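(* The container delivery scheduling problem (given an instance $\langle \mathcal{I},B\rangle$, find a feasible solution with the minimum number $m$ of bins) is $\mathcal{NP}$-hard.
   Context: An instance $\langle \mathcal{I},B\rangle$ of the container delivery scheduling problem consists of a set $\mathcal{I}=\{1,\ldots,n\}$ of items, each item $i$ having a due time $d_i\in\mathbb{Z}^+$, and an inventory bound $B>0$. For a time $\tau\ge 0$ put $\delta_i(\tau)=|d_i-\tau|$. A feasible solution with $m$ bins is a partition of $\mathcal{I}$ into subsets (bins) $\mathcal{S}_1,\ldots,\mathcal{S}_m$ together with delivery times $\mu_1,\ldots,\mu_m\ge 0$ such that $\sum_{i\in\mathcal{S}_j}\delta_i(\mu_j)\le B$ for every $j\in\{1,\ldots,m\}$. Several bins may be delivered at the same time. The objective is to minimize $m$. *)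

theory Defs
  imports Complex_Main "HOL-Library.Disjoint_Sets" "HOL-Computational_Algebra.Polynomial"
begin

section \<open>Multi-tape Turing machines\<close>

text \<open>
  Tapes are infinite in both directions; a tape is its contents together with the head position.
  Symbol 0 is the blank, symbols 1 and 2 are the input and output letters False and True, and
  larger numbers are available as work symbols. States and symbols are natural numbers, and
  finiteness of the transition relation restricts a machine to finitely many of them.
\<close>

datatype direction = Left | Stay | Right

type_synonym tape = "(int \<Rightarrow> nat) \<times> int"
type_synonym config = "nat \<times> tape list"

fun read :: "tape \<Rightarrow> nat" where
  "read (t, h) = t h"

fun shift :: "direction \<Rightarrow> int" where
  "shift Left = - 1"
| "shift Stay = 0"
| "shift Right = 1"

fun act :: "nat \<times> direction \<Rightarrow> tape \<Rightarrow> tape" where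
  "act (a, r) (t, h) = (t(h := a), h + shift r)"

text \<open>
  A transition \<open>(q, as, q', us)\<close> applies in state \<open>q\<close> when the heads read the symbols \<open>as\<close>; it
  enters state \<open>q'\<close> and performs, on each tape, the write-and-move action listed in \<open>us\<close>.
\<close>

record machine =
  tapes :: nat
  start :: nat
  accept :: nat
  trans :: "(nat \<times> nat list \<times> nat \<times> (nat \<times> direction) list) set"

definition turing_machine :: "machine \<Rightarrow> bool" where
  "turing_machine M \<longleftrightarrow>
     tapes M \<ge> 1 \<and> finite (trans M) \<and>
     (\<forall>(q, as, q', us) \<in> trans M.
        length as = tapes M \<and> length us = tapes M \<and> q \<noteq> accept M)"

definition deterministic :: "machine \<Rightarrow> bool" where
  "deterministic M \<longleftrightarrow>
     (\<forall>q as q1 us1 q2 us2. (q, as, q1, us1) \<in> trans M \<longrightarrow> (q, as, q2, us2) \<in> trans M \<longrightarrow>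
        q1 = q2 \<and> us1 = us2)"

inductive step :: "machine \<Rightarrow> config \<Rightarrow> config \<Rightarrow> bool" for M where
  "(q, map read ts, q', us) \<in> trans M \<Longrightarrow> step M (q, ts) (q', map2 act us ts)"

definition halted :: "machine \<Rightarrow> config \<Rightarrow> bool" where
  "halted M c \<longleftrightarrow> (\<nexists>c'. step M c c')"

text \<open>Contents of a tape carrying the word \<open>w\<close> in cells 0, 1, ... and blanks elsewhere.\<close>

definition word_tape :: "bool list \<Rightarrow> int \<Rightarrow> nat" where
  "word_tape w i =
     (if 0 \<le> i \<and> i < int (length w) then (if w ! nat i then 2 else 1) else 0)"

text \<open>The input is on the first tape, and all other tapes are blank.\<close>

definition init :: "machine \<Rightarrow> bool list \<Rightarrow> config" where
  "init M w = (start M, (word_tape w, 0) # replicate (tapes M - 1) (word_tape [], 0))"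


section \<open>NP and NP-hardness\<close>

text \<open>
  NP via nondeterministic machines all of whose computations halt within a polynomial number of
  steps; a word is accepted if some computation reaches the accepting state.
\<close>

definition NP :: "bool list set set" where
  "NP = {L. \<exists>M (p :: nat poly). turing_machine M \<and>
     (\<forall>w n c. (step M ^^ n) (init M w) c \<longrightarrow> n \<le> poly p (length w)) \<and>
     (\<forall>w. w \<in> L \<longleftrightarrow> (\<exists>c. (step M)\<^sup>*\<^sup>* (init M w) c \<and> fst c = accept M))}"

text \<open>A machine computing a function leaves the result as the contents of its last tape.\<close>

definition poly_time_computable :: "(bool list \<Rightarrow> bool list) \<Rightarrow> bool" where
  "poly_time_computable f \<longleftrightarrow>
     (\<exists>M (p :: nat poly). turing_machine M \<and> deterministic M \<and>
        (\<forall>w. \<exists>n c. n \<le> poly p (length w) \<and> (step M ^^ n) (init M w) c \<and> halted M c \<and>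
               fst (last (snd c)) = word_tape (f w)))"

definition poly_reducible :: "bool list set \<Rightarrow> bool list set \<Rightarrow> bool" where
  "poly_reducible L A \<longleftrightarrow> (\<exists>f. poly_time_computable f \<and> (\<forall>w. w \<in> L \<longleftrightarrow> f w \<in> A))"

definition NP_hard :: "bool list set \<Rightarrow> bool" where
  "NP_hard A \<longleftrightarrow> (\<forall>L \<in> NP. poly_reducible L A)"


section \<open>Binary encoding\<close>

text \<open>Binary digits, least significant first, without leading zeros.\<close>

fun bits :: "nat \<Rightarrow> bool list" where
  "bits n = (if n = 0 then [] else odd n # bits (n div 2))"

declare bits.simps [simp del]

text \<open>
  Self-delimiting form: every digit is preceded by True, and the number is terminated by False.
  The length is twice the number of binary digits, plus one.
\<close>

definition encode_nat :: "nat \<Rightarrow> bool list" where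
  "encode_nat n = concat (map (\<lambda>b. [True, b]) (bits n)) @ [False]"

lemma bits_inject: "bits m = bits n \<longleftrightarrow> m = n"
proof (induction m arbitrary: n rule: less_induct)
  case (less m)
  show ?case
  proof (cases "m = 0 \<or> n = 0")
    case True
    then show ?thesis by (auto simp: bits.simps[of m] bits.simps[of n] bits.simps[of 0])
  next
    case False
    then have "bits m = odd m # bits (m div 2)" "bits n = odd n # bits (n div 2)"
      by (simp_all add: bits.simps[of m] bits.simps[of n])
    with False have "bits m = bits n \<longleftrightarrow> odd m = odd n \<and> m div 2 = n div 2"
      using less.IH[of "m div 2" "n div 2"] by simp
    also have "\<dots> \<longleftrightarrow> m = n"
      by presburger
    finally show ?thesis .
  qed
qed

lemma encode_nat_append_inject:
  "encode_nat m @ v = encode_nat n @ w \<longleftrightarrow> m = n \<and> v = w"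
proof -
  have "concat (map (\<lambda>b. [True, b]) xs) @ False # v =
        concat (map (\<lambda>b. [True, b]) ys) @ False # w \<longleftrightarrow> xs = ys \<and> v = w"
    for xs ys
  proof (induction xs arbitrary: ys)
    case Nil
    then show ?case by (cases ys) auto
  next
    case (Cons x xs)
    then show ?case by (cases ys) auto
  qed
  then show ?thesis by (simp add: encode_nat_def bits_inject)
qed

lemma concat_encode_nat_inject:
  "concat (map encode_nat xs) = concat (map encode_nat ys) \<longleftrightarrow> xs = ys"
proof (induction xs arbitrary: ys)
  case Nil
  then show ?case by (cases ys) (auto simp: encode_nat_def)
next
  case (Cons x xs)
  show ?case
  proof (cases ys)
    case Nil
    then show ?thesis by (simp add: encode_nat_def)
  next
    case (Cons y ys')
    then show ?thesis by (simp add: encode_nat_append_inject Cons.IH)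
  qed
qed


section \<open>Minimization problems\<close>

record ('i, 's) min_problem =
  instances :: "'i set"
  encode :: "'i \<Rightarrow> bool list"
  solutions :: "'i \<Rightarrow> 's set"
  objective :: "'s \<Rightarrow> nat"

text \<open>
  The associated decision problem: given an instance and a number \<open>K\<close>, is there a feasible
  solution of objective value at most \<open>K\<close>? As usual, a minimization problem is called NP-hard if
  its decision problem is, with respect to polynomial-time many-one reductions.
\<close>

definition decision_problem :: "('i, 's) min_problem \<Rightarrow> bool list set" where
  "decision_problem P =
     {encode_nat K @ encode P x | K x.
        x \<in> instances P \<and> (\<exists>s \<in> solutions P x. objective P s \<le> K)}"

definition NP_hard_minimization :: "('i, 's) min_problem \<Rightarrow> bool" where
  "NP_hard_minimization P \<longleftrightarrow> NP_hard (decision_problem P)"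


section \<open>Container delivery scheduling\<close>

text \<open>
  An instance \<open>(ds, B)\<close> has the items \<open>1, ..., length ds\<close>; item \<open>i\<close> has due time \<open>ds ! (i - 1)\<close>.
  The inventory bound is rational so that an instance has a finite encoding.
\<close>

type_synonym cds_instance = "nat list \<times> rat"

definition due_time :: "nat list \<Rightarrow> nat \<Rightarrow> nat" where
  "due_time ds i = ds ! (i - 1)"

definition delta :: "nat list \<Rightarrow> nat \<Rightarrow> real \<Rightarrow> real" where
  "delta ds i \<tau> = \<bar>real (due_time ds i) - \<tau>\<bar>"

text \<open>A solution is the list of its bins, each given with its delivery time.\<close>

type_synonym cds_solution = "(nat set \<times> real) list"

fun cds_feasible :: "cds_instance \<Rightarrow> cds_solution \<Rightarrow> bool" where
  "cds_feasible (ds, B) bins \<longleftrightarrow>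
     distinct (map fst bins) \<and> partition_on {1..length ds} (set (map fst bins)) \<and>
     (\<forall>(S, \<mu>) \<in> set bins. 0 \<le> \<mu> \<and> (\<Sum>i\<in>S. delta ds i \<mu>) \<le> of_rat B)"

fun cds_encode :: "cds_instance \<Rightarrow> bool list" where
  "cds_encode (ds, B) =
     (let (a, b) = quotient_of B
      in encode_nat (nat a) @ encode_nat (nat b) @ concat (map encode_nat ds))"

definition container_delivery :: "(cds_instance, cds_solution) min_problem" where
  "container_delivery =
     \<lparr>instances = {(ds, B). (\<forall>d \<in> set ds. 0 < d) \<and> 0 < B},
      encode = cds_encode,
      solutions = (\<lambda>x. {bins. cds_feasible x bins}),
      objective = length\<rparr>"

lemma inj_on_cds_encode: "inj_on cds_encode (instances container_delivery)"
proof (rule inj_onI)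
  fix x y
  assume xy: "x \<in> instances container_delivery" "y \<in> instances container_delivery"
    and eq: "cds_encode x = cds_encode y"
  obtain ds B ds' B' where x: "x = (ds, B)" and y: "y = (ds', B')"
    by (cases x, cases y)
  obtain a b a' b' where q: "quotient_of B = (a, b)" "quotient_of B' = (a', b')"
    by (metis surj_pair)
  have "0 < B" "0 < B'"
    using xy by (auto simp: x y container_delivery_def)
  moreover have "0 < b" "0 < b'"
    using q by (auto dest: quotient_of_denom_pos)
  ultimately have "0 < a" "0 < a'"
    using q by (auto dest!: quotient_of_div simp: zero_less_divide_iff)
  moreover have "nat a = nat a' \<and> nat b = nat b' \<and> ds = ds'"
    using eq by (simp add: x y q encode_nat_append_inject concat_encode_nat_inject)
  ultimately have "quotient_of B = quotient_of B'" "ds = ds'"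
    using q \<open>0 < b\<close> \<open>0 < b'\<close> by auto
  then show "x = y"
    by (simp add: x y quotient_of_inject_eq)
qed

end

theory Submission
  imports Defs "HOL-Library.Countable"
begin

text \<open>
  A nondeterministic computation is first turned into a tiling problem. Its configurations are
  written as rows of cells, the rows are concatenated to one long word (a helix), and every position
  carries a tile whose colours have to agree with those of its neighbours at distance 1 (the chosen
  transition and the moving heads) and at distance of one row (the next configuration). Choosing a
  tile for each position such that all colours agree is a system of linear equations with bounded
  coefficients, so reading the equations as digits in a large base gives a subset sum problem.

  For the scheduling problem take two bins, a large cluster of items with due time \<open>Y\<close> and another
  one with due time \<open>q * Y\<close>. A bin containing half of both clusters is too expensive, so each cluster
  dominates one of the bins and fixes its delivery time. If there are \<open>q + 1\<close> tiles and \<open>G\<close>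
  positions, then an item with due time \<open>(q + 1) * Y + a\<close>, where \<open>a\<close> is small, costs \<open>q * Y + a\<close> in
  the first and \<open>Y + a\<close> in the second bin. With the bound \<open>q * G * Y + b\<close> exactly \<open>G\<close> of the
  \<open>(q + 1) * G\<close> items must be in the first bin. One filler item with due time slightly larger than
  \<open>Y\<close> makes the two remaining budgets for the small parts \<open>a\<close> meet in an equation.

  The reduction is computed by a short sequence of transducers, which repeatedly sweep over their
  input and may rewrite it in place. The only ones that are not finite-state passes write
  out all shifts of one track of the input against another, or count symbols in binary.
\<close>

section \<open>Transducers with an input and an output tape\<close>

text \<open>The helix makes all tile items alike: neighbours sit at fixed distances, so a tile at
  position \<open>g\<close> has digits only in the blocks \<open>g\<close>, \<open>g + 1\<close> and
  \<open>g + W\<close>. The items are therefore shifts of one pattern, two markers a row apart moved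
  past a fixed track, and writing the numbers needs no arithmetic beyond shifting and counting. The
  base is a power of two that depends on the machine only, so a block of digits is a bit string of
  constant length, which a finite control can write.

  On the scheduling side the obstacle is that delivery times are free reals. A cluster that has at
  least as many items in a bin as there are items outside the clusters acts as an anchor: moving the
  time away from it never pays. After that only multiples of \<open>Y\<close> and small parts remain
  to be compared. The budgets for the small parts are two inequalities; with the filler the small
  parts add up to exactly twice the budget, which forces equality in both. A fixed number of two
  bins is therefore enough for hardness.\<close>

definition nword :: "nat list \<Rightarrow> int \<Rightarrow> nat" where
  "nword xs i = (if 0 \<le> i \<and> i < int (length xs) then xs ! nat i else 0)"

lemma nword_Nil: "nword [] = (\<lambda>_. 0)"
  by (auto simp: nword_def)

lemma nword_at: "nword (ps @ a # xs) (int (length ps)) = a"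
  by (simp add: nword_def)

lemma nword_end: "nword ps (int (length ps)) = 0"
  by (simp add: nword_def)

lemma nword_neg: "nword ps (- 1) = 0"
  by (simp add: nword_def)

lemma nword_update: "(nword (ps @ a # xs))(int (length ps) := b) = nword (ps @ b # xs)"
  by (rule ext) (auto simp: nword_def nth_append nth_Cons' nat_less_iff)

lemma nword_append: "(nword ps)(int (length ps) := b) = nword (ps @ (if b = 0 then [] else [b]))"
  by (rule ext) (auto simp: nword_def nth_append nth_Cons' nat_less_iff)

lemma nword_snoc_erase: "(nword (ps @ [a]))(int (length ps) := 0) = nword ps"
  by (rule ext) (auto simp: nword_def nth_append nth_Cons' nat_less_iff)

lemma word_tape_eq_nword: "word_tape w = nword (map (\<lambda>b. if b then 2 else 1) w)"
  by (rule ext) (auto simp: nword_def word_tape_def nat_less_iff)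

text \<open>
  A transducer reads its input tape from left to right. A step replaces the symbol under the head
  and appends a word to the output tape. At the end of the input the transducer appends a word
  and either stops or makes another sweep over the rewritten input.
\<close>

type_synonym 'q rule = "'q \<Rightarrow> nat \<Rightarrow> 'q \<times> nat \<times> nat list"
type_synonym 'q end_rule = "'q \<Rightarrow> nat list \<times> 'q option"

fun sweep :: "'q rule \<Rightarrow> 'q \<Rightarrow> nat list \<Rightarrow> 'q \<times> nat list \<times> nat list" where
  "sweep d q [] = (q, [], [])"
| "sweep d q (a # xs) =
     (let (q', a', os) = d q a; (q'', xs', os') = sweep d q' xs in (q'', a' # xs', os @ os'))"

inductive sweeps :: "'q rule \<Rightarrow> 'q end_rule \<Rightarrow> 'q \<Rightarrow> nat list \<Rightarrow> nat \<Rightarrow> nat list \<Rightarrow> bool"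
  for d e where
  stop: "sweep d q xs = (q', xs', os) \<Longrightarrow> e q' = (os', None) \<Longrightarrow> sweeps d e q xs 1 (os @ os')"
| again: "sweep d q xs = (q', xs', os) \<Longrightarrow> e q' = (os', Some q'') \<Longrightarrow> sweeps d e q'' xs' n ys \<Longrightarrow>
     sweeps d e q xs (Suc n) (os @ os' @ ys)"

text \<open>
  Before it stops, the machine erases its input tape: two tapes suffice for any sequence of
  transducers, because they take turns as input and output tape.
\<close>

datatype 'q ctl = Scan 'q | Emit "nat list" "'q ctl" | Back 'q | Erase | Rewind | Done

instance ctl :: (countable) countable
  by countable_datatype

text \<open>Words contain no blank, so a blank marks either end: \<open>Back\<close> and
  \<open>Erase\<close> run left to cell -1 and step right to cell 0. While writing, the output head
  rests on the first blank behind the output; the last step of \<open>Erase\<close> moves it one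
  cell back, where \<open>Rewind\<close> starts.\<close>

fun ctl_step :: "'q rule \<Rightarrow> 'q end_rule \<Rightarrow> 'q ctl \<Rightarrow> nat \<Rightarrow> nat \<Rightarrow>
    ('q ctl \<times> (nat \<times> direction) \<times> (nat \<times> direction)) option" where
  "ctl_step d e (Scan q) a b =
     (if a \<noteq> 0 then let (q', a', os) = d q a in Some (Emit os (Scan q'), (a', Right), (b, Stay))
      else let (os, k) = e q in
        Some (Emit os (case k of Some q' \<Rightarrow> Back q' | None \<Rightarrow> Erase), (0, Left), (b, Stay)))"
| "ctl_step d e (Emit [] s) a b = Some (s, (a, Stay), (b, Stay))"
| "ctl_step d e (Emit (x # os) s) a b = Some (Emit os s, (a, Stay), (x, Right))"
| "ctl_step d e (Back q) a b =
     (if a \<noteq> 0 then Some (Back q, (a, Left), (b, Stay)) else Some (Scan q, (0, Right), (b, Stay)))"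
| "ctl_step d e Erase a b =
     (if a \<noteq> 0 then Some (Erase, (0, Left), (b, Stay)) else Some (Rewind, (0, Right), (b, Left)))"
| "ctl_step d e Rewind a b =
     (if b \<noteq> 0 then Some (Rewind, (a, Stay), (b, Left)) else Some (Done, (a, Stay), (0, Right)))"
| "ctl_step d e Done a b = None"

text \<open>One construction serves both directions: the flag decides which of the two tapes plays
  the role of the input.\<close>

definition arrange :: "bool \<Rightarrow> 'a \<Rightarrow> 'a \<Rightarrow> 'a list" where
  "arrange r x y = (if r then [x, y] else [y, x])"

lemma arrange_simps [simp]:
  "length (arrange r x y) = 2" "map f (arrange r x y) = arrange r (f x) (f y)"
  "arrange r x y = arrange r x' y' \<longleftrightarrow> x = x' \<and> y = y'"
  by (auto simp: arrange_def)

lemma map2_arrange [simp]: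
  "map2 g (arrange r x y) (arrange r x' y') = arrange r (g x x') (g y y')"
  by (simp add: arrange_def)

lemma arrange_swap: "arrange (\<not> r) x y = arrange r y x"
  by (simp add: arrange_def)

text \<open>
  The result is on the second tape if \<open>r\<close> holds and on the first tape otherwise.
\<close>

definition produces :: "bool \<Rightarrow> nat \<Rightarrow> (bool list \<Rightarrow> nat list) \<Rightarrow> bool" where
  "produces r A f \<longleftrightarrow> (\<forall>w. set (f w) \<subseteq> {1..A}) \<and>
     (\<exists>M (p :: nat poly). turing_machine M \<and> deterministic M \<and> tapes M = 2 \<and>
        (\<forall>w. length (f w) \<le> poly p (length w)) \<and>
        (\<forall>w. \<exists>n \<le> poly p (length w). (step M ^^ n) (init M w)
               (accept M, arrange r (\<lambda>_. 0, 0) (nword (f w), 0))))"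

lemma produces_input:
  assumes "2 \<le> A"
  shows "produces False A (map (\<lambda>b. if b then 2 else 1))"
proof -
  let ?M = "\<lparr>tapes = 2, start = 0, accept = 0, trans = {}\<rparr>"
  have "turing_machine ?M" "deterministic ?M"
    by (auto simp: turing_machine_def deterministic_def)
  moreover have "(step ?M ^^ 0) (init ?M w)
      (accept ?M, arrange False (\<lambda>_. 0, 0) (nword (map (\<lambda>b. if b then 2 else 1) w), 0))" for w
    by (simp add: init_def arrange_def word_tape_eq_nword nword_Nil)
  moreover have "length (map (\<lambda>b. if b then 2 else 1) w) \<le> poly [:0, 1:] (length w)"
    for w :: "bool list" by simp
  ultimately show ?thesis
    unfolding produces_def using assms
    by (intro conjI exI[of _ ?M] exI[of _ "[:0, 1:] :: nat poly"])
      (auto intro!: exI[of _ 0])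
qed

lemma produces_poly_time:
  assumes "produces True A f" "\<And>w. set (f w) \<subseteq> {1, 2}"
  shows "poly_time_computable (\<lambda>w. map (\<lambda>x. x = 2) (f w))"
proof -
  obtain M and p :: "nat poly" where M: "turing_machine M" "deterministic M"
    and run: "\<And>w. \<exists>n \<le> poly p (length w). (step M ^^ n) (init M w)
               (accept M, arrange True (\<lambda>_. 0, 0) (nword (f w), 0))"
    using assms(1) unfolding produces_def by blast
  have "halted M (accept M, ts)" for ts
    using M(1) by (auto simp: halted_def turing_machine_def step.simps)
  moreover have "word_tape (map (\<lambda>x. x = 2) (f w)) = nword (f w)" for w
  proof -
    have "map (\<lambda>b. if b then 2 else 1) (map (\<lambda>x. x = 2) (f w)) = f w"
      using assms(2)[of w] by (auto intro!: map_idI)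
    then show ?thesis by (simp only: word_tape_eq_nword)
  qed
  ultimately show ?thesis
    unfolding poly_time_computable_def using M run
    by (intro exI[of _ M] exI[of _ p]) (fastforce simp: arrange_def)
qed

section \<open>Running a transducer after a machine\<close>

locale transducer_phase =
  fixes d :: "('q :: countable) rule" and e :: "'q end_rule" and S :: "'q set" and A K :: nat
    and q0 :: 'q and M0 :: machine and r :: bool
  assumes finite_S: "finite S" and q0: "q0 \<in> S"
    and d: "\<And>q a q' a' os. q \<in> S \<Longrightarrow> a \<in> {1..A} \<Longrightarrow> d q a = (q', a', os) \<Longrightarrow>
        q' \<in> S \<and> a' \<in> {1..A} \<and> set os \<subseteq> {1..A} \<and> length os \<le> K"
    and e: "\<And>q os k. q \<in> S \<Longrightarrow> e q = (os, k) \<Longrightarrow>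
        set os \<subseteq> {1..A} \<and> length os \<le> K \<and> set_option k \<subseteq> S"
    and M0: "turing_machine M0" "deterministic M0" "tapes M0 = 2"
begin

text \<open>Finite although the type of control states is not: pending words have length at most
  \<open>K\<close>, and only three kinds of continuation occur.\<close>

definition Q :: "'q ctl set" where
  "Q = {Erase, Rewind, Done} \<union> Scan ` S \<union> Back ` S \<union>
     (\<lambda>(os, s). Emit os s) `
       ({os. set os \<subseteq> {1..A} \<and> length os \<le> K} \<times> ({Erase} \<union> Scan ` S \<union> Back ` S))"

text \<open>Control states get odd numbers, since the states of \<open>M0\<close> are renamed to
  even ones in the combined machine.\<close>

definition enc :: "'q ctl \<Rightarrow> nat" where "enc s = Suc (2 * to_nat s)"

text \<open>The transitions are those of \<open>M0\<close>, the link from its accepting state to the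
  first scan, and the control table. The link keeps the machine deterministic because no transition
  of \<open>M0\<close> leaves its accepting state.\<close>

definition M :: machine where
  "M = \<lparr>tapes = 2, start = 2 * start M0, accept = enc Done,
     trans = (\<lambda>(q, as, q', us). (2 * q, as, 2 * q', us)) ` trans M0 \<union>
       (\<lambda>(a, b). (2 * accept M0, arrange r a b, enc (Scan q0), arrange r (a, Stay) (b, Stay))) `
         ({..A} \<times> {..A}) \<union>
       (\<lambda>(s, a, b). case the (ctl_step d e s a b) of
            (s', u, v) \<Rightarrow> (enc s, arrange r a b, enc s', arrange r u v)) `
         ((Q - {Done}) \<times> {..A} \<times> {..A})\<rparr>"

lemma finite_Q: "finite Q"
proof -
  have "finite {os. set os \<subseteq> {1..A} \<and> length os \<le> K}"
    by (rule finite_lists_length_le) simp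
  then show ?thesis using finite_S by (auto simp: Q_def)
qed

lemma enc_inject [simp]: "enc s = enc s' \<longleftrightarrow> s = s'"
  by (simp add: enc_def)

lemma enc_odd [simp]: "enc s \<noteq> 2 * n" "2 * n \<noteq> enc s"
  unfolding enc_def by presburger+

lemma tapes_M [simp]: "tapes M = 2" and accept_M [simp]: "accept M = enc Done"
  and start_M [simp]: "start M = 2 * start M0"
  by (simp_all add: M_def)

lemma turing_machine_M: "turing_machine M"
  using M0 finite_Q unfolding turing_machine_def
  by (auto simp: M_def split: prod.splits)

lemma deterministic_M: "deterministic M"
  using M0 unfolding deterministic_def turing_machine_def
  by (auto simp: M_def split: prod.splits)

lemma old_run:
  "(step M0 ^^ n) (q, ts) (q', ts') \<Longrightarrow> (step M ^^ n) (2 * q, ts) (2 * q', ts')"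
proof (induction n arbitrary: q' ts')
  case (Suc n)
  then obtain q1 ts1 where *: "(step M0 ^^ n) (q, ts) (q1, ts1)" "step M0 (q1, ts1) (q', ts')"
    by auto
  from *(2) have "step M (2 * q1, ts1) (2 * q', ts')"
  proof cases
    case (1 us)
    have "(2 * q1, map read ts1, 2 * q', us) \<in> trans M"
      using imageI[OF 1(2), of "\<lambda>(q, as, q', us). (2 * q, as, 2 * q', us)"] by (simp add: M_def)
    then show ?thesis unfolding 1(1) by (rule step.intros)
  qed
  with Suc.IH[OF *(1)] show ?case by auto
qed simp

lemma link_step:
  assumes "read x \<le> A" "read y \<le> A"
  shows "step M (2 * accept M0, arrange r x y) (enc (Scan q0), arrange r x y)"
proof -
  have "(2 * accept M0, map read (arrange r x y), enc (Scan q0),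
      arrange r (read x, Stay) (read y, Stay)) \<in> trans M"
    using assms by (auto simp: M_def)
  from step.intros[OF this] show ?thesis by (cases x, cases y) simp
qed

lemma ctl_run:
  assumes "ctl_step d e s (read x) (read y) = Some (s', u, v)" "s \<in> Q" "read x \<le> A" "read y \<le> A"
  shows "step M (enc s, arrange r x y) (enc s', arrange r (act u x) (act v y))"
proof -
  have "s \<noteq> Done" using assms(1) by auto
  then have "(enc s, map read (arrange r x y), enc s', arrange r u v) \<in> trans M"
    using assms imageI[of "(s, read x, read y)" "(Q - {Done}) \<times> {..A} \<times> {..A}"
        "\<lambda>(s, a, b). case the (ctl_step d e s a b) of
            (s', u, v) \<Rightarrow> (enc s, arrange r a b, enc s', arrange r u v)"]
    by (simp add: M_def)
  from step.intros[OF this] show ?thesis by simp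
qed

abbreviation conf :: "'q ctl \<Rightarrow> nat list \<Rightarrow> int \<Rightarrow> nat list \<Rightarrow> int \<Rightarrow> config" where
  "conf s xs i ys j \<equiv> (enc s, arrange r (nword xs, i) (nword ys, j))"

abbreviation writing :: "'q ctl \<Rightarrow> nat list \<Rightarrow> int \<Rightarrow> nat list \<Rightarrow> config" where
  "writing s xs i ys \<equiv> conf s xs i ys (int (length ys))"

lemma nword_le:
  assumes "set xs \<subseteq> {1..A}"
  shows "nword xs i \<le> A"
proof (cases "0 \<le> i \<and> i < int (length xs)")
  case True
  then have "xs ! nat i \<in> set xs" by (auto simp: nat_less_iff)
  then show ?thesis using True assms by (auto simp: nword_def)
qed (auto simp: nword_def)

lemma conf_step:
  assumes "ctl_step d e s (nword xs i) (nword ys j) = Some (s', (a, u), (b, v))" "s \<in> Q"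
    "set xs \<subseteq> {1..A}" "set ys \<subseteq> {1..A}"
    "(nword xs)(i := a) = nword xs'" "(nword ys)(j := b) = nword ys'"
    "i' = i + shift u" "j' = j + shift v"
  shows "step M (conf s xs i ys j) (conf s' xs' i' ys' j')"
  using ctl_run[of s "(nword xs, i)" "(nword ys, j)" s' "(a, u)" "(b, v)"] assms by (simp add: nword_le)

lemma nword_same: "nword xs i = a \<Longrightarrow> (nword xs)(i := a) = nword xs"
  by auto

lemma Emit_run:
  assumes "set os \<subseteq> {1..A}" "length os \<le> K" "s \<in> {Erase} \<union> Scan ` S \<union> Back ` S"
    and "set xs \<subseteq> {1..A}" "set ys \<subseteq> {1..A}"
  shows "(step M ^^ Suc (length os)) (writing (Emit os s) xs i ys)
     (writing s xs i (ys @ os))"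
  using assms
proof (induction os arbitrary: ys)
  case Nil
  have "step M (writing (Emit [] s) xs i ys) (writing s xs i ys)"
    by (rule conf_step) (use Nil in \<open>auto simp: Q_def nword_same image_iff\<close>)
  then show ?case by auto
next
  case (Cons x os)
  have "step M (writing (Emit (x # os) s) xs i ys)
      (writing (Emit os s) xs i (ys @ [x]))"
    by (rule conf_step) (use Cons.prems in \<open>auto simp: Q_def nword_same image_iff nword_append\<close>)
  moreover have "(step M ^^ Suc (length os)) (writing (Emit os s) xs i (ys @ [x]))
     (writing s xs i ((ys @ [x]) @ os))"
    by (rule Cons.IH) (use Cons.prems in auto)
  ultimately show ?case
    by (simp only: relpowp.simps(2)[of "Suc (length os)"] length_Cons)
      (metis (no_types, lifting) append.assoc append_Cons append_Nil relpowp_Suc_I2 relpowp.simps(2))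
qed

text \<open>Each symbol costs one scanning step, one step per emitted symbol and one to leave
  \<open>Emit\<close>, hence at most \<open>K + 2\<close>. The prefix \<open>ps\<close> is the part
  of the tape already rewritten.\<close>

lemma sweep_run:
  assumes "sweep d q xs = (q', xs', os)" "q \<in> S"
    "set ps \<subseteq> {1..A}" "set xs \<subseteq> {1..A}" "set ys \<subseteq> {1..A}"
  shows "q' \<in> S \<and> length xs' = length xs \<and> set xs' \<subseteq> {1..A} \<and> set os \<subseteq> {1..A} \<and>
    length os \<le> K * length xs \<and>
    (\<exists>n \<le> (K + 2) * length xs.
      (step M ^^ n) (writing (Scan q) (ps @ xs) (int (length ps)) ys)
        (writing (Scan q') (ps @ xs') (int (length (ps @ xs))) (ys @ os)))"
  using assms
proof (induction xs arbitrary: q ps ys q' xs' os)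
  case Nil
  then show ?case by (auto intro!: exI[of _ 0])
next
  case (Cons a xs)
  obtain q1 a1 os1 where 1: "d q a = (q1, a1, os1)" by (cases "d q a")
  obtain q2 xs2 os2 where 2: "sweep d q1 xs = (q2, xs2, os2)" by (cases "sweep d q1 xs")
  have eq: "q' = q2" "xs' = a1 # xs2" "os = os1 @ os2"
    using Cons.prems(1) 1 2 by auto
  have d1: "q1 \<in> S" "a1 \<in> {1..A}" "set os1 \<subseteq> {1..A}" "length os1 \<le> K"
    using d[OF Cons.prems(2) _ 1] Cons.prems by auto
  have "step M (writing (Scan q) (ps @ a # xs) (int (length ps)) ys)
      (writing (Emit os1 (Scan q1)) (ps @ a1 # xs) (int (length (ps @ [a1]))) ys)"
    by (rule conf_step[where a = a1 and u = Right and v = Stay and b = "nword ys (int (length ys))"])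
      (use Cons.prems 1 in \<open>auto simp: Q_def nword_same nword_at nword_update\<close>)
  moreover have "(step M ^^ Suc (length os1))
      (writing (Emit os1 (Scan q1)) (ps @ a1 # xs) (int (length (ps @ [a1]))) ys)
      (writing (Scan q1) (ps @ a1 # xs) (int (length (ps @ [a1]))) (ys @ os1))"
    by (rule Emit_run) (use d1 Cons.prems in auto)
  ultimately have r1: "(step M ^^ Suc (Suc (length os1)))
      (writing (Scan q) (ps @ a # xs) (int (length ps)) ys)
      (writing (Scan q1) (ps @ a1 # xs) (int (length (ps @ [a1]))) (ys @ os1))"
    by (rule relpowp_Suc_I2)
  have IH: "q2 \<in> S \<and> length xs2 = length xs \<and> set xs2 \<subseteq> {1..A} \<and> set os2 \<subseteq> {1..A} \<and>
    length os2 \<le> K * length xs \<and>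
    (\<exists>n \<le> (K + 2) * length xs.
      (step M ^^ n) (writing (Scan q1) ((ps @ [a1]) @ xs) (int (length (ps @ [a1]))) (ys @ os1))
        (writing (Scan q2) ((ps @ [a1]) @ xs2) (int (length ((ps @ [a1]) @ xs))) ((ys @ os1) @ os2)))"
    using Cons.IH[OF 2 d1(1), of "ps @ [a1]" "ys @ os1"] d1 Cons.prems by simp
  then obtain n where n: "n \<le> (K + 2) * length xs"
    "(step M ^^ n) (writing (Scan q1) (ps @ a1 # xs) (int (length (ps @ [a1]))) (ys @ os1))
        (writing (Scan q2) (ps @ a1 # xs2) (int (length (ps @ a # xs))) (ys @ os1 @ os2))"
    by auto
  have "(step M ^^ (Suc (Suc (length os1)) + n))
      (writing (Scan q) (ps @ a # xs) (int (length ps)) ys)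
      (writing (Scan q2) (ps @ a1 # xs2) (int (length (ps @ a # xs))) (ys @ os1 @ os2))"
    by (rule relpowp_trans[OF r1 n(2)])
  moreover have "Suc (Suc (length os1)) + n \<le> (K + 2) * length (a # xs)"
    using n d1 by simp
  ultimately have "\<exists>n \<le> (K + 2) * length (a # xs).
      (step M ^^ n) (writing (Scan q) (ps @ a # xs) (int (length ps)) ys)
        (writing (Scan q') (ps @ xs') (int (length (ps @ a # xs))) (ys @ os))"
    unfolding eq by blast
  then show ?case
    using IH d1 by (simp add: eq del: relpowp.simps)
qed

lemma end_run:
  assumes "e q = (os, k)" "q \<in> S" "set xs \<subseteq> {1..A}" "set ys \<subseteq> {1..A}"
  shows "(step M ^^ Suc (Suc (length os))) (writing (Scan q) xs (int (length xs)) ys)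
    (writing (case k of Some q' \<Rightarrow> Back q' | None \<Rightarrow> Erase) xs (int (length xs) - 1) (ys @ os))"
proof -
  let ?s = "case k of Some q' \<Rightarrow> Back q' | None \<Rightarrow> Erase"
  have e': "set os \<subseteq> {1..A}" "length os \<le> K" "set_option k \<subseteq> S"
    using e[OF assms(2,1)] by auto
  have "step M (writing (Scan q) xs (int (length xs)) ys)
     (writing (Emit os ?s) xs (int (length xs) - 1) ys)"
    by (rule conf_step[where a = 0 and u = Left and v = Stay and b = "nword ys (int (length ys))"])
      (use assms in \<open>auto simp: Q_def nword_same nword_end\<close>)
  moreover have "(step M ^^ Suc (length os)) (writing (Emit os ?s) xs (int (length xs) - 1) ys)
     (writing ?s xs (int (length xs) - 1) (ys @ os))"
    by (rule Emit_run) (use e' assms in \<open>auto split: option.splits\<close>)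
  ultimately show ?thesis by (rule relpowp_Suc_I2)
qed

lemma Back_run:
  assumes "q \<in> S" "set xs \<subseteq> {1..A}" "set ys \<subseteq> {1..A}" "i \<le> length xs"
  shows "(step M ^^ Suc i) (conf (Back q) xs (int i - 1) ys j) (conf (Scan q) xs 0 ys j)"
  using assms(4)
proof (induction i)
  case 0
  have "step M (conf (Back q) xs (- 1) ys j) (conf (Scan q) xs 0 ys j)"
    by (rule conf_step[where a = 0 and u = Right and v = Stay and b = "nword ys j"])
      (use assms in \<open>auto simp: Q_def nword_same nword_neg\<close>)
  then show ?case by auto
next
  case (Suc i)
  have "xs ! i \<in> {1..A}" using assms(2) Suc.prems by (meson Suc_le_lessD nth_mem subsetD)
  then have "nword xs (int i) \<noteq> 0" using Suc.prems by (auto simp: nword_def)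
  then have "step M (conf (Back q) xs (int (Suc i) - 1) ys j) (conf (Back q) xs (int i - 1) ys j)"
    by (intro conf_step[where a = "nword xs (int i)" and u = Left and v = Stay and b = "nword ys j"])
      (use assms in \<open>auto simp: Q_def nword_same nword_neg\<close>)
  moreover have "(step M ^^ Suc i) (conf (Back q) xs (int i - 1) ys j) (conf (Scan q) xs 0 ys j)"
    using Suc by simp
  ultimately show ?case by (rule relpowp_Suc_I2)
qed

lemma Erase_run:
  assumes "set xs \<subseteq> {1..A}" "set ys \<subseteq> {1..A}"
  shows "(step M ^^ Suc (length xs)) (conf Erase xs (int (length xs) - 1) ys j)
    (conf Rewind [] 0 ys (j - 1))"
  using assms(1)
proof (induction xs rule: rev_induct)
  case Nil
  have "step M (conf Erase [] (- 1) ys j) (conf Rewind [] 0 ys (j - 1))"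
    by (rule conf_step[where a = 0 and u = Right and v = Left and b = "nword ys j"])
      (use assms in \<open>auto simp: Q_def nword_same nword_neg\<close>)
  then show ?case by auto
next
  case (snoc x xs)
  have "step M (conf Erase (xs @ [x]) (int (length xs)) ys j) (conf Erase xs (int (length xs) - 1) ys j)"
    by (rule conf_step[where a = 0 and u = Left and v = Stay and b = "nword ys j"])
      (use assms snoc.prems in \<open>auto simp: Q_def nword_same nword_at nword_snoc_erase\<close>)
  moreover have "(step M ^^ Suc (length xs)) (conf Erase xs (int (length xs) - 1) ys j)
      (conf Rewind [] 0 ys (j - 1))"
    using snoc by simp
  ultimately have "(step M ^^ Suc (Suc (length xs))) (conf Erase (xs @ [x]) (int (length xs)) ys j)
      (conf Rewind [] 0 ys (j - 1))"
    by (rule relpowp_Suc_I2)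
  then show ?case by (simp del: relpowp.simps)
qed

lemma Rewind_run:
  assumes "set ys \<subseteq> {1..A}" "j \<le> length ys"
  shows "(step M ^^ Suc j) (conf Rewind [] 0 ys (int j - 1)) (conf Done [] 0 ys 0)"
  using assms(2)
proof (induction j)
  case 0
  have "step M (conf Rewind [] 0 ys (- 1)) (conf Done [] 0 ys 0)"
    by (rule conf_step[where a = 0 and u = Stay and v = Right and b = 0])
      (use assms in \<open>auto simp: Q_def nword_same nword_neg nword_Nil\<close>)
  then show ?case by auto
next
  case (Suc i)
  have "ys ! i \<in> {1..A}" using assms(1) Suc.prems by (meson Suc_le_lessD nth_mem subsetD)
  then have "nword ys (int i) \<noteq> 0" using Suc.prems by (auto simp: nword_def)
  then have "step M (conf Rewind [] 0 ys (int (Suc i) - 1)) (conf Rewind [] 0 ys (int i - 1))"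
    by (intro conf_step[where a = 0 and u = Stay and v = Left and b = "nword ys (int i)"])
      (use assms in \<open>auto simp: Q_def nword_same nword_neg nword_Nil\<close>)
  moreover have "(step M ^^ Suc i) (conf Rewind [] 0 ys (int i - 1)) (conf Done [] 0 ys 0)"
    using Suc by simp
  ultimately show ?case by (rule relpowp_Suc_I2)
qed

text \<open>One sweep, its final word and the return or erasure take at most
  \<open>(K + 3) * (length xs + 1)\<close> steps. Sweeps preserve the length of the input tape, so
  this is charged \<open>n\<close> times; \<open>length (ys @ zs) + 1\<close> pays for the final
  \<open>Rewind\<close>.\<close>

lemma sweeps_run:
  assumes "sweeps d e q xs n zs" "q \<in> S" "set xs \<subseteq> {1..A}" "set ys \<subseteq> {1..A}"
  shows "set zs \<subseteq> {1..A} \<and> length zs \<le> n * (K * (length xs + 1)) \<and>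
    (\<exists>m \<le> n * ((K + 3) * (length xs + 1)) + length (ys @ zs) + 1.
       (step M ^^ m) (writing (Scan q) xs 0 ys) (conf Done [] 0 (ys @ zs) 0))"
  using assms
proof (induction arbitrary: ys rule: sweeps.induct)
  case (stop q xs q' xs' os os')
  note sw = sweep_run[OF stop(1,3) _ stop(4,5), of "[]", simplified]
  have ok: "q' \<in> S" "length xs' = length xs" "set xs' \<subseteq> {1..A}" "set os \<subseteq> {1..A}"
    "length os \<le> K * length xs" using sw by auto
  have ok': "set os' \<subseteq> {1..A}" "length os' \<le> K" using e[OF ok(1) stop(2)] by auto
  have oks: "set (ys @ os) \<subseteq> {1..A}" "set (ys @ os @ os') \<subseteq> {1..A}" using ok ok' stop by auto
  obtain n where n: "n \<le> (K + 2) * length xs"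
    "(step M ^^ n) (writing (Scan q) xs 0 ys)
        (writing (Scan q') xs' (int (length xs')) (ys @ os))"
    using sw by auto
  note n(2)
  also have "(step M ^^ Suc (Suc (length os')))
      (writing (Scan q') xs' (int (length xs')) (ys @ os))
      (writing Erase xs' (int (length xs') - 1) (ys @ os @ os'))"
    using end_run[OF stop(2) ok(1,3) oks(1)] by simp
  also (relpowp_trans) have "(step M ^^ Suc (length xs'))
      (writing Erase xs' (int (length xs') - 1) (ys @ os @ os'))
      (conf Rewind [] 0 (ys @ os @ os') (int (length (ys @ os @ os')) - 1))"
    by (rule Erase_run[OF ok(3) oks(2)])
  also (relpowp_trans) have "(step M ^^ Suc (length (ys @ os @ os')))
      (conf Rewind [] 0 (ys @ os @ os') (int (length (ys @ os @ os')) - 1))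
      (conf Done [] 0 (ys @ os @ os') 0)"
    by (rule Rewind_run[OF oks(2)]) simp
  finally (relpowp_trans) have run: "(step M ^^ (n + Suc (Suc (length os')) + Suc (length xs') + Suc (length (ys @ os @ os'))))
      (writing (Scan q) xs 0 ys) (conf Done [] 0 (ys @ os @ os') 0)" .
  have "n + Suc (Suc (length os')) + Suc (length xs') + Suc (length (ys @ os @ os'))
      \<le> 1 * ((K + 3) * (length xs + 1)) + length (ys @ os @ os') + 1"
    using n(1) ok(2) ok'(2) by (simp add: algebra_simps)
  with run have "\<exists>m \<le> 1 * ((K + 3) * (length xs + 1)) + length (ys @ os @ os') + 1.
      (step M ^^ m) (writing (Scan q) xs 0 ys) (conf Done [] 0 (ys @ os @ os') 0)"
    by blast
  moreover have "length (os @ os') \<le> 1 * (K * (length xs + 1))"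
    using ok ok' by simp
  ultimately show ?case using ok(4) ok'(1) by simp
next
  case (again q xs q' xs' os os' q'' n zs)
  note sw = sweep_run[OF again(1,5) _ again(6,7), of "[]", simplified]
  have ok: "q' \<in> S" "length xs' = length xs" "set xs' \<subseteq> {1..A}" "set os \<subseteq> {1..A}"
    "length os \<le> K * length xs" using sw by auto
  have ok': "set os' \<subseteq> {1..A}" "length os' \<le> K" "q'' \<in> S" using e[OF ok(1) again(2)] by auto
  have oks: "set (ys @ os) \<subseteq> {1..A}" "set (ys @ os @ os') \<subseteq> {1..A}" using ok ok' again by auto
  obtain l where l: "l \<le> (K + 2) * length xs"
    "(step M ^^ l) (writing (Scan q) xs 0 ys)
        (writing (Scan q') xs' (int (length xs')) (ys @ os))"
    using sw by auto
  note IH = again.IH[OF ok'(3) ok(3) oks(2)]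
  from IH obtain m where m: "m \<le> n * ((K + 3) * (length xs' + 1)) + length ((ys @ os @ os') @ zs) + 1"
    "(step M ^^ m) (writing (Scan q'') xs' 0 (ys @ os @ os'))
      (conf Done [] 0 (ys @ os @ os' @ zs) 0)" by auto
  note l(2)
  also have "(step M ^^ Suc (Suc (length os')))
      (writing (Scan q') xs' (int (length xs')) (ys @ os))
      (writing (Back q'') xs' (int (length xs') - 1) (ys @ os @ os'))"
    using end_run[OF again(2) ok(1,3) oks(1)] by simp
  also (relpowp_trans) have "(step M ^^ Suc (length xs'))
      (writing (Back q'') xs' (int (length xs') - 1) (ys @ os @ os'))
      (writing (Scan q'') xs' 0 (ys @ os @ os'))"
    by (rule Back_run[OF ok'(3) ok(3) oks(2)]) simp
  also (relpowp_trans) note m(2)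
  finally (relpowp_trans) have run: "(step M ^^ (l + Suc (Suc (length os')) + Suc (length xs') + m))
      (writing (Scan q) xs 0 ys) (conf Done [] 0 (ys @ os @ os' @ zs) 0)" .
  have "l + Suc (Suc (length os')) + Suc (length xs') + m
      \<le> Suc n * ((K + 3) * (length xs + 1)) + length (ys @ os @ os' @ zs) + 1"
    using l(1) m(1) ok(2) ok'(2) by (simp add: algebra_simps)
  with run have "\<exists>m \<le> Suc n * ((K + 3) * (length xs + 1)) + length (ys @ os @ os' @ zs) + 1.
      (step M ^^ m) (writing (Scan q) xs 0 ys) (conf Done [] 0 (ys @ os @ os' @ zs) 0)"
    by blast
  moreover have "length (os @ os' @ zs) \<le> Suc n * (K * (length xs + 1))"
    using ok ok' IH by simp
  ultimately show ?case using ok(4) ok'(1) IH by simp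
qed

end

text \<open>A finite control emits boundedly many symbols per step, so linearly many sweeps take
  quadratic time in the length of the intermediate word. The allowance
  \<open>length (f w) + 2\<close> fits both multi-sweep constructions below: one sweep per shift, or
  one per binary digit and a last one.\<close>

lemma produces_transducer:
  fixes d :: "('q :: countable) rule" and e :: "'q end_rule"
  assumes f: "produces r A f" and S: "finite S" "q0 \<in> S"
    and d: "\<And>q a. q \<in> S \<Longrightarrow> a \<in> {1..A} \<Longrightarrow>
        (case d q a of (q', a', os) \<Rightarrow> q' \<in> S \<and> a' \<in> {1..A} \<and> set os \<subseteq> {1..A})"
    and e: "\<And>q. q \<in> S \<Longrightarrow> (case e q of (os, k) \<Rightarrow> set os \<subseteq> {1..A} \<and> set_option k \<subseteq> S)"
    and g: "\<And>w. \<exists>n \<le> length (f w) + 2. sweeps d e q0 (f w) n (g w)"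
  shows "produces (\<not> r) A g"
proof -
  obtain M0 and p :: "nat poly" where M0: "turing_machine M0" "deterministic M0" "tapes M0 = 2"
    and len: "\<And>w. length (f w) \<le> poly p (length w)"
    and run: "\<And>w. \<exists>n \<le> poly p (length w). (step M0 ^^ n) (init M0 w)
               (accept M0, arrange r (\<lambda>_. 0, 0) (nword (f w), 0))"
    using f unfolding produces_def by blast
  have sf: "set (f w) \<subseteq> {1..A}" for w using f unfolding produces_def by blast
  define L where "L = (\<lambda>(q, a). length (snd (snd (d q a)))) ` (S \<times> {1..A}) \<union> (\<lambda>q. length (fst (e q))) ` S"
  define K where "K = Max L"
  have "finite L" using S by (simp add: L_def)
  then have "x \<le> K" if "x \<in> L" for x using that by (simp add: K_def)
  then have K: "length (snd (snd (d q a))) \<le> K" "length (fst (e q)) \<le> K" if "q \<in> S" "a \<in> {1..A}" for q a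
    using that unfolding L_def by blast+
  have K2: "length (fst (e q)) \<le> K" if "q \<in> S" for q
    using that \<open>\<And>x. x \<in> L \<Longrightarrow> x \<le> K\<close> unfolding L_def by blast
  interpret transducer_phase d e S A K q0 M0 "\<not> r"
  proof
    show "q' \<in> S \<and> a' \<in> {1..A} \<and> set os \<subseteq> {1..A} \<and> length os \<le> K"
      if "q \<in> S" "a \<in> {1..A}" "d q a = (q', a', os)" for q a q' a' os
      using d[OF that(1,2)] K(1)[OF that(1,2)] that(3) by simp
    show "set os \<subseteq> {1..A} \<and> length os \<le> K \<and> set_option k \<subseteq> S"
      if "q \<in> S" "e q = (os, k)" for q os k
      using e[OF that(1)] K2[OF that(1)] that(2) by simp
  qed (use S M0 in auto)
  define P where "P = (p + [:2:]) * ([:K + 3:] * (p + [:1:]))"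
  have P: "n * ((K + 3) * (l + 1)) \<le> poly P x" if "n \<le> l + 2" "l \<le> poly p x" for n l x
    using that unfolding P_def by (simp del: mult_Suc_right mult_Suc) (intro mult_mono; simp)
  \<comment> \<open>One \<open>P\<close> bounds the sweeps, the other the output that is rewound;
    the constant 2 is the linking step and the last rewinding step.\<close>
  have main: "set (g w) \<subseteq> {1..A} \<and> length (g w) \<le> poly P (length w) \<and>
     (\<exists>m \<le> poly (p + P + P + [:2:]) (length w). (step M ^^ m) (init M w)
       (accept M, arrange (\<not> r) (\<lambda>_. 0, 0) (nword (g w), 0)))" for w
  proof -
    obtain n where n: "n \<le> length (f w) + 2" "sweeps d e q0 (f w) n (g w)" using g by blast
    note sr = sweeps_run[OF n(2) S(2) sf, of "[]", simplified]
    have "length (g w) \<le> n * (K * (length (f w) + 1))" using sr by simp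
    also have "\<dots> \<le> n * ((K + 3) * (length (f w) + 1))" by (intro mult_mono) auto
    finally have lg: "length (g w) \<le> poly P (length w)" using P[OF n(1) len] by linarith
    obtain m where m: "m \<le> n * ((K + 3) * (length (f w) + 1)) + length (g w) + 1"
      "(step M ^^ m) (conf (Scan q0) (f w) 0 [] 0) (conf Done [] 0 (g w) 0)"
      using sr by auto
    obtain l where l: "l \<le> poly p (length w)"
      "(step M0 ^^ l) (init M0 w) (accept M0, arrange r (\<lambda>_. 0, 0) (nword (f w), 0))"
      using run by blast
    have "init M w = (2 * start M0, snd (init M0 w))" by (simp add: init_def M0)
    moreover have "init M0 w = (start M0, snd (init M0 w))" by (simp add: init_def)
    ultimately have "(step M ^^ l) (init M w)
        (2 * accept M0, arrange (\<not> r) (nword (f w), 0) (nword [], 0))"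
      using old_run[of l "start M0" "snd (init M0 w)"] l(2) by (simp add: arrange_swap nword_Nil)
    also have "(step M ^^ 1) \<dots> (conf (Scan q0) (f w) 0 [] 0)"
      using link_step[of "(nword (f w), 0)" "(nword [], 0)"] sf[of w]
      by (simp add: nword_le eq_OO)
    also (relpowp_trans) note m(2)
    finally (relpowp_trans) have "(step M ^^ (l + 1 + m)) (init M w) (conf Done [] 0 (g w) 0)" .
    moreover have "l + 1 + m \<le> poly (p + P + P + [:2:]) (length w)"
      using l(1) m(1) P[OF n(1) len] lg by simp
    ultimately have "\<exists>m \<le> poly (p + P + P + [:2:]) (length w). (step M ^^ m) (init M w)
       (conf Done [] 0 (g w) 0)"
      by blast
    then show ?thesis using sr lg by (simp add: nword_Nil)
  qed
  then have "length (g w) \<le> poly (p + P + P + [:2:]) (length w)" for w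
    by (simp add: add_increasing add_increasing2 le_SucI trans_le_add2)
  with main show ?thesis
    unfolding produces_def using turing_machine_M deterministic_M tapes_M by blast
qed

section \<open>One-pass transducers that leave their input as it is\<close>

fun transduce :: "('q \<Rightarrow> nat \<Rightarrow> 'q \<times> nat list) \<Rightarrow> 'q \<Rightarrow> nat list \<Rightarrow> 'q \<times> nat list" where
  "transduce t q [] = (q, [])"
| "transduce t q (a # xs) = (let (q', os) = t q a; (q'', os') = transduce t q' xs in (q'', os @ os'))"

lemma transduce_append:
  "transduce t q (xs @ ys) =
     (let (q', os) = transduce t q xs; (q'', os') = transduce t q' ys in (q'', os @ os'))"
  by (induction xs arbitrary: q) (auto split: prod.splits)

lemma transduce_append_eq:
  "transduce t q xs = (q', os) \<Longrightarrow> transduce t q' ys = (q'', os') \<Longrightarrow>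
     transduce t q (xs @ ys) = (q'', os @ os')"
  by (simp add: transduce_append)

lemma transduce_map:
  assumes "\<And>x. x \<in> set xs \<Longrightarrow> t q x = (q, g x)"
  shows "transduce t q xs = (q, concat (map g xs))"
  using assms by (induction xs) auto

lemma produces_transduce:
  fixes t :: "'q :: countable \<Rightarrow> nat \<Rightarrow> 'q \<times> nat list"
  assumes f: "produces r A f" and S: "finite S" "q0 \<in> S"
    and t: "\<And>q a. q \<in> S \<Longrightarrow> a \<in> {1..A} \<Longrightarrow> fst (t q a) \<in> S \<and> set (snd (t q a)) \<subseteq> {1..A}"
    and e: "\<And>q. q \<in> S \<Longrightarrow> set (e q) \<subseteq> {1..A}"
  shows "produces (\<not> r) A (\<lambda>w. let (q, os) = transduce t q0 (f w) in os @ e q)"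
proof (rule produces_transducer[OF f S])
  let ?d = "\<lambda>q a. let (q', os) = t q a in (q', a, os)"
  show "case ?d q a of (q', a', os) \<Rightarrow> q' \<in> S \<and> a' \<in> {1..A} \<and> set os \<subseteq> {1..A}"
    if "q \<in> S" "a \<in> {1..A}" for q a
    using t[OF that] that by (auto split: prod.splits)
  show "case (e q, None) of (os, k) \<Rightarrow> set os \<subseteq> {1..A} \<and> set_option k \<subseteq> S"
    if "q \<in> S" for q using e[OF that] by simp
  have "sweep ?d q xs = (fst (transduce t q xs), xs, snd (transduce t q xs))" for q xs
    by (induction xs arbitrary: q) (auto split: prod.splits)
  from sweeps.stop[OF this, of "\<lambda>q. (e q, None)"]
  have "sweeps ?d (\<lambda>q. (e q, None)) q0 xs 1 (let (q, os) = transduce t q0 xs in os @ e q)" for xs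
    by (simp add: case_prod_unfold Let_def)
  then show "\<exists>n \<le> length (f w) + 2. sweeps ?d (\<lambda>q. (e q, None)) q0 (f w) n
      (let (q, os) = transduce t q0 (f w) in os @ e q)" for w
    by (intro exI[of _ 1]) simp
qed

text \<open>The result has to end on the last tape; if it is on the first one, an identity phase
  copies it over.\<close>

lemma produces_final:
  assumes "produces r A f" "\<And>w. set (f w) \<subseteq> {1, 2}"
  shows "poly_time_computable (\<lambda>w. map (\<lambda>x. x = 2) (f w))"
proof (cases r)
  case True
  then show ?thesis using assms produces_poly_time by simp
next
  case False
  have "snd (transduce (\<lambda>_ a. ((), [a])) () xs) = xs" for xs
    by (induction xs) (auto split: prod.splits)
  then have "f = (\<lambda>w. let (q, os) = transduce (\<lambda>_ a. ((), [a])) () (f w) in os @ (\<lambda>_. []) q)"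
    by (simp add: case_prod_unfold)
  moreover have "produces True A (\<lambda>w. let (q, os) = transduce (\<lambda>_ a. ((), [a])) () (f w) in os @ (\<lambda>_. []) q)"
    using produces_transduce[OF assms(1), of "{()}" "()" "\<lambda>_ a. ((), [a])" "\<lambda>_. []"] False by simp
  ultimately show ?thesis using assms(2) produces_poly_time by simp
qed

section \<open>Shifting a track\<close>

text \<open>
  A symbol \<open>3 * f + m\<close> with \<open>1 \<le> f\<close> and \<open>m < 3\<close> carries \<open>f\<close> on a fixed track and \<open>m\<close> on a
  moving track; symbol 1 is a separator. A marker 1 at the start of the moving track controls the
  shifting: the last copy is the one where it has reached the end.
\<close>

definition track :: "nat list \<Rightarrow> nat list \<Rightarrow> nat list" where
  "track fs ms = map2 (\<lambda>f m. 3 * f + m) fs ms"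

lemma track_Cons [simp]: "track (f # fs) (m # ms) = (3 * f + m) # track fs ms"
  and track_Nil [simp]: "track [] ms = []"
  by (simp_all add: track_def)

lemma length_track [simp]: "length (track fs ms) = min (length fs) (length ms)"
  by (simp add: track_def)

lemma track_append:
  "length fs = length ms \<Longrightarrow> track (fs @ fs') (ms @ ms') = track fs ms @ track fs' ms'"
  by (simp add: track_def)

definition shifted :: "nat list \<Rightarrow> nat \<Rightarrow> nat list" where
  "shifted ms s = replicate s 0 @ take (length ms - s) ms"

definition shifts :: "nat list \<Rightarrow> nat list \<Rightarrow> nat list" where
  "shifts fs ms = concat (map (\<lambda>s. track fs (shifted ms s) @ [1]) [0..<length fs])"

lemma length_shifted [simp]: "s \<le> length ms \<Longrightarrow> length (shifted ms s) = length ms"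
  by (simp add: shifted_def)

lemma butlast_shifted: "s < length ms \<Longrightarrow> 0 # butlast (shifted ms s) = shifted ms (Suc s)"
  by (rule nth_equalityI) (auto simp: shifted_def nth_Cons' nth_butlast nth_append)

lemma last_shifted: "s < length ms \<Longrightarrow> last (shifted ms s) = ms ! (length ms - Suc s)"
  by (subst last_conv_nth) (auto simp: shifted_def nth_append Suc_diff_Suc)

text \<open>The state is the moving component of the symbol just passed, so a sweep emits the
  current copy and leaves the next shift on the tape. The value 1 for symbols below 3 keeps the rule
  total without writing blanks.\<close>

definition shift_rule :: "nat rule" where
  "shift_rule c a = (a mod 3, if a < 3 then 1 else 3 * (a div 3) + c, [a])"

text \<open>The final state is the component that falls off the end. If the marker 1 occurs only at
  the start of the unshifted track, this is 1 exactly when all shifts have been written.\<close>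

definition shift_end :: "nat end_rule" where
  "shift_end c = ([1], if c = 1 then None else Some 0)"

lemma sweep_shift_rule:
  assumes "length fs = length ms" "\<And>f. f \<in> set fs \<Longrightarrow> 1 \<le> f" "\<And>m. m \<in> set ms \<Longrightarrow> m < 3"
  shows "sweep shift_rule c (track fs ms) =
    (last (c # ms), track fs (butlast (c # ms)), track fs ms)"
  using assms
proof (induction fs ms arbitrary: c rule: list_induct2)
  case (Cons f fs m ms)
  have "1 \<le> f" "m < 3" using Cons.prems by auto
  then have "shift_rule c (3 * f + m) = (m, 3 * f + c, [3 * f + m])"
    by (simp add: shift_rule_def)
  with Cons show ?case by simp
qed simp

lemma sweeps_shift:
  assumes "length fs = length ms" "\<And>f. f \<in> set fs \<Longrightarrow> 1 \<le> f"
    and ms: "ms \<noteq> []" "hd ms = 1" "\<And>m. m \<in> set (tl ms) \<Longrightarrow> m = 0 \<or> m = 2"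
    and "s < length fs"
  shows "sweeps shift_rule shift_end 0 (track fs (shifted ms s)) (length fs - s)
    (concat (map (\<lambda>s. track fs (shifted ms s) @ [1]) [s..<length fs]))"
  using assms(6)
proof (induction "length fs - s" arbitrary: s)
  case (Suc n)
  have lt: "m < 3" if "m \<in> set (shifted ms s)" for m
  proof -
    have "set ms = insert 1 (set (tl ms))" using ms by (cases ms) auto
    then have "m \<in> set ms \<Longrightarrow> m < 3" using ms(3) by fastforce
    moreover have "m = 0 \<or> m \<in> set ms" using that by (auto simp: shifted_def dest: in_set_takeD)
    ultimately show ?thesis by auto
  qed
  have ne: "shifted ms s \<noteq> []" using Suc.prems assms(1) by (auto simp: shifted_def)
  have sw: "sweep shift_rule 0 (track fs (shifted ms s)) =
     (ms ! (length ms - Suc s), track fs (shifted ms (Suc s)), track fs (shifted ms s))"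
    using sweep_shift_rule[of fs "shifted ms s" 0] assms(1,2) lt Suc.prems ne
    by (simp add: butlast_shifted last_shifted)
  show ?case
  proof (cases "Suc s = length fs")
    case True
    then have "ms ! (length ms - Suc s) = 1" using ms assms(1) by (simp add: hd_conv_nth)
    then have "shift_end (ms ! (length ms - Suc s)) = ([1], None)" by (simp add: shift_end_def)
    from sweeps.stop[where d = shift_rule and e = shift_end, OF sw this] show ?thesis
      by (simp add: True[symmetric])
  next
    case False
    then have i: "length ms - Suc s = Suc (length ms - Suc (Suc s))" "length ms - Suc (Suc s) < length (tl ms)"
      using Suc.prems assms(1) by auto
    then have "ms ! (length ms - Suc s) = tl ms ! (length ms - Suc (Suc s))"
      by (simp add: nth_tl)
    then have "ms ! (length ms - Suc s) \<in> set (tl ms)"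
      using i nth_mem by metis
    then have "shift_end (ms ! (length ms - Suc s)) = ([1], Some 0)"
      using ms(3) by (fastforce simp: shift_end_def)
    moreover have "sweeps shift_rule shift_end 0 (track fs (shifted ms (Suc s))) (length fs - Suc s)
      (concat (map (\<lambda>s. track fs (shifted ms s) @ [1]) [Suc s..<length fs]))"
      by (rule Suc.hyps(1)) (use Suc.hyps(2) Suc.prems False in auto)
    ultimately have "sweeps shift_rule shift_end 0 (track fs (shifted ms s)) (Suc (length fs - Suc s))
      (track fs (shifted ms s) @ [1] @ concat (map (\<lambda>s. track fs (shifted ms s) @ [1]) [Suc s..<length fs]))"
      using sweeps.again[where d = shift_rule and e = shift_end, OF sw] by blast
    then show ?thesis using Suc.prems by (simp add: upt_rec[of s] Suc_diff_Suc)
  qed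
qed simp

text \<open>The condition \<open>A mod 3 = 2\<close> closes the alphabet under replacing the moving
  component of a symbol by any of 0, 1, 2.\<close>

lemma produces_shifts:
  assumes f: "produces r A (\<lambda>w. track (fs w) (ms w))" and A: "A mod 3 = 2"
    and len: "\<And>w. length (fs w) = length (ms w)" and fs: "\<And>w f. f \<in> set (fs w) \<Longrightarrow> 1 \<le> f"
    and ms: "\<And>w. ms w \<noteq> []" "\<And>w. hd (ms w) = 1" "\<And>w m. m \<in> set (tl (ms w)) \<Longrightarrow> m = 0 \<or> m = 2"
  shows "produces (\<not> r) A (\<lambda>w. shifts (fs w) (ms w))"
proof (rule produces_transducer[OF f])
  show "finite {0, 1, 2 :: nat}" "0 \<in> {0, 1, 2 :: nat}" by auto
  show "case shift_rule q a of (q', a', os) \<Rightarrow> q' \<in> {0, 1, 2} \<and> a' \<in> {1..A} \<and> set os \<subseteq> {1..A}"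
    if "q \<in> {0, 1, 2}" "a \<in> {1..A}" for q a
  proof -
    have "3 * (a div 3) + q \<le> 3 * (A div 3) + 2"
      using that div_le_mono[of a A 3] by auto
    also have "\<dots> = A" using A by presburger
    finally show ?thesis using that A by (auto simp: shift_rule_def)
  qed
  show "case shift_end q of (os, k) \<Rightarrow> set os \<subseteq> {1..A} \<and> set_option k \<subseteq> {0, 1, 2}" for q
    using A by (cases "A = 0") (auto simp: shift_end_def)
  show "\<exists>n \<le> length (track (fs w) (ms w)) + 2.
      sweeps shift_rule shift_end 0 (track (fs w) (ms w)) n (shifts (fs w) (ms w))" for w
    using sweeps_shift[of "fs w" "ms w" 0] len[of w] fs[of _ w] ms(1,2)[of w] ms(3)[of _ w]
    by (intro exI[of _ "length (fs w)"]) (auto simp: shifts_def shifted_def)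
qed

section \<open>Counting in binary\<close>

text \<open>
  Every sweep deletes every other marked symbol and outputs the parity of their number, which is
  the next binary digit.
\<close>

definition count_rule :: "(nat \<Rightarrow> bool) \<Rightarrow> (bool \<times> bool \<times> bool) rule" where
  "count_rule P = (\<lambda>(first, seen, odd) a. let os = (if first then [a] else []) in
     if P a then ((first, True, \<not> odd), if odd then a else 1, os) else ((first, seen, odd), a, os))"

definition count_end :: "(bool \<Rightarrow> nat) \<Rightarrow> (bool \<times> bool \<times> bool) end_rule" where
  "count_end b = (\<lambda>(first, seen, odd). if seen then ([b odd], Some (False, False, False)) else ([], None))"

text \<open>Alternate marked symbols survive, beginning with the second one, or with the first if
  \<open>par\<close> holds; deleted ones become 1, which is unmarked by assumption.\<close>

lemma sweep_count_rule:
  assumes "\<not> P 1"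
  shows "\<exists>xs'. sweep (count_rule P) (first, seen, par) xs =
    ((first, seen \<or> filter P xs \<noteq> [], par \<noteq> odd (length (filter P xs))), xs',
      if first then xs else []) \<and>
    length (filter P xs') = (length (filter P xs) + (if par then 1 else 0)) div 2"
proof (induction xs arbitrary: seen par)
  case (Cons a xs)
  show ?case
  proof (cases "P a")
    case True
    with Cons[of True "\<not> par"] assms show ?thesis
      by (cases par) (auto simp: count_rule_def)
  next
    case False
    with Cons[of seen par] show ?thesis by (auto simp: count_rule_def)
  qed
qed auto

lemma sweeps_count:
  assumes P: "\<not> P 1"
  shows "sweeps (count_rule P) (count_end b) (first, False, False) xs (length (bits (length (filter P xs))) + 1)
    ((if first then xs else []) @ map b (bits (length (filter P xs))))"
proof (induction "length (filter P xs)" arbitrary: xs first rule: less_induct)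
  case less
  obtain xs' where sw: "sweep (count_rule P) (first, False, False) xs =
    ((first, filter P xs \<noteq> [], odd (length (filter P xs))), xs', if first then xs else [])"
    "length (filter P xs') = length (filter P xs) div 2"
    using sweep_count_rule[of P first False False xs] P by auto
  show ?case
  proof (cases "filter P xs = []")
    case True
    then have "count_end b (first, filter P xs \<noteq> [], odd (length (filter P xs))) = ([], None)"
      by (simp add: count_end_def)
    from sweeps.stop[where d = "count_rule P" and e = "count_end b", OF sw(1) this] show ?thesis by (simp add: True bits.simps[of 0])
  next
    case False
    then have "count_end b (first, filter P xs \<noteq> [], odd (length (filter P xs))) =
        ([b (odd (length (filter P xs)))], Some (False, False, False))"
      by (simp add: count_end_def)
    from sweeps.again[where d = "count_rule P" and e = "count_end b", OF sw(1) this less[of xs' False]]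
      False sw(2)
    show ?thesis
      by (cases first) (simp_all add: bits.simps[of "length (filter P xs)"])
  qed
qed

lemma length_bits_le: "length (bits n) \<le> n"
proof (induction n rule: less_induct)
  case (less n)
  show ?case
  proof (cases "n = 0")
    case False
    with less[of "n div 2"] show ?thesis by (simp add: bits.simps[of n])
  qed (simp add: bits.simps)
qed

lemma produces_count:
  assumes f: "produces r A f" and A: "1 \<le> A" "b True \<in> {1..A}" "b False \<in> {1..A}" and P: "\<not> P 1"
  shows "produces (\<not> r) A (\<lambda>w. f w @ map b (bits (length (filter P (f w)))))"
proof (rule produces_transducer[OF f])
  show "finite (UNIV :: (bool \<times> bool \<times> bool) set)" "(True, False, False) \<in> UNIV" by auto
  show "case count_rule P q a of (q', a', os) \<Rightarrow> q' \<in> UNIV \<and> a' \<in> {1..A} \<and> set os \<subseteq> {1..A}"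
    if "a \<in> {1..A}" for q a
    using that A by (cases q) (auto simp: count_rule_def)
  show "case count_end b q of (os, k) \<Rightarrow> set os \<subseteq> {1..A} \<and> set_option k \<subseteq> UNIV" for q
  proof (cases q)
    case (fields x y z)
    then show ?thesis using A by (cases z) (auto simp: count_end_def)
  qed
  show "\<exists>n \<le> length (f w) + 2. sweeps (count_rule P) (count_end b) (True, False, False) (f w) n
      (f w @ map b (bits (length (filter P (f w)))))" for w
    using sweeps_count[of P b True "f w"] P length_bits_le[of "length (filter P (f w))"]
      order.trans[OF length_bits_le length_filter_le[of P "f w"]]
    by (intro exI[of _ "length (bits (length (filter P (f w)))) + 1"]) auto
qed

section \<open>Padding the input\<close>

definition mark :: "nat list \<Rightarrow> nat list" where
  "mark c = track c (1 # replicate (length c - 1) 0)"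

text \<open>The shifts of a word of length \<open>L\<close> have \<open>L * (L + 1)\<close> symbols,
  separators included. Blanking everything after the first copy leaves \<open>L * L\<close> pad
  symbols, so one round at least squares the length, and iterating it exceeds any
  polynomial.\<close>

definition pad :: "nat list \<Rightarrow> nat list" where
  "pad c = c @ replicate (length c * length c) 3"

abbreviation mark_copies :: "nat list \<Rightarrow> nat list" where
  "mark_copies c \<equiv> shifts c (1 # replicate (length c - 1) 0)"

lemma track_replicate_0: "track fs (replicate (length fs) 0) = map ((*) 3) fs"
  by (induction fs) auto

lemma mark_Cons: "mark (f # fs) = (3 * f + 1) # map ((*) 3) fs"
  by (simp add: mark_def track_replicate_0)

lemma mark_append: "c \<noteq> [] \<Longrightarrow> mark (c @ c') = mark c @ map ((*) 3) c'"
  by (cases c) (simp_all add: mark_Cons)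

lemma length_mark [simp]: "length (mark c) = length c"
  by (cases c) (simp_all add: mark_Cons mark_def)

lemma mark_ge_3:
  assumes "\<And>f. f \<in> set c \<Longrightarrow> 1 \<le> f" "a \<in> set (mark c)"
  shows "3 \<le> a"
proof (cases c)
  case (Cons f fs)
  then have "f \<in> set c" "\<And>f'. f' \<in> set fs \<Longrightarrow> f' \<in> set c" by auto
  then show ?thesis using assms Cons by (fastforce simp: mark_Cons)
qed (use assms in \<open>simp add: mark_def\<close>)

lemma shifted_0 [simp]: "shifted ms 0 = ms"
  by (simp add: shifted_def)

lemma length_shifts:
  "length fs = length ms \<Longrightarrow> length (shifts fs ms) = length fs * (length fs + 1)"
proof -
  assume "length fs = length ms"
  then have "map (\<lambda>s. length (track fs (shifted ms s) @ [1])) [0..<length fs] =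
      map (\<lambda>_. length fs + 1) [0..<length fs]"
    by (intro map_cong) auto
  then show ?thesis
    by (simp add: shifts_def length_concat o_def sum_list_triv del: map_eq_conv)
qed

lemma shifts_first:
  "fs \<noteq> [] \<Longrightarrow> shifts fs ms = track fs ms @ 1 # concat (map (\<lambda>s. track fs (shifted ms s) @ [1]) [1..<length fs])"
  by (simp add: shifts_def upt_conv_Cons)

lemma track_mem: "a \<in> set (track fs ms) \<Longrightarrow> \<exists>f\<in>set fs. \<exists>m\<in>set ms. a = 3 * f + m"
  unfolding track_def set_map by (force dest: set_zip_leftD set_zip_rightD)

lemma track_ge_3: "(\<And>f. f \<in> set fs \<Longrightarrow> 1 \<le> f) \<Longrightarrow> a \<in> set (track fs ms) \<Longrightarrow> 3 \<le> a"
  by (force simp: track_def dest: set_zip_leftD)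

lemma produces_mark_shifts:
  assumes "produces r A (\<lambda>w. mark (c w))" "A mod 3 = 2" "\<And>w. c w \<noteq> []" "\<And>w f. f \<in> set (c w) \<Longrightarrow> 1 \<le> f"
  shows "produces (\<not> r) A (\<lambda>w. mark_copies (c w))"
  by (rule produces_shifts) (use assms in \<open>auto simp: mark_def Suc_diff_Suc\<close>)

lemma produces_pad:
  assumes "produces r A (\<lambda>w. mark (c w))" "A mod 3 = 2" "9 \<le> A"
    "\<And>w. c w \<noteq> []" "\<And>w f. f \<in> set (c w) \<Longrightarrow> 1 \<le> f"
  shows "produces r A (\<lambda>w. mark (pad (c w)))"
proof -
  \<comment> \<open>The state turns at the first separator. The symbol 9 is
    \<open>3 * 3 + 0\<close>, a blank without a marker.\<close>
  define t where "t q a = (if q \<or> a = 1 then (True, [9]) else (False, [a :: nat]))" for q a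
  have keep: "transduce t False xs = (False, xs)" if "\<And>a. a \<in> set xs \<Longrightarrow> 3 \<le> a" for xs
    using transduce_map[of xs t False "\<lambda>a. [a]"] that by (fastforce simp: t_def)
  have blank: "transduce t True xs = (True, replicate (length xs) 9)" for xs
    by (induction xs) (auto simp: t_def)
  have "produces (\<not> \<not> r) A (\<lambda>w. let (q, os) = transduce t False
      (mark_copies (c w)) in os @ (\<lambda>_. []) q)"
    using produces_mark_shifts[OF assms(1,2,4,5)]
    by (rule produces_transduce[where S = UNIV]) (use assms(3) in \<open>auto simp: t_def\<close>)
  moreover have "(let (q, os) = transduce t False (mark_copies (c w))
      in os @ (\<lambda>_. []) q) = mark (pad (c w))" for w
  proof -
    let ?ms = "1 # replicate (length (c w) - 1) 0"
    let ?rest = "concat (map (\<lambda>s. track (c w) (shifted ?ms s) @ [1]) [1..<length (c w)])"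
    have sh: "mark_copies (c w) = mark (c w) @ 1 # ?rest"
      using assms(4) by (simp add: shifts_first mark_def)
    have "length (mark_copies (c w)) = length (c w) * (length (c w) + 1)"
      using assms(4) by (simp add: length_shifts)
    then have "length (1 # ?rest) = length (c w) * length (c w)"
      unfolding sh by simp
    moreover have "transduce t False (mark (c w)) = (False, mark (c w))"
      by (rule keep) (rule mark_ge_3[OF assms(5)])
    moreover have "transduce t False (1 # ?rest) = (True, replicate (length (1 # ?rest)) 9)"
      using blank[of ?rest] by (simp add: t_def)
    ultimately have "transduce t False (mark_copies (c w)) =
        (True, mark (c w) @ replicate (length (c w) * length (c w)) 9)"
      unfolding sh by (metis transduce_append_eq)
    then show ?thesis using assms(4) by (simp add: pad_def mark_append)
  qed
  ultimately show ?thesis by simp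
qed

lemma pad_props:
  "pad c = [] \<longleftrightarrow> c = []" "f \<in> set (pad c) \<Longrightarrow> f = 3 \<or> f \<in> set c"
  "length c * length c \<le> length (pad c)"
  by (auto simp: pad_def)

lemma pad_funpow:
  "\<exists>l. (pad ^^ j) c = c @ replicate l 3" "length c ^ 2 ^ j \<le> length ((pad ^^ j) c)"
proof -
  show "\<exists>l. (pad ^^ j) c = c @ replicate l 3"
  proof (induction j)
    case (Suc j)
    then show ?case by (auto simp: pad_def replicate_add[symmetric])
  qed (simp add: exI[of _ 0])
  show "length c ^ 2 ^ j \<le> length ((pad ^^ j) c)"
  proof (induction j)
    case (Suc j)
    have "length c ^ 2 ^ Suc j = length c ^ 2 ^ j * length c ^ 2 ^ j"
      by (simp add: power_add[symmetric] mult_2)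
    also have "\<dots> \<le> length ((pad ^^ j) c) * length ((pad ^^ j) c)"
      using Suc by (intro mult_mono) auto
    also have "\<dots> \<le> length ((pad ^^ Suc j) c)" using pad_props(3) by simp
    finally show ?case .
  qed simp
qed

lemma produces_pad_funpow:
  assumes "produces r A (\<lambda>w. mark (c w))" "A mod 3 = 2" "9 \<le> A"
    "\<And>w. c w \<noteq> []" "\<And>w f. f \<in> set (c w) \<Longrightarrow> 1 \<le> f"
  shows "produces r A (\<lambda>w. mark ((pad ^^ j) (c w)))"
proof (induction j)
  case (Suc j)
  have "(pad ^^ j) (c w) \<noteq> []" for w
    using pad_funpow(1)[of j "c w"] assms(4) by auto
  moreover have "1 \<le> f" if "f \<in> set ((pad ^^ j) (c w))" for w f
    using pad_funpow(1)[of j "c w"] assms(5)[of f w] that by auto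
  ultimately have "produces r A (\<lambda>w. mark (pad ((pad ^^ j) (c w))))"
    by (rule produces_pad[OF Suc assms(2,3)])
  then show ?case by simp
qed (use assms in simp)

definition letter :: "bool \<Rightarrow> nat" where "letter b = (if b then 2 else 1)"

text \<open>The symbol 10 is \<open>3 * 3 + 1\<close>, a marked blank: if the input is empty, the
  marker has to go to the first pad symbol.\<close>

lemma produces_start:
  assumes "10 \<le> A" "1 \<le> l"
  shows "produces True A (\<lambda>w. mark (map letter w @ replicate l 3))"
proof -
  define t where "t q a = (if a \<le> 2 then (True, [3 * a + (if q then 0 else 1)]) else (True, [1 :: nat]))" for q a
  define e where "e q = (if q then replicate l (9 :: nat) else 10 # replicate (l - 1) 9)" for q
  have "produces False A (map letter)"
    using produces_input[of A] assms by (simp add: letter_def[abs_def])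
  then have "produces (\<not> False) A (\<lambda>w. let (q, os) = transduce t False (map letter w) in os @ e q)"
    by (rule produces_transduce[where S = UNIV]) (use assms in \<open>auto simp: t_def e_def\<close>)
  moreover have "(let (q, os) = transduce t False (map letter w) in os @ e q) =
      mark (map letter w @ replicate l 3)" for w
  proof -
    have *: "transduce t True (map letter w) = (True, map ((*) 3) (map letter w))" for w
      by (induction w) (auto simp: t_def letter_def)
    show ?thesis
    proof (cases w)
      case Nil
      then show ?thesis using assms by (cases l) (auto simp: e_def mark_Cons)
    next
      case (Cons b v)
      then show ?thesis using *[of v] by (simp add: t_def e_def mark_Cons letter_def)
    qed
  qed
  ultimately show ?thesis by simp
qed

section \<open>The first row and the grid\<close>

text \<open>
  The row starts with the state column; the head is in the middle and has at least
  \<open>length c\<close> blank cells to its left. The letters of \<open>c\<close> are 1 and 2, and 3 stands for a blank.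
\<close>

definition row_code :: "nat \<Rightarrow> (nat \<Rightarrow> bool \<Rightarrow> nat) \<Rightarrow> nat list \<Rightarrow> nat list" where
  "row_code vs vc c = vs # replicate (length c + 1) (vc 3 False) @
     vc (hd c) True # map (\<lambda>f. vc f False) (tl c) @
     replicate ((length c - 2) * (length c + 1) + 1) (vc 3 False)"

lemma length_row_code:
  assumes "2 \<le> length c"
  shows "length (row_code vs vc c) = Suc (length c * (length c + 1))"
proof -
  obtain m where "length c = 2 + m" using assms le_Suc_ex by blast
  then show ?thesis by (simp add: row_code_def algebra_simps)
qed

text \<open>The row is the list of shifts of \<open>c\<close>, rewritten symbol by symbol, plus one
  state column. The first copy and its separator become the \<open>length c + 1\<close> blanks left
  of the head, the second copy supplies the letters, and everything after it becomes blanks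
  again.\<close>

lemma produces_row:
  assumes c: "produces r A (\<lambda>w. mark (c w))" "A mod 3 = 2" "\<And>w. 2 \<le> length (c w)"
      "\<And>w f. f \<in> set (c w) \<Longrightarrow> f \<in> {1, 2, 3}"
    and v: "\<And>f b. f \<in> {1, 2, 3} \<Longrightarrow> 1 \<le> vc f b \<and> 3 * vc f b + 2 \<le> A" "1 \<le> vs" "3 * vs + 2 \<le> A"
  shows "produces r A (\<lambda>w. mark (row_code vs vc (c w)))"
proof -
  \<comment> \<open>Components outside the intended range are clamped, so that every reply of the
    transducer lies in the alphabet whatever it reads.\<close>
  define cl where "cl a = (if a div 3 \<in> {1, 2} then a div 3 else 3)" for a :: nat
  define t :: "nat \<Rightarrow> nat \<Rightarrow> nat \<times> nat list" where "t q a = (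
    if q = 0 then (1, [3 * vs + 1, 3 * vc 3 False])
    else if q = 1 then (if a = 1 then 2 else 1, [3 * vc 3 False])
    else if q = 2 then (3, [3 * vc (cl a) True])
    else if q = 3 then (if a = 1 then (4, [3 * vc 3 False]) else (3, [3 * vc (cl a) False]))
    else (4, [3 * vc 3 False]))" for q a
  have ne: "c w \<noteq> []" for w using c(3)[of w] by auto
  have ge: "1 \<le> f" if "f \<in> set (c w)" for w f using c(4)[OF that] by auto
  have "produces (\<not> \<not> r) A (\<lambda>w. let (q, os) = transduce t 0
      (mark_copies (c w)) in os @ (\<lambda>_. []) q)"
    using produces_mark_shifts[OF c(1,2) ne ge]
  proof (rule produces_transduce[where S = "{..4}"])
    show "fst (t q a) \<in> {..4} \<and> set (snd (t q a)) \<subseteq> {1..A}" for q a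
    proof -
      have "1 \<le> vc (cl a) b \<and> 3 * vc (cl a) b + 2 \<le> A" "1 \<le> vc 3 b \<and> 3 * vc 3 b + 2 \<le> A" for b
        using v(1)[of "cl a" b] v(1)[of 3 b] by (auto simp: cl_def)
      from this[of True] this[of False] show ?thesis using v(2,3) by (auto simp: t_def)
    qed
  qed auto
  moreover have "(let (q, os) = transduce t 0 (mark_copies (c w))
      in os @ (\<lambda>_. []) q) = mark (row_code vs vc (c w))" for w
  proof -
    let ?c = "c w" and ?L = "length (c w)"
    let ?ms = "1 # replicate (?L - 1) 0"
    let ?rest = "concat (map (\<lambda>s. track ?c (shifted ?ms s) @ [1]) [2..<?L])"
    obtain f fs where cw: "?c = f # fs" using ne[of w] by (cases ?c) auto
    have "[1..<?L] = 1 # [2..<?L]"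
      using c(3)[of w] by (subst upt_conv_Cons) (auto simp: numeral_2_eq_2)
    then have sh: "mark_copies ?c = mark ?c @ [1] @ track ?c (shifted ?ms 1) @ 1 # ?rest"
      using ne[of w] by (simp add: shifts_first mark_def)
    have "length (mark_copies ?c) = ?L * (?L + 1)" using ne[of w] by (simp add: length_shifts)
    then have len: "length (1 # ?rest) = (?L - 2) * (?L + 1) + 1"
    proof -
      obtain m where "?L = 2 + m" using c(3)[of w] le_Suc_ex by blast
      moreover have "length (shifted ?ms 1) = ?L" using c(3)[of w] ne[of w] by simp
      ultimately show ?thesis using \<open>length (mark_copies ?c) = ?L * (?L + 1)\<close> unfolding sh
        by (simp add: algebra_simps)
    qed
    have 1: "transduce t 1 xs = (1, replicate (length xs) (3 * vc 3 False))" if "\<And>a. a \<in> set xs \<Longrightarrow> 3 \<le> a" for xs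
      using that by (induction xs) (force simp: t_def)+
    have first: "transduce t 0 (mark ?c) = (1, (3 * vs + 1) # replicate ?L (3 * vc 3 False))"
      using 1[of "map ((*) 3) fs"] ge[of _ w] unfolding cw by (force simp: mark_Cons t_def)
    have sep: "transduce t 1 [1] = (2, [3 * vc 3 False])" by (simp add: t_def)
    have trk: "track ?c (shifted ?ms 1) = 3 * f # track fs (tl (shifted ?ms 1))"
      "length (tl (shifted ?ms 1)) = length fs" "\<And>m. m \<in> set (tl (shifted ?ms 1)) \<Longrightarrow> m < 3"
      using c(3)[of w] unfolding cw by (auto simp: shifted_def take_Cons' split: if_splits)
    have 3: "transduce t 3 (track fs ms) = (3, map (\<lambda>f. 3 * vc f False) fs)"
      if "length fs = length ms" "\<And>m. m \<in> set ms \<Longrightarrow> m < 3" "\<And>f. f \<in> set fs \<Longrightarrow> f \<in> {1, 2, 3}" for fs ms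
      using that
    proof (induction fs ms rule: list_induct2)
      case (Cons x xs y ys)
      have "x \<in> {1, 2, 3}" "y < 3" using Cons.prems by auto
      then have "t 3 (3 * x + y) = (3, [3 * vc x False])" by (auto simp: t_def cl_def)
      then show ?case using Cons by simp
    qed simp
    have "transduce t 3 (track fs (tl (shifted ?ms 1))) = (3, map (\<lambda>f. 3 * vc f False) fs)"
      using trk(2,3) c(4)[of _ w] cw by (intro 3) simp_all
    moreover have "t 2 (3 * f) = (3, [3 * vc f True])"
      using c(4)[of f w] cw by (auto simp: t_def cl_def)
    ultimately have second: "transduce t 2 (track ?c (shifted ?ms 1)) = (3, 3 * vc f True # map (\<lambda>f. 3 * vc f False) fs)"
      unfolding trk(1) by simp
    have "transduce t 4 xs = (4, replicate (length xs) (3 * vc 3 False))" for xs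
      by (induction xs) (auto simp: t_def)
    then have rest: "transduce t 3 (1 # ?rest) = (4, replicate ((?L - 2) * (?L + 1) + 1) (3 * vc 3 False))"
      unfolding len[symmetric] by (simp add: t_def)
    have "transduce t 0 (mark_copies ?c) = (4, ((3 * vs + 1) # replicate ?L (3 * vc 3 False)) @
        [3 * vc 3 False] @ (3 * vc f True # map (\<lambda>f. 3 * vc f False) fs) @
        replicate ((?L - 2) * (?L + 1) + 1) (3 * vc 3 False))"
      unfolding sh
      by (rule transduce_append_eq[OF first transduce_append_eq[OF sep transduce_append_eq[OF second rest]]])
    then show ?thesis
      by (simp add: row_code_def mark_Cons cw replicate_app_Cons_same o_def)
  qed
  ultimately show ?thesis by simp
qed

text \<open>
  A cell is expanded to \<open>R\<close> symbols, which allows \<open>R\<close> different shifts of a marker per cell. The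
  last of them carries the colour, if the cell is in the first row. The markers 1 and 2 on the moving
  track have the distance of one row.
\<close>

definition grid_cell :: "nat \<Rightarrow> nat \<Rightarrow> nat \<Rightarrow> nat list" where
  "grid_cell R x m = track ([1..<R] @ [x]) (m # replicate (R - 1) 0)"

definition grid :: "nat \<Rightarrow> nat list \<Rightarrow> nat list" where
  "grid R vs = concat (map (\<lambda>h. grid_cell R (if h < length vs then R + vs ! h else R)
     (if h = 0 then 1 else if h = length vs then 2 else 0)) [0..<length vs * length vs])"

text \<open>Every symbol except the separators in the shifts of a row of length \<open>W\<close>
  becomes one cell, which gives \<open>W * W\<close> cells. The first copy supplies the colours and
  marker 1; the first symbol of the second copy lies one row later and gets marker 2.\<close>

lemma produces_grid:
  assumes c: "produces r A (\<lambda>w. mark (c w))" "A mod 3 = 2" "\<And>w. 2 \<le> length (c w)"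
      "\<And>w f. f \<in> set (c w) \<Longrightarrow> 1 \<le> f \<and> f \<le> N"
    and R: "1 \<le> R" "3 * (R + N) + 2 \<le> A"
  shows "produces r A (\<lambda>w. grid R (c w))"
proof -
  define cl where "cl a = min N (a div 3)" for a :: nat
  define t :: "nat \<Rightarrow> nat \<Rightarrow> nat \<times> nat list" where "t q a = (
    if q = 0 then (1, grid_cell R (R + cl a) 1)
    else if q = 1 then (if a = 1 then (2, []) else (1, grid_cell R (R + cl a) 0))
    else if q = 2 then (3, grid_cell R R 2)
    else (3, if a = 1 then [] else grid_cell R R 0))" for q a
  have ne: "c w \<noteq> []" for w using c(3)[of w] by auto
  have "produces (\<not> \<not> r) A (\<lambda>w. let (q, os) = transduce t 0
      (mark_copies (c w)) in os @ (\<lambda>_. []) q)"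
    using produces_mark_shifts[OF c(1,2) ne conjunct1[OF c(4)]]
  proof (rule produces_transduce[where S = "{..3}"])
    have cell: "set (grid_cell R x m) \<subseteq> {1..A}" if "R \<le> x" "x \<le> R + N" "m \<le> 2" for x m
    proof
      fix a assume "a \<in> set (grid_cell R x m)"
      then obtain f m' where "a = 3 * f + m'" "f \<in> set ([1..<R] @ [x])" "m' \<in> set (m # replicate (R - 1) 0)"
        unfolding grid_cell_def by (blast dest: track_mem)
      then show "a \<in> {1..A}" using that R by auto
    qed
    show "fst (t q a) \<in> {..3} \<and> set (snd (t q a)) \<subseteq> {1..A}" for q a
      using cell[of "R + cl a" 1] cell[of "R + cl a" 0] cell[of R 2] cell[of R 0]
      by (auto simp: t_def cl_def)
  qed auto
  moreover have "(let (q, os) = transduce t 0 (mark_copies (c w))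
      in os @ (\<lambda>_. []) q) = grid R (c w)" for w
  proof -
    let ?c = "c w" and ?L = "length (c w)"
    let ?ms = "1 # replicate (?L - 1) 0"
    let ?blk = "\<lambda>s. track ?c (shifted ?ms s) @ [1]"
    obtain f fs where cw: "?c = f # fs" using ne[of w] by (cases ?c) auto
    have "[1..<?L] = 1 # [2..<?L]"
      using c(3)[of w] by (subst upt_conv_Cons) (auto simp: numeral_2_eq_2)
    then have sh: "mark_copies ?c = mark ?c @ [1] @ ?blk 1 @ concat (map ?blk [2..<?L])"
      using ne[of w] by (simp add: shifts_first mark_def)
    have 1: "transduce t 1 (map ((*) 3) xs) = (1, concat (map (\<lambda>f. grid_cell R (R + f) 0) xs))"
      if "\<And>f. f \<in> set xs \<Longrightarrow> 1 \<le> f \<and> f \<le> N" for xs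
      using that by (induction xs) (auto simp: t_def cl_def)
    have first: "transduce t 0 (mark ?c) = (1, grid_cell R (R + f) 1 @ concat (map (\<lambda>f. grid_cell R (R + f) 0) fs))"
    proof -
      have "Suc (3 * f) div 3 = f" by presburger
      moreover have "f \<le> N" using c(4)[of f w] cw by simp
      moreover have "transduce t 1 (map ((*) 3) fs) = (1, concat (map (\<lambda>f. grid_cell R (R + f) 0) fs))"
        using c(4)[of _ w] cw by (intro 1) simp
      ultimately show ?thesis unfolding cw by (simp add: mark_Cons t_def cl_def)
    qed
    have 3: "transduce t 3 xs = (3, concat (replicate (length xs) (grid_cell R R 0)))"
      if "\<And>a. a \<in> set xs \<Longrightarrow> 3 \<le> a" for xs
      using that by (induction xs) (force simp: t_def)+
    have trk: "a \<in> set (track ?c ms) \<Longrightarrow> 3 \<le> a" for a ms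
      by (rule track_ge_3[of ?c]) (use c(4) in auto)
    have blk: "transduce t 3 (?blk s) = (3, concat (replicate ?L (grid_cell R R 0)))" if "s \<le> ?L" for s
    proof -
      have "transduce t 3 (track ?c (shifted ?ms s)) = (3, concat (replicate ?L (grid_cell R R 0)))"
        using 3[of "track ?c (shifted ?ms s)"] trk that ne[of w] by simp
      moreover have "transduce t 3 [1] = (3, [])" by (simp add: t_def)
      ultimately show ?thesis by (metis append_Nil2 transduce_append_eq)
    qed
    have "transduce t 3 (concat (map ?blk ss)) = (3, concat (map (\<lambda>s. concat (replicate ?L (grid_cell R R 0))) ss))"
      if "\<And>s. s \<in> set ss \<Longrightarrow> s \<le> ?L" for ss
      using that
    proof (induction ss)
      case (Cons s ss)
      then show ?case using transduce_append_eq[OF blk Cons.IH, of s] by simp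
    qed simp
    then have rest: "transduce t 3 (concat (map ?blk [2..<?L])) =
        (3, concat (replicate ((?L - 2) * ?L) (grid_cell R R 0)))"
    proof -
      have "concat (map (\<lambda>s. concat (replicate ?L (grid_cell R R 0))) ss) =
          concat (replicate (length ss * ?L) (grid_cell R R 0))" for ss :: "nat list"
        by (induction ss) (simp_all add: replicate_add)
      from this[of "[2..<?L]"] \<open>\<And>ss. (\<And>s. s \<in> set ss \<Longrightarrow> s \<le> ?L) \<Longrightarrow> _\<close>[of "[2..<?L]"]
      show ?thesis by simp
    qed
    have second: "transduce t 2 (?blk 1) = (3, grid_cell R R 2 @ concat (replicate (?L - 1) (grid_cell R R 0)))"
    proof -
      obtain x xs where x: "track ?c (shifted ?ms 1) = x # xs"
        using ne[of w] c(3)[of w] by (cases "track ?c (shifted ?ms 1)") (auto simp: length_0_conv[symmetric] simp del: length_0_conv)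
      have "length (x # xs) = ?L" unfolding x[symmetric] using ne[of w] c(3)[of w] by simp
      then have l: "length xs = ?L - 1" by simp
      have "transduce t 3 xs = (3, concat (replicate (?L - 1) (grid_cell R R 0)))"
        using 3[of xs] trk[of _ "shifted ?ms 1"] unfolding x l by simp
      moreover have "transduce t 3 [1] = (3, [])" by (simp add: t_def)
      ultimately have "transduce t 3 (xs @ [1]) = (3, concat (replicate (?L - 1) (grid_cell R R 0)) @ [])"
        by (rule transduce_append_eq)
      moreover have "t 2 x = (3, grid_cell R R 2)" by (simp add: t_def)
      ultimately show ?thesis unfolding x by simp
    qed
    have sep: "transduce t 1 [1] = (2, [])" by (simp add: t_def)
    have "transduce t 0 (mark_copies ?c) = (3, (grid_cell R (R + f) 1 @ concat (map (\<lambda>f. grid_cell R (R + f) 0) fs)) @ [] @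
       (grid_cell R R 2 @ concat (replicate (?L - 1) (grid_cell R R 0))) @ concat (replicate ((?L - 2) * ?L) (grid_cell R R 0)))"
      unfolding sh
      by (rule transduce_append_eq[OF first transduce_append_eq[OF sep transduce_append_eq[OF second rest]]])
    moreover have "grid R ?c = (grid_cell R (R + f) 1 @ concat (map (\<lambda>f. grid_cell R (R + f) 0) fs)) @ [] @
       (grid_cell R R 2 @ concat (replicate (?L - 1) (grid_cell R R 0))) @ concat (replicate ((?L - 2) * ?L) (grid_cell R R 0))"
    proof -
      let ?g = "\<lambda>h. grid_cell R (if h < ?L then R + ?c ! h else R) (if h = 0 then 1 else if h = ?L then 2 else 0)"
      obtain m where m: "?L = 2 + m" using c(3)[of w] le_Suc_ex by blast
      have LL: "?L * ?L = ?L + (1 + ((?L - 1) + (?L - 2) * ?L))" unfolding m by (simp add: algebra_simps)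
      have "[0..<?L * ?L] = [0..<?L] @ [?L] @ [Suc ?L..<?L * ?L]"
      proof -
        have "[0..<?L * ?L] = [0..<?L] @ [?L..<?L * ?L]"
          using upt_add_eq_append[of 0 ?L "1 + ((?L - 1) + (?L - 2) * ?L)"] unfolding LL[symmetric] by simp
        moreover have "[?L..<?L * ?L] = ?L # [Suc ?L..<?L * ?L]"
          using LL by (intro upt_conv_Cons) linarith
        ultimately show ?thesis by simp
      qed
      then have "grid R ?c = concat (map ?g [0..<?L]) @ ?g ?L @ concat (map ?g [Suc ?L..<?L * ?L])"
        unfolding grid_def by simp
      moreover have "map ?g [Suc ?L..<?L * ?L] = replicate ((?L - 1) + (?L - 2) * ?L) (grid_cell R R 0)"
      proof -
        have "map ?g [Suc ?L..<?L * ?L] = map (\<lambda>_. grid_cell R R 0) [Suc ?L..<?L * ?L]"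
          by (rule map_cong) auto
        moreover have "?L * ?L - Suc ?L = (?L - 1) + (?L - 2) * ?L" using LL by linarith
        ultimately show ?thesis by (simp only: map_replicate_const length_upt)
      qed
      moreover have "map ?g [0..<?L] = grid_cell R (R + f) 1 # map (\<lambda>f. grid_cell R (R + f) 0) fs"
      proof -
        have "map ?g [0..<?L] = map ?g (0 # map Suc [0..<length fs])"
          unfolding cw by (simp add: upt_conv_Cons map_Suc_upt del: upt_Suc)
        also have "\<dots> = grid_cell R (R + f) 1 # map (\<lambda>i. grid_cell R (R + fs ! i) 0) [0..<length fs]"
          by (simp add: cw)
        also have "map (\<lambda>i. grid_cell R (R + fs ! i) 0) [0..<length fs] = map (\<lambda>f. grid_cell R (R + f) 0) fs"
          by (rule nth_equalityI) auto
        finally show ?thesis .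
      qed
      moreover have "?g ?L = grid_cell R R 2" using m by simp
      ultimately show ?thesis by (simp add: replicate_add)
    qed
    ultimately show ?thesis by simp
  qed
  ultimately show ?thesis by simp
qed

text \<open>The first \<open>q\<close> symbols of each cell serve as tally marks: counting them in
  binary produces \<open>q * G\<close>, the leading part of the inventory bound.\<close>

lemma length_filter_grid:
  assumes "q < R"
  shows "length (filter (\<lambda>a. 1 \<le> a div 3 \<and> a div 3 \<le> q) (grid R vs)) = q * (length vs * length vs)"
proof -
  let ?P = "\<lambda>a :: nat. 1 \<le> a div 3 \<and> a div 3 \<le> q"
  have map3: "filter ?P (map ((*) 3) xs) = map ((*) 3) (filter (\<lambda>f. 1 \<le> f \<and> f \<le> q) xs)" for xs
    by (induction xs) auto
  have "length (filter ?P (grid_cell R x m)) = q" if "R \<le> x" "m < 3" for x m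
  proof -
    obtain f fs where f: "[1..<R] @ [x] = f # fs" by (cases "[1..<R] @ [x]") auto
    then have "length (f # fs) = R" using assms by (metis One_nat_def Suc_pred bot_nat_0.not_eq_extremum length_append_singleton length_upt less_nat_zero_code)
    then have "grid_cell R x m = (3 * f + m) # map ((*) 3) fs"
      unfolding grid_cell_def f using track_replicate_0[of fs] by auto
    then have "length (filter ?P (grid_cell R x m)) = length (filter ?P (map ((*) 3) (f # fs)))"
      using that(2) by simp
    also have "\<dots> = length (filter (\<lambda>f. 1 \<le> f \<and> f \<le> q) ([1..<R] @ [x]))"
      unfolding map3 f[symmetric] by simp
    also have "[1..<R] = [1..<Suc q] @ [Suc q..<R]"
      using assms upt_add_eq_append[of 1 "Suc q" "R - Suc q"] by simp
    finally show ?thesis using that(1) assms by (simp add: filter_id_conv)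
  qed
  then have *: "length (filter ?P (concat (map (\<lambda>h. grid_cell R (x h) (m h)) hs))) = q * length hs"
    if "\<And>h. R \<le> x h" "\<And>h. m h < 3" for x m hs
    using that by (induction hs) auto
  show ?thesis unfolding grid_def by (subst *) auto
qed

section \<open>Writing numbers in binary\<close>

definition fixed_bits :: "nat \<Rightarrow> nat \<Rightarrow> bool list" where
  "fixed_bits k x = map (\<lambda>i. odd (x div 2 ^ i)) [0..<k]"

lemma bits_shift:
  assumes "x < 2 ^ k" "0 < y"
  shows "bits (x + 2 ^ k * y) = fixed_bits k x @ bits y"
  using assms(1)
proof (induction k arbitrary: x)
  case (Suc k)
  have "fixed_bits (Suc k) x = odd x # fixed_bits k (x div 2)"
    by (simp add: fixed_bits_def upt_conv_Cons map_Suc_upt[symmetric] div_mult2_eq o_def del: upt_Suc)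
  moreover have "(x + 2 ^ Suc k * y) div 2 = x div 2 + 2 ^ k * y" by simp
  moreover have "odd (x + 2 ^ Suc k * y) = odd x" by simp
  moreover have "x + 2 ^ Suc k * y \<noteq> 0" using assms(2) by simp
  ultimately show ?case
    using Suc.IH[of "x div 2"] Suc.prems by (subst bits.simps) simp
qed (simp add: fixed_bits_def)

text \<open>With base \<open>2 ^ k\<close> the digits occupy disjoint bit blocks, so the number is
  written block by block without carries. Since \<open>bits\<close> drops leading zeros, blocks of
  fixed length need the positive part \<open>y\<close> above them.\<close>

lemma bits_blocks:
  assumes "\<And>h. h < G \<Longrightarrow> c h < 2 ^ k" "0 < y"
  shows "bits ((\<Sum>h<G. c h * (2 ^ k) ^ h) + (2 ^ k) ^ G * y) =
    concat (map (\<lambda>h. fixed_bits k (c h)) [0..<G]) @ bits y"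
  using assms
proof (induction G arbitrary: y)
  case (Suc G)
  have "(\<Sum>h<Suc G. c h * (2 ^ k) ^ h) + (2 ^ k) ^ Suc G * y =
      (\<Sum>h<G. c h * (2 ^ k) ^ h) + (2 ^ k) ^ G * (c G + 2 ^ k * y)"
    by (simp add: algebra_simps)
  also have "bits \<dots> = concat (map (\<lambda>h. fixed_bits k (c h)) [0..<G]) @ bits (c G + 2 ^ k * y)"
    by (rule Suc.IH) (use Suc.prems in auto)
  also have "bits (c G + 2 ^ k * y) = fixed_bits k (c G) @ bits y"
    by (rule bits_shift) (use Suc.prems in auto)
  finally show ?case by simp
qed simp

definition emit :: "bool list \<Rightarrow> nat list" where
  "emit bs = concat (map (\<lambda>b. [2, letter b]) bs)"

lemma emit_simps [simp]:
  "emit [] = []" "emit (b # bs) = 2 # letter b # emit bs" "emit (bs @ cs) = emit bs @ emit cs"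
  by (simp_all add: emit_def)

lemma emit_concat: "emit (concat bss) = concat (map emit bss)"
  by (induction bss) auto

lemma set_emit: "set (emit bs) \<subseteq> {1, 2}"
  by (induction bs) (auto simp: letter_def)

lemma map_letter_encode_nat: "map letter (encode_nat x) = emit (bits x) @ [1]"
  by (simp add: encode_nat_def emit_def map_concat letter_def o_def)

section \<open>The output transducer\<close>

lemma concat_upt_blocks:
  "concat (map (\<lambda>h. map (\<lambda>i. g (R * h + i)) [0..<R]) [0..<G]) = map g [0..<R * G]"
proof (induction G)
  case (Suc G)
  have "[0..<R * Suc G] = [0..<R * G] @ [R * G..<R * G + R]"
    using upt_add_eq_append[of 0 "R * G" R] by (simp add: add.commute)
  moreover have "[R * G..<R * G + R] = map (\<lambda>i. R * G + i) [0..<R]"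
    by (simp add: map_add_upt add.commute)
  ultimately show ?case using Suc by (simp add: o_def)
qed simp

lemma concat_track:
  assumes "\<And>h. h \<in> set hs \<Longrightarrow> length (f h) = length (m h)"
  shows "concat (map (\<lambda>h. track (f h) (m h)) hs) = track (concat (map f hs)) (concat (map m hs))"
  using assms by (induction hs) (auto simp: track_append)

text \<open>Model of the state component that remembers the item type: the place of the last marker
  1, with \<open>ty\<close> carried over from earlier cells.\<close>

fun last_hit :: "nat \<Rightarrow> nat list \<Rightarrow> nat option \<Rightarrow> nat option" where
  "last_hit i [] ty = ty"
| "last_hit i (m # ms) ty = last_hit (Suc i) ms (if m = 1 then Some i else ty)"

lemma last_hit_snoc: "last_hit i (ms @ [m]) ty = (if m = 1 then Some (i + length ms) else last_hit i ms ty)"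
  by (induction ms arbitrary: i ty) auto

lemma last_hit_map:
  assumes "\<And>i. i < n \<Longrightarrow> g i = 1 \<longleftrightarrow> i = j"
  shows "last_hit 0 (map g [0..<n]) ty = (if j < n then Some j else ty)"
  using assms
proof (induction n)
  case (Suc n)
  then have "last_hit 0 (map g [0..<n]) ty = (if j < n then Some j else ty)" by simp
  then show ?case using Suc.prems[of n] by (auto simp: last_hit_snoc)
qed simp

type_synonym out_state = "nat \<times> nat option \<times> nat \<times> bool \<times> bool"

text \<open>\<open>block\<close> receives only what finitely many states can hold: the kind of copy,
  whether the cell is the first, its colour, the item type, the distance from the marker cut at 2,
  and the presence of marker 2. The digits of an item depend on nothing else, so one pass writes a
  whole number.\<close>

locale output_rule =
  fixes k R F :: nat and prefix :: "nat list" and fin :: "nat \<Rightarrow> nat option \<Rightarrow> nat list"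
    and block :: "nat \<Rightarrow> bool \<Rightarrow> nat option \<Rightarrow> nat option \<Rightarrow> nat \<Rightarrow> bool \<Rightarrow> nat"
  assumes R: "1 \<le> R" "R \<le> F"
begin

text \<open>
  A state consists of the number of the copy (0, 1, or 2 for all later ones), the position within
  its cell of the marker 1 if it has been met, the distance from the cell of the marker (at most 2),
  whether the marker 2 lies in the current cell, and whether the current cell is the first one.
\<close>

definition out :: "out_state \<Rightarrow> nat \<Rightarrow> out_state \<times> nat list" where
  "out = (\<lambda>(c, ty, pos, u, first) a. let f = a div 3; m = a mod 3 in
     if a = 1 then ((min 2 (Suc c), None, 0, False, True), fin c ty)
     else if F \<le> f then ((c, ty, pos, u, first), if c = 0 then emit [f = Suc F] else [])
     else let ty' = (if m = 1 then Some (min f R - 1) else ty); pos' = (if m = 1 then 0 else pos);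
              u' = (u \<or> m = 2); pre = (if c = 0 \<and> m = 1 then prefix else []) in
       if f < R then ((c, ty', pos', u', first), pre)
       else ((c, ty', if ty' = None then 0 else min 2 (Suc pos'), False, False),
         pre @ emit (fixed_bits k (block c first (if R < f then Some (f - R) else None) ty' pos' u'))))"

text \<open>\<open>min f R - 1\<close> is the place in the cell: the values 1 to
  \<open>R - 1\<close> number all symbols but the last, and the last one has a value of at least
  \<open>R\<close> that depends on the colour.\<close>

lemma out_sub:
  assumes "1 \<le> f" "f < F" "m < 3"
  shows "out (c, ty, pos, u, first) (3 * f + m) =
    (let ty' = (if m = 1 then Some (min f R - 1) else ty); pos' = (if m = 1 then 0 else pos);
         u' = (u \<or> m = 2); pre = (if c = 0 \<and> m = 1 then prefix else []) in
       if f < R then ((c, ty', pos', u', first), pre)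
       else ((c, ty', if ty' = None then 0 else min 2 (Suc pos'), False, False),
         pre @ emit (fixed_bits k (block c first (if R < f then Some (f - R) else None) ty' pos' u'))))"
proof -
  have "(3 * f + m = 1) = False" "(3 * f + m) div 3 = f" "(3 * f + m) mod 3 = m" "(F \<le> f) = False"
    using assms by auto
  then show ?thesis by (simp only: out_def Let_def split_conv if_False)
qed

text \<open>Copy 0 carries marker 1 on its very first symbol, which is where the prefix of the whole
  output belongs.\<close>

definition pre :: "nat \<Rightarrow> nat list \<Rightarrow> nat list" where
  "pre c ms = concat (map (\<lambda>m. if c = 0 \<and> m = 1 then prefix else []) ms)"

lemma transduce_subs:
  assumes "i + length ms < R" "\<And>m. m \<in> set ms \<Longrightarrow> m < 3"
  shows "transduce out (c, ty, pos, u, first) (track [Suc i..<Suc i + length ms] ms) =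
    ((c, last_hit i ms ty, if 1 \<in> set ms then 0 else pos, u \<or> 2 \<in> set ms, first), pre c ms)"
  using assms
proof (induction ms arbitrary: i ty pos u)
  case Nil
  then show ?case by (simp add: pre_def)
next
  case (Cons m ms)
  have "[Suc i..<Suc i + length (m # ms)] = Suc i # [Suc (Suc i)..<Suc (Suc i) + length ms]"
    by (subst upt_conv_Cons) (simp_all del: upt_Suc)
  moreover have "out (c, ty, pos, u, first) (3 * Suc i + m) =
     ((c, if m = 1 then Some i else ty, if m = 1 then 0 else pos, u \<or> m = 2, first),
      if c = 0 \<and> m = 1 then prefix else [])"
    using out_sub[of "Suc i" m] Cons.prems R by (simp add: Let_def)
  ultimately show ?case
    using Cons.IH[of "Suc i"] Cons.prems by (auto simp: pre_def)
qed

lemma transduce_cell: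
  fixes ty :: "nat option" and pos :: nat
  assumes "length ms = R" "\<And>m. m \<in> set ms \<Longrightarrow> m < 3" "R \<le> x" "x < F"
  defines "ty' \<equiv> last_hit 0 ms ty" and "pos' \<equiv> (if 1 \<in> set ms then 0 else pos)"
  shows "transduce out (c, ty, pos, False, first) (track ([1..<R] @ [x]) ms) =
    ((c, ty', if ty' = None then 0 else min 2 (Suc pos'), False, False),
     pre c ms @ emit (fixed_bits k (block c first (if R < x then Some (x - R) else None) ty' pos' (2 \<in> set ms))))"
proof -
  obtain ns m where ms: "ms = ns @ [m]" using assms(1) R by (cases ms rule: rev_cases) auto
  have ns: "Suc (length ns) = R" using assms(1) ms by simp
  have split: "track ([1..<R] @ [x]) ms = track [1..<R] ns @ [3 * x + m]"
    unfolding ms using ns R by (subst track_append) auto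
  have subs: "transduce out (c, ty, pos, False, first) (track [1..<R] ns) =
      ((c, last_hit 0 ns ty, if 1 \<in> set ns then 0 else pos, 2 \<in> set ns, first), pre c ns)"
    using transduce_subs[of 0 ns c ty pos False first] ns assms(2) ms by simp
  have end_sub: "transduce out (c, last_hit 0 ns ty, if 1 \<in> set ns then 0 else pos, 2 \<in> set ns, first) [3 * x + m] =
    ((c, ty', if ty' = None then 0 else min 2 (Suc pos'), False, False),
     (if c = 0 \<and> m = 1 then prefix else []) @
     emit (fixed_bits k (block c first (if R < x then Some (x - R) else None) ty' pos' (2 \<in> set ms))))"
  proof -
    have "ty' = (if m = 1 then Some (min x R - 1) else last_hit 0 ns ty)"
      using assms(3) ns by (auto simp: ty'_def ms last_hit_snoc)
    moreover have "pos' = (if m = 1 then 0 else if 1 \<in> set ns then 0 else pos)"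
      by (simp add: pos'_def ms)
    moreover have "(2 \<in> set ms) = (2 \<in> set ns \<or> m = 2)" by (auto simp: ms)
    moreover have "out (c, last_hit 0 ns ty, if 1 \<in> set ns then 0 else pos, 2 \<in> set ns, first) (3 * x + m) =
      (let ty' = (if m = 1 then Some (min x R - 1) else last_hit 0 ns ty);
           pos' = (if m = 1 then 0 else if 1 \<in> set ns then 0 else pos);
           u' = (2 \<in> set ns \<or> m = 2); pre = (if c = 0 \<and> m = 1 then prefix else []) in
         if x < R then ((c, ty', pos', u', first), pre)
         else ((c, ty', if ty' = None then 0 else min 2 (Suc pos'), False, False),
           pre @ emit (fixed_bits k (block c first (if R < x then Some (x - R) else None) ty' pos' u'))))"
      by (rule out_sub) (use assms(2-4) R ms in auto)
    ultimately show ?thesis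
      using assms(3) by (simp only: transduce.simps Let_def not_less[symmetric] if_False split_conv append_Nil2)
  qed
  have "pre c ms = pre c ns @ (if c = 0 \<and> m = 1 then prefix else [])"
    by (simp add: pre_def ms)
  with transduce_append_eq[OF subs end_sub] show ?thesis
    by (simp only: split append_assoc)
qed

definition move :: "nat \<Rightarrow> nat \<Rightarrow> nat \<Rightarrow> nat" where
  "move W s i = (if i = s then 1 else if i = s + R * W then 2 else 0)"

text \<open>Shift \<open>s\<close> belongs to item \<open>s mod R\<close> of cell
  \<open>s div R\<close>. Only that cell, the next one and the one a row later can carry digits of
  an item, so distances are cut at 2. Before the cell truncated subtraction gives 0, and the absent
  type tells the cases apart.\<close>

definition cell_value :: "nat \<Rightarrow> (nat \<Rightarrow> nat) \<Rightarrow> nat \<Rightarrow> nat \<Rightarrow> nat" where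
  "cell_value W x s h = block (min 2 s) (h = 0) (if R < x h then Some (x h - R) else None)
     (if s div R \<le> h then Some (s mod R) else None) (min 2 (h - s div R)) (h = s div R + W)"

lemma div_eq_iff_nat: "R * h + i = s \<longleftrightarrow> h = s div R \<and> i = s mod R" if "i < R" for h i s
  using that by auto

lemma transduce_cells:
  assumes x: "\<And>h. h < G \<Longrightarrow> R \<le> x h \<and> x h < F" and W: "1 \<le> W"
  shows "transduce out (min 2 s, None, 0, False, True)
      (concat (map (\<lambda>h. track ([1..<R] @ [x h]) (map (\<lambda>i. move W s (R * h + i)) [0..<R])) [0..<G])) =
    ((min 2 s, if s div R < G then Some (s mod R) else None, min 2 (G - s div R), False, G = 0),
     concat (map (\<lambda>h. (if s = 0 \<and> h = 0 then prefix else []) @ emit (fixed_bits k (cell_value W x s h))) [0..<G]))"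
  using x
proof (induction G)
  case 0
  then show ?case by simp
next
  case (Suc G)
  let ?ms = "map (\<lambda>i. move W s (R * G + i)) [0..<R]"
  have m1: "move W s (R * G + i) = 1 \<longleftrightarrow> G = s div R \<and> i = s mod R" if "i < R" for i
    using div_eq_iff_nat[OF that, of G s] by (simp add: move_def)
  \<comment> \<open>A distance of \<open>R * W\<close> keeps the residue modulo \<open>R\<close>, so
    marker 2 takes the same place in cell \<open>s div R + W\<close>.\<close>
  have m2: "move W s (R * G + i) = 2 \<longleftrightarrow> G = s div R + W \<and> i = s mod R" if "i < R" for i
    using div_eq_iff_nat[OF that, of G "s + R * W"] R W by (auto simp: move_def)
  have one: "1 \<in> set ?ms \<longleftrightarrow> G = s div R" and two: "2 \<in> set ?ms \<longleftrightarrow> G = s div R + W"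
  proof -
    have "v \<in> set ?ms \<longleftrightarrow> (\<exists>i<R. move W s (R * G + i) = v)" for v by auto
    moreover have "s mod R < R" using R by simp
    ultimately show "1 \<in> set ?ms \<longleftrightarrow> G = s div R" "2 \<in> set ?ms \<longleftrightarrow> G = s div R + W"
      using m1 m2 by blast+
  qed
  define ty where "ty = (if s div R < G then Some (s mod R) else None)"
  have hit: "last_hit 0 ?ms ty = (if s div R \<le> G then Some (s mod R) else None)"
  proof (cases "G = s div R")
    case True
    then have "last_hit 0 ?ms ty = (if s mod R < R then Some (s mod R) else ty)"
      using m1 by (intro last_hit_map) auto
    then show ?thesis using True R by simp
  next
    case False
    then have "last_hit 0 ?ms ty = (if R < R then Some R else ty)"
      using m1 by (intro last_hit_map) auto
    then show ?thesis using False by (auto simp: ty_def)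
  qed
  have pos: "(if 1 \<in> set ?ms then 0 else min 2 (G - s div R)) = min 2 (G - s div R)"
    unfolding one by auto
  have pre: "pre (min 2 s) ?ms = (if s = 0 \<and> G = 0 then prefix else [])"
  proof (cases "s = 0 \<and> G = 0")
    case True
    then have "?ms = 1 # map (move W s) [1..<R]"
      using R by (simp add: upt_conv_Cons move_def)
    moreover have "\<forall>i\<in>{1..<R}. move W s i \<noteq> 1" using True by (simp add: move_def)
    ultimately show ?thesis using True by (simp add: pre_def)
  next
    case False
    then have "\<forall>m\<in>set ?ms. \<not> (min 2 s = 0 \<and> m = 1)"
    proof (intro ballI notI)
      fix m assume "m \<in> set ?ms" "min 2 s = 0 \<and> m = 1"
      then have "1 \<in> set ?ms" "s = 0" by auto
      with one False show False by simp
    qed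
    then show ?thesis using False by (auto simp: pre_def)
  qed
  have "transduce out (min 2 s, ty, min 2 (G - s div R), False, G = 0) (track ([1..<R] @ [x G]) ?ms) =
    ((min 2 s, if s div R < Suc G then Some (s mod R) else None, min 2 (Suc G - s div R), False, Suc G = 0),
     (if s = 0 \<and> G = 0 then prefix else []) @ emit (fixed_bits k (cell_value W x s G)))"
  proof -
    have "\<And>m. m \<in> set ?ms \<Longrightarrow> m < 3" by (auto simp: move_def)
    note tc = transduce_cell[of ?ms "x G" "min 2 s" ty "min 2 (G - s div R)" "G = 0", OF _ this]
    have "Suc (G - s div R) = Suc G - s div R" if "s div R \<le> G" using that by simp
    then show ?thesis
      using tc Suc.prems[of G] unfolding hit pos two pre cell_value_def by (auto simp: min_def)
  qed
  moreover have "transduce out (min 2 s, None, 0, False, True)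
      (concat (map (\<lambda>h. track ([1..<R] @ [x h]) (map (\<lambda>i. move W s (R * h + i)) [0..<R])) [0..<G])) =
    ((min 2 s, ty, min 2 (G - s div R), False, G = 0),
     concat (map (\<lambda>h. (if s = 0 \<and> h = 0 then prefix else []) @ emit (fixed_bits k (cell_value W x s h))) [0..<G]))"
    unfolding ty_def using Suc by simp
  ultimately show ?case by (simp add: transduce_append)
qed

lemma transduce_bits:
  assumes "length ms = length bs" "\<And>m. m \<in> set ms \<Longrightarrow> m < 3"
  shows "transduce out (c, q) (track (map (\<lambda>b. F + of_bool b) bs) ms) = ((c, q), if c = 0 then emit bs else [])"
  using assms
proof (induction ms bs rule: list_induct2)
  case (Cons m ms b bs)
  have "m < 3" using Cons.prems by simp
  then have "3 * (F + of_bool b) + m \<noteq> 1" "(3 * (F + of_bool b) + m) div 3 = F + of_bool b" using R by auto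
  moreover obtain ty pos u first where "q = (ty, pos, u, first)" by (cases q) auto
  ultimately have "out (c, q) (3 * (F + of_bool b) + m) = ((c, q), if c = 0 then emit [b] else [])"
    by (cases b) (simp_all add: out_def Let_def)
  then show ?case using Cons by auto
qed simp

text \<open>From \<open>s = R * G\<close> on the marker has left the grid and lies among the
  appended binary digits. Such copies have no type but still yield a number.\<close>

definition copy_output :: "nat \<Rightarrow> nat \<Rightarrow> (nat \<Rightarrow> nat) \<Rightarrow> bool list \<Rightarrow> nat \<Rightarrow> nat list" where
  "copy_output W G x bs s = (if s = 0 then prefix else []) @
     emit (concat (map (\<lambda>h. fixed_bits k (cell_value W x s h)) [0..<G])) @
     (if s = 0 then emit bs else []) @ fin (min 2 s) (if s < R * G then Some (s mod R) else None)"

lemma transduce_copy: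
  assumes x: "\<And>h. h < G \<Longrightarrow> R \<le> x h \<and> x h < F" and W: "1 \<le> W" and G: "1 \<le> G"
    and sfx: "length sfx = length bs" "\<And>m. m \<in> set sfx \<Longrightarrow> m < 3"
  shows "transduce out (min 2 s, None, 0, False, True)
      (concat (map (\<lambda>h. track ([1..<R] @ [x h]) (map (\<lambda>i. move W s (R * h + i)) [0..<R])) [0..<G]) @
       track (map (\<lambda>b. F + of_bool b) bs) sfx @ [1]) =
    ((min 2 (Suc s), None, 0, False, True), copy_output W G x bs s)"
proof -
  have eq: "s div R < G \<longleftrightarrow> s < R * G" using R by (simp add: div_less_iff_less_mult mult.commute)
  have cat: "concat (map (\<lambda>h. (if s = 0 \<and> h = 0 then prefix else []) @ emit (fixed_bits k (cell_value W x s h))) [0..<G]) =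
     (if s = 0 then prefix else []) @ emit (concat (map (\<lambda>h. fixed_bits k (cell_value W x s h)) [0..<G]))"
  proof -
    have "map (\<lambda>h. (if s = 0 \<and> h = 0 then prefix else []) @ emit (fixed_bits k (cell_value W x s h))) [Suc 0..<G] =
        map (\<lambda>h. emit (fixed_bits k (cell_value W x s h))) [Suc 0..<G]" by auto
    then show ?thesis using G by (simp add: upt_conv_Cons emit_concat o_def del: upt_Suc map_eq_conv)
  qed
  have "transduce out (min 2 s, ty, pos, False, G = 0) [1] = ((min 2 (Suc s), None, 0, False, True), fin (min 2 s) ty)" for ty pos
    by (auto simp: out_def Let_def)
  from transduce_append_eq[OF transduce_cells[where x = x and G = G and s = s, OF x W] transduce_append_eq[OF transduce_bits[OF sfx] this]]
  show ?thesis unfolding cat eq by (simp add: copy_output_def min_def)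
qed

lemma grid_eq_track:
  assumes "2 \<le> length vs"
  shows "grid R vs = track (concat (map (\<lambda>h. [1..<R] @ [if h < length vs then R + vs ! h else R]) [0..<length vs * length vs]))
     (map (move (length vs) 0) [0..<R * (length vs * length vs)])"
proof -
  have "(if h = 0 then 1 else if h = length vs then 2 else 0) # replicate (R - 1) 0 =
      map (\<lambda>i. move (length vs) 0 (R * h + i)) [0..<R]" for h
  proof -
    have "map (\<lambda>i. move (length vs) 0 (R * h + i)) [0..<R] =
        move (length vs) 0 (R * h) # map (\<lambda>i. move (length vs) 0 (R * h + i)) [1..<R]"
      using R by (simp add: upt_conv_Cons)
    also have "map (\<lambda>i. move (length vs) 0 (R * h + i)) [1..<R] = map (\<lambda>i. 0) [1..<R]"
    proof (rule map_cong)
      fix i assume "i \<in> set [1..<R]"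
      then have "R * h + i \<noteq> 0" "R * h + i \<noteq> R * length vs"
        using div_eq_iff_nat[of i h "R * length vs"] by auto
      then show "move (length vs) 0 (R * h + i) = 0" by (simp add: move_def)
    qed simp
    also have "move (length vs) 0 (R * h) = (if h = 0 then 1 else if h = length vs then 2 else 0)"
      using R by (simp add: move_def)
    finally show ?thesis by (simp add: map_replicate_const)
  qed
  then show ?thesis
    unfolding grid_def grid_cell_def by (subst concat_track) (use R in \<open>auto simp: concat_upt_blocks\<close>)
qed

lemma transduce_copies:
  fixes bs :: "bool list"
  assumes vs: "2 \<le> length vs" "\<And>v. v \<in> set vs \<Longrightarrow> R + v < F" and R2: "R < F"
  defines "W \<equiv> length vs" and "x \<equiv> \<lambda>h. if h < length vs then R + vs ! h else R"
    and "fs \<equiv> concat (map (\<lambda>h. [1..<R] @ [if h < length vs then R + vs ! h else R]) [0..<length vs * length vs]) @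
       map (\<lambda>b. F + of_bool b) bs"
    and "ms \<equiv> map (move (length vs) 0) [0..<R * (length vs * length vs)] @ replicate (length bs) 0"
  shows "snd (transduce out (0, None, 0, False, True) (shifts fs ms)) =
    concat (map (copy_output W (W * W) x bs) [0..<length fs])"
proof -
  let ?G = "W * W"
  have G: "1 \<le> ?G" "W < ?G" using vs by (auto simp: W_def)
  have lfs: "length (concat (map (\<lambda>h. [1..<R] @ [x h]) [0..<?G])) = R * ?G"
  proof -
    have "map (\<lambda>h. length ([1..<R] @ [x h])) [0..<?G] = map (\<lambda>_. R) [0..<?G]" using R by simp
    then show ?thesis by (simp add: length_concat o_def sum_list_triv mult.commute del: map_eq_conv)
  qed
  have len: "length ms = R * ?G + length bs" "length fs = R * ?G + length bs"
    using lfs by (simp_all add: ms_def fs_def W_def x_def)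
  have x: "R \<le> x h \<and> x h < F" for h using vs R2 by (auto simp: x_def)
  have copy: "transduce out (min 2 s, None, 0, False, True) (track fs (shifted ms s) @ [1]) =
      ((min 2 (Suc s), None, 0, False, True), copy_output W ?G x bs s)" if "s < length fs" for s
  proof -
    define sfx where "sfx = drop (R * ?G) (shifted ms s)"
    have ls: "length (shifted ms s) = R * ?G + length bs" using that len by simp
    have mem: "m < 3" if "m \<in> set (shifted ms s)" for m
      using that by (auto simp: shifted_def ms_def move_def dest!: in_set_takeD)
    have "take (R * ?G) (shifted ms s) = map (move W s) [0..<R * ?G]"
    proof (rule nth_equalityI)
      fix i assume "i < length (take (R * ?G) (shifted ms s))"
      then have i: "i < R * ?G" by simp
      have "shifted ms s ! i = (if i < s then 0 else ms ! (i - s))"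
        using i that len by (auto simp: shifted_def nth_append)
      moreover have "ms ! (i - s) = move W 0 (i - s)"
        using i by (simp add: ms_def nth_append W_def)
      ultimately show "take (R * ?G) (shifted ms s) ! i = map (move W s) [0..<R * ?G] ! i"
        using i by (auto simp: move_def)
    qed (use ls in simp)
    then have "shifted ms s = map (move W s) [0..<R * ?G] @ sfx"
      unfolding sfx_def by (metis append_take_drop_id)
    then have "track fs (shifted ms s) = track (concat (map (\<lambda>h. [1..<R] @ [x h]) [0..<?G])) (map (move W s) [0..<R * ?G]) @
        track (map (\<lambda>b. F + of_bool b) bs) sfx"
      unfolding fs_def W_def x_def using lfs[unfolded W_def x_def] by (simp add: track_append)
    also have "track (concat (map (\<lambda>h. [1..<R] @ [x h]) [0..<?G])) (map (move W s) [0..<R * ?G]) =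
        concat (map (\<lambda>h. track ([1..<R] @ [x h]) (map (\<lambda>i. move W s (R * h + i)) [0..<R])) [0..<?G])"
      unfolding concat_upt_blocks[of "move W s" R ?G, symmetric] by (subst concat_track) (use R in auto)
    finally show ?thesis
      using transduce_copy[where x = x and W = W and G = ?G and sfx = sfx and bs = bs and s = s, OF x] G mem ls vs
      by (auto simp: sfx_def W_def dest: in_set_dropD)
  qed
  have "transduce out (min 2 0, None, 0, False, True) (concat (map (\<lambda>s. track fs (shifted ms s) @ [1]) [0..<n])) =
      ((min 2 n, None, 0, False, True), concat (map (copy_output W ?G x bs) [0..<n]))" if "n \<le> length fs" for n
    using that
  proof (induction n)
    case (Suc n)
    show ?case
      using transduce_append_eq[OF Suc.IH copy[of n]] Suc.prems by simp
  qed simp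
  then show ?thesis by (simp add: shifts_def)
qed

end

section \<open>Computations as helical tilings\<close>

datatype ('h, 'v) tile = Tile (lft: 'h) (rgt: 'h) (dwn: 'v) (upp: 'v)

definition helix :: "('h, 'v) tile set \<Rightarrow> 'h \<Rightarrow> 'v list \<Rightarrow> nat \<Rightarrow> (nat \<Rightarrow> ('h, 'v) tile) \<Rightarrow> bool" where
  "helix T l0 vs G x \<longleftrightarrow> (\<forall>g<G. x g \<in> T) \<and> lft (x 0) = l0 \<and>
     (\<forall>g. Suc g < G \<longrightarrow> rgt (x g) = lft (x (Suc g))) \<and>
     (\<forall>g<length vs. dwn (x g) = vs ! g) \<and>
     (\<forall>g. g + length vs < G \<longrightarrow> upp (x g) = dwn (x (g + length vs)))"

text \<open>
  A vertical colour is \<open>None\<close> in the first column of a row and otherwise lists, for each tape, the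
  symbol in a cell and whether the head is there. A horizontal colour consists of the transition
  that is applied in the current row and, for each tape, the direction in which the head crosses the
  border between two cells (\<open>Stay\<close> if it does not). The tile in the first column selects the
  transition; it checks that its source is the target of the previous one, whose colour arrives
  from the end of the previous row.
\<close>

type_synonym move = "nat \<times> nat list \<times> nat \<times> (nat \<times> direction) list"
type_synonym hcolour = "move \<times> direction list"
type_synonym vcolour = "(nat \<times> bool) list option"

fun source :: "move \<Rightarrow> nat" where "source (q, as, q', us) = q"
fun target :: "move \<Rightarrow> nat" where "target (q, as, q', us) = q'"

text \<open>
  One tape of one cell, for a transition reading \<open>b\<close> and performing \<open>(a, u)\<close>: contents before and
  after the step, and head movements across the left and the right border.
\<close>

fun tape_ok :: "nat \<Rightarrow> nat \<times> direction \<Rightarrow> nat \<times> bool \<Rightarrow> nat \<times> bool \<Rightarrow> direction \<Rightarrow> direction \<Rightarrow> bool" where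
  "tape_ok b (a, u) (c, h) (c', h') fl fr \<longleftrightarrow>
     (if h then c = b \<and> c' = a else c' = c) \<and>
     (fr = Right \<longleftrightarrow> h \<and> u = Right) \<and> (fl = Left \<longleftrightarrow> h \<and> u = Left) \<and>
     (h' \<longleftrightarrow> h \<and> u = Stay \<or> fl = Right \<or> fr = Left)"

text \<open>A border carries \<open>Right\<close> iff the cell on its left sends the head over, and
  \<open>Left\<close> iff the cell on its right does, so adjacent cells agree on every movement.
  \<open>Stay\<close> on the outer borders keeps heads from entering or leaving the window.\<close>

lemma tape_ok_sound:
  assumes ok: "\<And>c. c < n \<Longrightarrow>
      tape_ok b (a, u) (t (int c - lo), h = int c - lo) (C c) (F c) (F (Suc c))"
    and F: "F 0 = Stay" "F n = Stay" and h: "- lo \<le> h" "h < int n - lo"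
  shows "t h = b" "c < n \<Longrightarrow> C c = ((t(h := a)) (int c - lo), h + shift u = int c - lo)"
proof -
  have "nat (h + lo) < n" "int (nat (h + lo)) - lo = h" using h by auto
  with ok[of "nat (h + lo)"] show "t h = b"
    by (cases "C (nat (h + lo))") auto
  have right: "F c = Right \<longleftrightarrow> h + 1 = int c - lo \<and> u = Right" if "c < n" for c
  proof (cases c)
    case 0
    then show ?thesis using F h by auto
  next
    case (Suc c')
    then show ?thesis using ok[of c'] that by (cases "C c'") auto
  qed
  have left: "F (Suc c) = Left \<longleftrightarrow> h - 1 = int c - lo \<and> u = Left" if "c < n" for c
  proof (cases "Suc c = n")
    case True
    then show ?thesis using F h by auto
  next
    case False
    then show ?thesis using ok[of "Suc c"] that by (cases "C (Suc c)") auto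
  qed
  assume c: "c < n"
  obtain c' h' where C: "C c = (c', h')" by (cases "C c")
  have "c' = (t(h := a)) (int c - lo)"
    using ok[OF c] C by (auto split: if_splits)
  moreover have "h' \<longleftrightarrow> h + shift u = int c - lo"
    using ok[OF c] C right[OF c] left[OF c] by (cases u) auto
  ultimately show "C c = ((t(h := a)) (int c - lo), h + shift u = int c - lo)"
    using C by simp
qed

text \<open>The border with index \<open>i\<close> is the one between the cells \<open>i - 1\<close>
  and \<open>i\<close>.\<close>

definition flag :: "int \<Rightarrow> nat \<times> direction \<Rightarrow> int \<Rightarrow> direction" where
  "flag h u i = (if h = i - 1 \<and> snd u = Right then Right else if h = i \<and> snd u = Left then Left else Stay)"

lemma tape_ok_complete:
  assumes "i' = i + 1" "t h = b"
  shows "tape_ok b u (t i, h = i) (fst (act u (t, h)) i, snd (act u (t, h)) = i)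
    (flag h u i) (flag h u i')"
  using assms by (cases u; cases "snd u") (auto simp: flag_def)

definition cell :: "tape list \<Rightarrow> int \<Rightarrow> (nat \<times> bool) list" where
  "cell ts i = map (\<lambda>(t, h). (t i, h = i)) ts"

text \<open>Column \<open>Suc c\<close> shows tape cell \<open>c - lo\<close>, so the window extends
  from \<open>- lo\<close> to \<open>n - lo - 1\<close>.\<close>

definition row :: "nat \<Rightarrow> nat \<Rightarrow> tape list \<Rightarrow> vcolour list" where
  "row lo n ts = None # map (\<lambda>c. Some (cell ts (int c - int lo))) [0..<n]"

lemma row_simps [simp]:
  "length (row lo n ts) = Suc n" "row lo n ts ! 0 = None"
  "c < n \<Longrightarrow> row lo n ts ! Suc c = Some (cell ts (int c - int lo))"
  by (simp_all add: row_def)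

context
  fixes M :: machine
  assumes M: "turing_machine M"
begin

definition symbols :: "nat set" where
  "symbols = {0, 1, 2} \<union> fst ` (\<Union>(q, as, q', us) \<in> trans M. set us)"

text \<open>
  The move \<open>idle\<close> repeats an accepting configuration. Since all computations are short, a helix with
  sufficiently many rows uses it at some point, so no condition on the last row is needed.
\<close>

definition idle :: move where "idle = (accept M, [], accept M, [])"
text \<open>A fictitious move whose target is the start state; it is the horizontal colour that
  enters the first tile.\<close>

definition initial :: move where "initial = (start M, [], start M, [])"

definition stays :: "direction list" where "stays = replicate (tapes M) Stay"

definition state_tiles :: "(hcolour, vcolour) tile set" where
  "state_tiles = {Tile (m, stays) (m', stays) None None | m m'.
     m \<in> insert initial (insert idle (trans M)) \<and> m' \<in> insert idle (trans M) \<and> source m' = target m}"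

definition cells :: "(nat \<times> bool) list set" where
  "cells = {cs. set cs \<subseteq> symbols \<times> UNIV \<and> length cs = tapes M}"

definition idle_tiles :: "(hcolour, vcolour) tile set" where
  "idle_tiles = (\<lambda>cs. Tile (idle, stays) (idle, stays) (Some cs) (Some cs)) ` cells"

definition move_ok :: "move \<Rightarrow> (nat \<times> bool) list \<Rightarrow> (nat \<times> bool) list \<Rightarrow> direction list \<Rightarrow> direction list \<Rightarrow> bool" where
  "move_ok = (\<lambda>(q, as, q', us) cs cs' fl fr.
     \<forall>j<tapes M. tape_ok (as ! j) (us ! j) (cs ! j) (cs' ! j) (fl ! j) (fr ! j))"

definition move_tiles :: "(hcolour, vcolour) tile set" where
  "move_tiles = {Tile (m, fl) (m, fr) (Some cs) (Some cs') | m cs cs' fl fr. m \<in> trans M \<and> cs \<in> cells \<and> cs' \<in> cells \<and>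
        length fl = tapes M \<and> length fr = tapes M \<and> move_ok m cs cs' fl fr}"

definition tiles :: "(hcolour, vcolour) tile set" where
  "tiles = state_tiles \<union> idle_tiles \<union> move_tiles"

lemma state_tilesE:
  assumes "y \<in> state_tiles"
  obtains m m' where "y = Tile (m, stays) (m', stays) None None" "m' \<in> insert idle (trans M)"
    "source m' = target m"
  using assms unfolding state_tiles_def by blast

lemma move_tilesE:
  assumes "y \<in> move_tiles"
  obtains m cs cs' fl fr where "y = Tile (m, fl) (m, fr) (Some cs) (Some cs')"
    "cs' \<in> cells" "move_ok m cs cs' fl fr"
  using assms unfolding move_tiles_def by blast

lemma move_tilesI:
  "m \<in> trans M \<Longrightarrow> cs \<in> cells \<Longrightarrow> cs' \<in> cells \<Longrightarrow> length fl = tapes M \<Longrightarrow> length fr = tapes M \<Longrightarrow>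
     move_ok m cs cs' fl fr \<Longrightarrow> Tile (m, fl) (m, fr) (Some cs) (Some cs') \<in> move_tiles"
  unfolding move_tiles_def by blast

lemma state_tilesI:
  "m \<in> insert initial (insert idle (trans M)) \<Longrightarrow> m' \<in> insert idle (trans M) \<Longrightarrow> source m' = target m \<Longrightarrow>
     Tile (m, stays) (m', stays) None None \<in> state_tiles"
  unfolding state_tiles_def by blast

lemma finite_tiles: "finite tiles"
proof -
  have fT: "finite (trans M)" using M by (simp add: turing_machine_def)
  have fS: "finite symbols" unfolding symbols_def using fT by auto
  have "(UNIV :: direction set) = {Left, Stay, Right}" by (auto intro: direction.exhaust)
  then have fD: "finite (UNIV :: direction set)" by (metis finite.emptyI finite.insertI)
  have "finite cells" unfolding cells_def
    by (rule finite_lists_length_eq) (simp add: fS)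
  moreover have "finite {fl :: direction list. length fl = tapes M}"
    using finite_lists_length_eq[OF fD, of "tapes M"] by simp
  ultimately have "finite (trans M \<times> cells \<times> cells \<times> {fl :: direction list. length fl = tapes M} \<times>
      {fl :: direction list. length fl = tapes M})"
    using fT by auto
  then have "finite ((\<lambda>(m, cs, cs', fl, fr). Tile (m, fl) (m, fr) (Some cs) (Some cs')) `
      (trans M \<times> cells \<times> cells \<times> {fl :: direction list. length fl = tapes M} \<times>
      {fl :: direction list. length fl = tapes M}))"
    by (rule finite_imageI)
  moreover have "move_tiles \<subseteq> (\<lambda>(m, cs, cs', fl, fr). Tile (m, fl) (m, fr) (Some cs) (Some cs')) `
      (trans M \<times> cells \<times> cells \<times> {fl :: direction list. length fl = tapes M} \<times>
      {fl :: direction list. length fl = tapes M})" (is "_ \<subseteq> ?f ` ?X")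
  proof
    fix y assume "y \<in> move_tiles"
    then obtain m cs cs' fl fr where y: "y = Tile (m, fl) (m, fr) (Some cs) (Some cs')"
      "m \<in> trans M" "cs \<in> cells" "cs' \<in> cells" "length fl = tapes M" "length fr = tapes M"
      unfolding move_tiles_def by blast
    then have "y = ?f (m, cs, cs', fl, fr)" "(m, cs, cs', fl, fr) \<in> ?X" by simp_all
    then show "y \<in> ?f ` ?X" by (rule image_eqI)
  qed
  ultimately have "finite move_tiles" by (meson finite_subset)
  have "finite ((insert initial (insert idle (trans M))) \<times> insert idle (trans M))"
    using fT by auto
  then have "finite ((\<lambda>(m, m'). Tile (m, stays) (m', stays) (None :: vcolour) (None :: vcolour)) `
      (insert initial (insert idle (trans M)) \<times> insert idle (trans M)))"
    by (rule finite_imageI)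
  moreover have "state_tiles \<subseteq> (\<lambda>(m, m'). Tile (m, stays) (m', stays) None None) `
      (insert initial (insert idle (trans M)) \<times> insert idle (trans M))"
    unfolding state_tiles_def by fast
  ultimately have "finite state_tiles" by (meson finite_subset)
  then show ?thesis
    using \<open>finite cells\<close> \<open>finite move_tiles\<close> by (simp add: tiles_def idle_tiles_def)
qed

lemma trans_length:
  assumes "(q, as, q', us) \<in> trans M"
  shows "length as = tapes M" "length us = tapes M" "q \<noteq> accept M"
  using M assms by (auto simp: turing_machine_def)

lemma step_cases:
  assumes "step M (q, ts) (q', ts')"
  obtains us where "(q, map read ts, q', us) \<in> trans M" "ts' = map2 act us ts"
    "length ts = tapes M" "length us = tapes M"
  using assms
proof cases
  case (1 us)
  with trans_length[OF 1(2)] that show ?thesis by simp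
qed

text \<open>\<open>None\<close> below forces a state tile in column 0. The move it selects is handed
  on unchanged by every tile of the row, so all cells perform the same move, either
  \<open>idle\<close> or one transition.\<close>

lemma row_sound:
  assumes T: "\<And>c. c \<le> Suc n \<Longrightarrow> x c \<in> tiles"
    and H: "\<And>c. c \<le> n \<Longrightarrow> rgt (x c) = lft (x (Suc c))"
    and D: "\<And>c. c \<le> n \<Longrightarrow> dwn (x c) = row lo n ts ! c"
    and U: "dwn (x (Suc n)) = upp (x 0)"
    and l: "lft (x 0) = (m, fs)" "target m = q"
    and ts: "length ts = tapes M" "\<And>t h. (t, h) \<in> set ts \<Longrightarrow> - int lo \<le> h \<and> h < int n - int lo"
  shows "\<exists>m' fs' q' ts'. lft (x (Suc n)) = (m', fs') \<and> target m' = q' \<and>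
    (\<forall>c\<le>n. upp (x c) = row lo n ts' ! c) \<and>
    (step M (q, ts) (q', ts') \<or> q = accept M \<and> q' = q \<and> ts' = ts)"
proof -
  have "x 0 \<in> state_tiles"
    using T[of 0] D[of 0] by (auto simp: tiles_def idle_tiles_def move_tiles_def)
  then obtain m1 m' where x0: "x 0 = Tile (m1, stays) (m', stays) None None"
    "m' \<in> insert idle (trans M)" "source m' = target m1"
    by (rule state_tilesE)
  then have m': "m' \<in> insert idle (trans M)" "source m' = q" "rgt (x 0) = (m', stays)"
    and u0: "upp (x 0) = None"
    using l by auto
  \<comment> \<open>Column 0 passes \<open>None\<close> upwards, so the next row opens with a state
    tile too; its left colour \<open>stays\<close> closes the right border of this row.\<close>
  have "x (Suc n) \<in> state_tiles"
    using T[of "Suc n"] U u0 by (auto simp: tiles_def idle_tiles_def move_tiles_def)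
  then obtain m'' where m'': "lft (x (Suc n)) = (m'', stays)"
    by (rule state_tilesE) simp
  have cells: "x (Suc c) \<in> idle_tiles \<union> move_tiles" if "c < n" for c
    using T[of "Suc c"] D[of "Suc c"] that by (auto simp: tiles_def state_tiles_def)
  have pass: "fst (lft (x (Suc c))) = m'" if "c \<le> n" for c
    using that
  proof (induction c)
    case 0
    then show ?case using H[of 0] m' by (metis fst_conv le0)
  next
    case (Suc c)
    have "fst (rgt (x (Suc c))) = fst (lft (x (Suc c)))"
      using cells[of c] Suc.prems by (auto simp: idle_tiles_def move_tiles_def)
    then show ?case using Suc H[of "Suc c"] by simp
  qed
  have mm: "m'' = m'" using pass[of n] m'' by simp
  show ?thesis
  proof (cases "m' = idle")
    case True
    \<comment> \<open>No transition leaves the accepting state, so \<open>idle\<close> is not a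
      transition and no move tile carries it.\<close>
    have "x (Suc c) \<in> idle_tiles" if "c < n" for c
    proof (rule ccontr)
      assume "\<not> ?thesis"
      then have "x (Suc c) \<in> move_tiles" using cells[OF that] by auto
      then have "idle \<in> trans M" using pass[of c] True that by (auto simp: move_tiles_def)
      then show False using M by (auto simp: turing_machine_def idle_def)
    qed
    then have "upp (x (Suc c)) = row lo n ts ! Suc c" if "c < n" for c
      using that D[of "Suc c"] by (fastforce simp: idle_tiles_def)
    then have "upp (x c) = row lo n ts ! c" if "c \<le> n" for c
      using u0 that by (cases c) auto
    moreover have "target m' = q" "q = accept M" using m' True by (auto simp: idle_def)
    ultimately show ?thesis using m'' mm \<open>\<And>c. c \<le> n \<Longrightarrow> upp (x c) = row lo n ts ! c\<close> by blast
  next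
    case False
    then have tr: "m' \<in> trans M" using m' by auto
    obtain as q' us where m'_eq: "m' = (q, as, q', us)" using m'(2) by (cases m') auto
    have len: "length as = tapes M" "length us = tapes M"
      using tr m'_eq by (auto dest: trans_length)
    define F where "F c = snd (lft (x (Suc c)))" for c
    have F: "F 0 = stays" "F n = stays" using H[of 0] m'(3) m'' unfolding F_def by (metis le0 snd_conv)+
    have "\<exists>cs'. upp (x (Suc c)) = Some cs' \<and> length cs' = tapes M \<and>
        move_ok m' (cell ts (int c - int lo)) cs' (F c) (F (Suc c))" if "c < n" for c
    proof -
      have "x (Suc c) \<in> move_tiles"
        using cells[OF that] pass[of c] that False by (auto simp: idle_tiles_def)
      then obtain m cs cs' fl fr where t: "x (Suc c) = Tile (m, fl) (m, fr) (Some cs) (Some cs')"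
        "cs' \<in> cells" "move_ok m cs cs' fl fr"
        by (rule move_tilesE)
      have "rgt (x (Suc c)) = lft (x (Suc (Suc c)))" "fst (lft (x (Suc c))) = m'"
        "dwn (x (Suc c)) = Some (cell ts (int c - int lo))"
        using H[of "Suc c"] pass[of c] D[of "Suc c"] that by auto
      then have "m = m'" "cs = cell ts (int c - int lo)" "F c = fl" "F (Suc c) = fr"
        unfolding F_def t(1) by (simp_all add: t(1)) (metis snd_conv)
      then show ?thesis using t by (simp add: cells_def)
    qed
    then obtain C where C: "\<And>c. c < n \<Longrightarrow> upp (x (Suc c)) = Some (C c) \<and> length (C c) = tapes M \<and>
        move_ok m' (cell ts (int c - int lo)) (C c) (F c) (F (Suc c))"
      by metis
    have j: "as ! j = read (ts ! j) \<and> (\<forall>c<n. C c ! j = cell (map2 act us ts) (int c - int lo) ! j)"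
      if "j < tapes M" for j
    proof -
      obtain t h where th: "ts ! j = (t, h)" by (cases "ts ! j")
      obtain a u where au: "us ! j = (a, u)" by (cases "us ! j")
      have "(t, h) \<in> set ts" using th that ts(1) by (metis nth_mem)
      then have h: "- int lo \<le> h" "h < int n - int lo" using ts(2) by auto
      have 1: "tape_ok (as ! j) (a, u) (t (int c - int lo), h = int c - int lo) (C c ! j) (F c ! j) (F (Suc c) ! j)"
        if "c < n" for c
      proof -
        have "tape_ok (as ! j) (us ! j) (cell ts (int c - int lo) ! j) (C c ! j) (F c ! j) (F (Suc c) ! j)"
          using C[OF that] \<open>j < tapes M\<close> unfolding move_ok_def m'_eq by simp
        then show ?thesis
          using \<open>j < tapes M\<close> ts(1) unfolding au cell_def by (simp add: th del: tape_ok.simps)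
      qed
      note 2 = tape_ok_sound[where C = "\<lambda>c. C c ! j" and F = "\<lambda>c. F c ! j", OF 1 _ _ h]
      have "t h = as ! j" "\<And>c. c < n \<Longrightarrow> C c ! j = ((t(h := a)) (int c - int lo), h + shift u = int c - int lo)"
        using 2 F that by (auto simp: stays_def)
      then show ?thesis using th au that len ts by (simp add: cell_def)
    qed
    then have "as = map read ts" using len ts by (intro nth_equalityI) auto
    then have "step M (q, ts) (q', map2 act us ts)"
      using tr m'_eq by (auto intro: step.intros)
    moreover have "C c = cell (map2 act us ts) (int c - int lo)" if "c < n" for c
      using C[OF that] that j len ts by (intro nth_equalityI) (auto simp: cell_def)
    then have "\<forall>c\<le>n. upp (x c) = row lo n (map2 act us ts) ! c"
    proof (intro allI impI)
      fix c assume "c \<le> n" "\<And>c. c < n \<Longrightarrow> C c = cell (map2 act us ts) (int c - int lo)"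
      then show "upp (x c) = row lo n (map2 act us ts) ! c"
        using u0 C by (cases c) auto
    qed
    moreover have "target m' = q'" using m'_eq by simp
    ultimately show ?thesis using m'' mm by blast
  qed
qed

section \<open>Heads and symbols along a run\<close>

lemma step_heads:
  assumes "step M (q, ts) (q', ts')" "\<And>t h. (t, h) \<in> set ts \<Longrightarrow> \<bar>h\<bar> \<le> int r"
  shows "(t, h) \<in> set ts' \<Longrightarrow> \<bar>h\<bar> \<le> int (Suc r)"
proof -
  assume *: "(t, h) \<in> set ts'"
  obtain us where us: "ts' = map2 act us ts" using assms(1) by (rule step_cases)
  obtain v s where "(v, s) \<in> set (zip us ts)" "(t, h) = act v s"
    using * us by auto
  then obtain a u t0 h0 where "(t0, h0) \<in> set ts" "(t, h) = act (a, u) (t0, h0)"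
    by (metis surj_pair set_zip_rightD)
  then show ?thesis using assms(2)[of t0 h0] by (cases u) auto
qed

lemma step_symbols:
  assumes "step M (q, ts) (q', ts')" "\<And>t h. (t, h) \<in> set ts \<Longrightarrow> range t \<subseteq> symbols"
  shows "(t, h) \<in> set ts' \<Longrightarrow> range t \<subseteq> symbols"
proof -
  assume *: "(t, h) \<in> set ts'"
  obtain us where us: "(q, map read ts, q', us) \<in> trans M" "ts' = map2 act us ts"
    using assms(1) by (rule step_cases)
  obtain a u t0 h0 where 1: "(a, u) \<in> set us" "(t0, h0) \<in> set ts" "(t, h) = act (a, u) (t0, h0)"
  proof -
    obtain v s where "(v, s) \<in> set (zip us ts)" "(t, h) = act v s"
      using * us(2) by auto
    then show thesis using that by (metis surj_pair set_zip_leftD set_zip_rightD)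
  qed
  have "a \<in> symbols" using 1(1) us(1) unfolding symbols_def by force
  then show ?thesis using assms(2)[OF 1(2)] 1(3) by auto
qed

lemma init_tapes:
  "fst (init M w) = start M" "length (snd (init M w)) = tapes M"
  "(t, h) \<in> set (snd (init M w)) \<Longrightarrow> h = 0 \<and> range t \<subseteq> symbols"
proof -
  have "word_tape v i \<in> symbols" for v i by (simp add: word_tape_def symbols_def)
  then show "(t, h) \<in> set (snd (init M w)) \<Longrightarrow> h = 0 \<and> range t \<subseteq> symbols"
    by (auto simp: init_def)
qed (use M in \<open>auto simp: init_def turing_machine_def\<close>)

lemma run_invariants:
  assumes "(step M ^^ r) (init M w) (q, ts)"
  shows "length ts = tapes M \<and> (\<forall>(t, h) \<in> set ts. \<bar>h\<bar> \<le> int r \<and> range t \<subseteq> symbols)"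
  using assms
proof (induction r arbitrary: q ts)
  case 0
  then show ?case using init_tapes(3)[where w = w] init_tapes(2)[of w] by auto
next
  case (Suc r)
  then obtain q0 ts0 where *: "(step M ^^ r) (init M w) (q0, ts0)" "step M (q0, ts0) (q, ts)" by auto
  from Suc.IH[OF *(1)] have "\<forall>x \<in> set ts0. \<bar>snd x\<bar> \<le> int r \<and> range (fst x) \<subseteq> symbols"
    by (simp add: case_prod_unfold)
  then have IH: "\<And>t h. (t, h) \<in> set ts0 \<Longrightarrow> \<bar>h\<bar> \<le> int r"
    "\<And>t h. (t, h) \<in> set ts0 \<Longrightarrow> range t \<subseteq> symbols" by (metis fst_conv snd_conv)+
  have "length ts = tapes M" using *(2) by (rule step_cases) simp
  then show ?case using step_heads[OF *(2)] step_symbols[OF *(2)] IH by blast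
qed

text \<open>Rows simulate steps until the accepting state turns up. After \<open>P + 1\<close> rows
  either it has turned up or there is a run of \<open>P + 1\<close> steps, which
  \<open>bound\<close> forbids. In the rows simulated the heads are within \<open>P\<close> of the
  origin, hence inside the window; one row more in \<open>G\<close> keeps all edges used inside the
  helix.\<close>

lemma helix_sound:
  assumes bound: "\<And>r c. (step M ^^ r) (init M w) c \<Longrightarrow> r \<le> P"
    and lo: "P + 1 \<le> lo" "lo + P + 2 \<le> n" and G: "(P + 2) * Suc n \<le> G"
    and x: "helix tiles (initial, stays) (row lo n (snd (init M w))) G x"
  shows "\<exists>c. (step M)\<^sup>*\<^sup>* (init M w) c \<and> fst c = accept M"
proof -
  let ?W = "Suc n"
  have inv: "\<exists>q ts m fs. lft (x (r * ?W)) = (m, fs) \<and> target m = q \<and>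
     (\<forall>c\<le>n. dwn (x (r * ?W + c)) = row lo n ts ! c) \<and> length ts = tapes M \<and>
     (\<forall>(t, h) \<in> set ts. \<bar>h\<bar> \<le> int r) \<and>
     ((step M ^^ r) (init M w) (q, ts) \<or> (step M)\<^sup>*\<^sup>* (init M w) (q, ts) \<and> q = accept M)"
    if "r \<le> P + 1" for r
    using that
  proof (induction r)
    case 0
    have "\<forall>c\<le>n. dwn (x c) = row lo n (snd (init M w)) ! c" "lft (x 0) = (initial, stays)"
      using x by (auto simp: helix_def)
    moreover have "target initial = start M" by (simp add: initial_def)
    moreover have "(step M ^^ 0) (init M w) (start M, snd (init M w))"
      using init_tapes(1)[of w] by (metis prod.collapse relpowp_0_I)
    ultimately show ?case
      using init_tapes(3)[where w = w] init_tapes(2)[of w] by fastforce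
  next
    case (Suc r)
    then obtain q ts m fs where IH: "lft (x (r * ?W)) = (m, fs)" "target m = q"
     "\<And>c. c \<le> n \<Longrightarrow> dwn (x (r * ?W + c)) = row lo n ts ! c" "length ts = tapes M"
     "\<And>t h. (t, h) \<in> set ts \<Longrightarrow> \<bar>h\<bar> \<le> int r"
     "(step M ^^ r) (init M w) (q, ts) \<or> (step M)\<^sup>*\<^sup>* (init M w) (q, ts) \<and> q = accept M"
      by fastforce
    have "Suc (Suc r) * ?W \<le> (P + 2) * ?W" using Suc.prems by (intro mult_le_mono1) simp
    then have lt: "r * ?W + ?W + c < G" if "c \<le> n" for c using G that by simp
    have row_end: "r * ?W + Suc n = Suc r * ?W" by simp
    have "\<exists>m' fs' q' ts'. lft (x (r * ?W + Suc n)) = (m', fs') \<and> target m' = q' \<and>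
      (\<forall>c\<le>n. upp (x (r * ?W + c)) = row lo n ts' ! c) \<and>
      (step M (q, ts) (q', ts') \<or> q = accept M \<and> q' = q \<and> ts' = ts)"
    proof (rule row_sound)
      show "x (r * ?W + c) \<in> tiles" if "c \<le> Suc n" for c
        using x lt[of 0] that by (simp add: helix_def)
      show "rgt (x (r * ?W + c)) = lft (x (r * ?W + Suc c))" if "c \<le> n" for c
        using x lt[of 0] that by (simp add: helix_def)
      show "dwn (x (r * ?W + Suc n)) = upp (x (r * ?W + 0))"
        using x lt[of 0] by (auto simp: helix_def)
      show "- int lo \<le> h \<and> h < int n - int lo" if "(t, h) \<in> set ts" for t h
        using IH(5)[OF that] Suc.prems lo by auto
    qed (use IH in auto)
    then obtain m' fs' q' ts' where 1: "lft (x (Suc r * ?W)) = (m', fs')" "target m' = q'"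
      "\<And>c. c \<le> n \<Longrightarrow> upp (x (r * ?W + c)) = row lo n ts' ! c"
      "step M (q, ts) (q', ts') \<or> q = accept M \<and> q' = q \<and> ts' = ts"
      unfolding row_end by blast
    have 2: "dwn (x (Suc r * ?W + c)) = row lo n ts' ! c" if "c \<le> n" for c
    proof -
      have "upp (x (r * ?W + c)) = dwn (x (r * ?W + c + ?W))"
        using x lt[OF that] by (auto simp: helix_def add_ac)
      then show ?thesis using 1(3)[OF that] by (simp add: algebra_simps)
    qed
    have no_step: "\<not> step M (accept M, ts) c" for c
      using M by (auto simp: turing_machine_def step.simps)
    from 1(4) show ?case
    proof
      assume st: "step M (q, ts) (q', ts')"
      with IH(6) no_step have "(step M ^^ Suc r) (init M w) (q', ts')" by auto
      moreover have "length ts' = tapes M" using st by (rule step_cases) simp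
      moreover have "\<bar>h\<bar> \<le> int (Suc r)" if "(t, h) \<in> set ts'" for t h
        using step_heads[OF st IH(5) that] .
      ultimately show ?thesis using 1(1,2) 2 by fastforce
    next
      assume "q = accept M \<and> q' = q \<and> ts' = ts"
      moreover from this IH(6) have "(step M)\<^sup>*\<^sup>* (init M w) (q', ts') \<and> q' = accept M"
        by (auto dest: relpowp_imp_rtranclp)
      ultimately show ?thesis using 1(1,2) 2 IH(4,5) by fastforce
    qed
  qed
  then obtain q ts where "(step M ^^ (P + 1)) (init M w) (q, ts) \<or>
      (step M)\<^sup>*\<^sup>* (init M w) (q, ts) \<and> q = accept M"
    by blast
  with bound show ?thesis by fastforce
qed

text \<open>Any number \<open>G\<close> of positions can be tiled: after step \<open>N\<close> the
  configuration is frozen and every further row uses \<open>idle\<close>.\<close>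

lemma helix_complete:
  assumes acc: "(step M ^^ N) (init M w) c" "fst c = accept M"
    and lo: "N < lo" "lo + N + 1 < n"
  shows "\<exists>x. helix tiles (initial, stays) (row lo n (snd (init M w))) G x"
proof -
  obtain f where f: "f 0 = init M w" "f N = c" "\<And>i. i < N \<Longrightarrow> step M (f i) (f (Suc i))"
    using acc(1) by (auto simp: relpowp_fun_conv)
  define C where "C i = f (min i N)" for i
  define tp where "tp i = snd (C i)" for i
  have C0: "C 0 = init M w" using f by (simp add: C_def)
  have CN: "fst (C i) = accept M" if "N \<le> i" for i
    using f acc(2) that by (auto simp: C_def min_def)
  have st: "step M (C i) (C (Suc i))" if "i < N" for i using f(3)[OF that] that by (simp add: C_def)
  have stay: "C (Suc i) = C i" if "N \<le> i" for i using that by (simp add: C_def min_def)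
  have pow: "i \<le> N \<Longrightarrow> (step M ^^ i) (init M w) (C i)" for i
  proof (induction i)
    case (Suc i)
    then show ?case using st[of i] by auto
  qed (simp add: C0)
  have inv: "length (tp i) = tapes M \<and> (\<forall>(t, h) \<in> set (tp i). \<bar>h\<bar> \<le> int (min i N) \<and> range t \<subseteq> symbols)" for i
    using run_invariants[of "min i N" w "fst (C i)" "tp i"] pow[of "min i N"]
    by (simp add: tp_def C_def)
  have "\<exists>m. if i < N then m \<in> trans M \<and> (\<exists>us. m = (fst (C i), map read (tp i), fst (C (Suc i)), us) \<and>
      tp (Suc i) = map2 act us (tp i) \<and> length us = tapes M) else m = idle" for i
  proof (cases "i < N")
    case True
    then have "step M (fst (C i), tp i) (fst (C (Suc i)), tp (Suc i))" using st[of i] by (simp add: tp_def)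
    then obtain us where "(fst (C i), map read (tp i), fst (C (Suc i)), us) \<in> trans M"
      "tp (Suc i) = map2 act us (tp i)" "length us = tapes M" by (rule step_cases)
    then show ?thesis using True by auto
  qed auto
  then obtain m where m: "\<And>i. if i < N then m i \<in> trans M \<and>
      (\<exists>us. m i = (fst (C i), map read (tp i), fst (C (Suc i)), us) \<and>
      tp (Suc i) = map2 act us (tp i) \<and> length us = tapes M) else m i = idle"
    by metis
  define us where "us i = snd (snd (snd (m i)))" for i
  have mN: "m i \<in> trans M" "m i = (fst (C i), map read (tp i), fst (C (Suc i)), us i)"
    "tp (Suc i) = map2 act (us i) (tp i)" "length (us i) = tapes M" if "i < N" for i
    using m[of i] that by (auto simp: us_def)
  have mI: "m i = idle" if "N \<le> i" for i using m[of i] that by auto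
  \<comment> \<open>The state tile of a row receives the move of the row before it, and that of row
    0 receives \<open>initial\<close>.\<close>
  define m' where "m' i = (case i of 0 \<Rightarrow> initial | Suc i \<Rightarrow> m i)" for i
  define F where "F i p = (if i < N then map2 (\<lambda>(t, h) u. flag h u p) (tp i) (us i) else stays)" for i p
  define x where "x g = (let i = g div Suc n in case g mod Suc n of
      0 \<Rightarrow> Tile (m' i, stays) (m i, stays) None None
    | Suc c \<Rightarrow> Tile (m i, F i (int c - int lo)) (m i, F i (int (Suc c) - int lo))
        (Some (cell (tp i) (int c - int lo))) (Some (cell (tp (Suc i)) (int c - int lo))))" for g
  have cells: "cell (tp i) p \<in> cells" for i p
    using inv[of i] by (fastforce simp: cell_def cells_def)
  \<comment> \<open>Heads stay within distance \<open>N\<close> of the origin, so none crosses a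
    border of the window.\<close>
  have Fedge: "F i (int 0 - int lo) = stays" "F i (int n - int lo) = stays" for i
  proof -
    have "flag h u (- int lo) = Stay \<and> flag h u (int n - int lo) = Stay" if "(t, h) \<in> set (tp i)" for t h u
    proof -
      have "\<bar>h\<bar> \<le> int N" using inv[of i] that by fastforce
      then show ?thesis using lo by (auto simp: flag_def)
    qed
    then have "i < N \<Longrightarrow> map2 (\<lambda>(t, h) u. flag h u p) (tp i) (us i) = replicate (length (tp i)) Stay"
      if "p \<in> {- int lo, int n - int lo}" for p
      using that mN(4)[of i] inv[of i]
      by (intro nth_equalityI) (auto simp: case_prod_unfold, (metis nth_mem prod.collapse)+)
    then show "F i (int 0 - int lo) = stays" "F i (int n - int lo) = stays"
      using inv[of i] by (auto simp: F_def stays_def)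
  qed
  have "x g \<in> tiles" for g
  proof (cases "g mod Suc n")
    case 0
    let ?i = "g div Suc n"
    have "m' ?i \<in> insert initial (insert idle (trans M))" "m ?i \<in> insert idle (trans M)"
      using m[of ?i] m[of "?i - 1"] by (auto simp: m'_def split: nat.splits if_splits)
    moreover have "source (m ?i) = fst (C ?i)"
      using mN(2)[of ?i] mI[of ?i] CN[of ?i] by (cases "?i < N") (auto simp: idle_def)
    moreover have "target (m' ?i) = fst (C ?i)"
    proof (cases ?i)
      case 0
      then show ?thesis by (simp add: m'_def C0 init_def initial_def)
    next
      case (Suc i)
      then show ?thesis using mN(2)[of i] mI[of i] CN[of ?i]
        by (cases "i < N") (auto simp: m'_def idle_def)
    qed
    ultimately have "Tile (m' ?i, stays) (m ?i, stays) None None \<in> state_tiles"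
      by (intro state_tilesI) simp_all
    then show ?thesis using 0 by (simp add: x_def Let_def tiles_def)
  next
    case (Suc c)
    let ?i = "g div Suc n"
    show ?thesis
    proof (cases "?i < N")
      case True
      note mi = mN[OF True]
      have tpl: "length (tp ?i) = tapes M" using inv by blast
      have "move_ok (m ?i) (cell (tp ?i) (int c - int lo)) (cell (tp (Suc ?i)) (int c - int lo))
          (F ?i (int c - int lo)) (F ?i (int (Suc c) - int lo))"
        unfolding mi(2) move_ok_def prod.case
      proof (intro allI impI)
        fix j assume j: "j < tapes M"
        obtain t h where th: "tp ?i ! j = (t, h)" by (cases "tp ?i ! j")
        have "tape_ok (t h) (us ?i ! j) (t (int c - int lo), h = int c - int lo)
            (fst (act (us ?i ! j) (t, h)) (int c - int lo), snd (act (us ?i ! j) (t, h)) = int c - int lo)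
            (flag h (us ?i ! j) (int c - int lo)) (flag h (us ?i ! j) (int (Suc c) - int lo))"
          by (rule tape_ok_complete) auto
        then show "tape_ok (map read (tp ?i) ! j) (us ?i ! j) (cell (tp ?i) (int c - int lo) ! j)
            (cell (tp (Suc ?i)) (int c - int lo) ! j) (F ?i (int c - int lo) ! j) (F ?i (int (Suc c) - int lo) ! j)"
          using j th tpl mi True by (simp add: cell_def F_def case_prod_unfold)
      qed
      moreover have "length (F ?i p) = tapes M" for p using mi tpl True by (simp add: F_def)
      ultimately have "x g \<in> move_tiles"
        using Suc mi(1) cells by (simp only: x_def Let_def nat.case) (rule move_tilesI)
      then show ?thesis by (simp add: tiles_def)
    next
      case False
      then have "tp (Suc ?i) = tp ?i" "m ?i = idle" using stay[of ?i] mI by (auto simp: tp_def)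
      then have "x g \<in> idle_tiles" using Suc False cells
        by (auto simp: x_def Let_def idle_tiles_def F_def)
      then show ?thesis by (simp add: tiles_def)
    qed
  qed
  moreover have "lft (x 0) = (initial, stays)" by (simp add: x_def m'_def)
  moreover have "rgt (x g) = lft (x (Suc g))" for g
  proof (cases "Suc (g mod Suc n) = Suc n")
    case True
    then have "Suc g mod Suc n = 0" "Suc g div Suc n = Suc (g div Suc n)"
      by (simp_all add: mod_Suc div_Suc)
    then show ?thesis using True Fedge(1,2)[of "g div Suc n"]
      by (cases "g mod Suc n") (auto simp: x_def Let_def m'_def)
  next
    case False
    then have "Suc g mod Suc n = Suc (g mod Suc n)" "Suc g div Suc n = g div Suc n"
      by (simp_all add: mod_Suc div_Suc)
    then show ?thesis using Fedge(1)[of "g div Suc n"]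
      by (cases "g mod Suc n") (auto simp: x_def Let_def)
  qed
  moreover have "dwn (x g) = row lo n (snd (init M w)) ! g" if "g < Suc n" for g
    using that by (cases g) (auto simp: x_def Let_def tp_def C0)
  moreover have "upp (x g) = dwn (x (g + Suc n))" for g
  proof -
    have "(g + Suc n) mod Suc n = g mod Suc n" "(g + Suc n) div Suc n = Suc (g div Suc n)"
      by (simp_all only: mod_add_self2 div_add_self2 Zero_not_Suc not_False_eq_True)
    then show ?thesis unfolding x_def Let_def by (simp only:) (simp split: nat.split)
  qed
  ultimately show ?thesis
    by (intro exI[of _ x]) (simp add: helix_def)
qed

end

section \<open>Tilings as subset sums\<close>

lemma base_digits_less:
  fixes c :: "nat \<Rightarrow> nat"
  assumes "\<And>h. h < G \<Longrightarrow> c h < Q"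
  shows "(\<Sum>h<G. c h * Q ^ h) < Q ^ G"
  using assms
proof (induction G)
  case (Suc G)
  have "(\<Sum>h<Suc G. c h * Q ^ h) < Q ^ G + c G * Q ^ G" using Suc by simp
  also have "\<dots> = (c G + 1) * Q ^ G" by simp
  also have "\<dots> \<le> Q * Q ^ G" using Suc.prems[of G] by (intro mult_le_mono1) simp
  finally show ?case by simp
qed simp

lemma base_digits_unique:
  fixes c c' :: "nat \<Rightarrow> nat"
  assumes "\<And>h. h < G \<Longrightarrow> c h < Q" "\<And>h. h < G \<Longrightarrow> c' h < Q"
    and "(\<Sum>h<G. c h * Q ^ h) = (\<Sum>h<G. c' h * Q ^ h)" "h < G"
  shows "c h = c' h"
  using assms
proof (induction G)
  case (Suc G)
  let ?s = "\<Sum>h<G. c h * Q ^ h" and ?s' = "\<Sum>h<G. c' h * Q ^ h"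
  have lt: "?s < Q ^ G" "?s' < Q ^ G" using Suc.prems by (auto intro!: base_digits_less)
  have eq: "?s + c G * Q ^ G = ?s' + c' G * Q ^ G" using Suc.prems(3) by simp
  have "(?s + c G * Q ^ G) mod Q ^ G = ?s" "(?s' + c' G * Q ^ G) mod Q ^ G = ?s'"
    using lt by auto
  with eq have "?s = ?s'" by simp
  moreover have "0 < Q" using Suc.prems(1)[of 0] by auto
  moreover from calculation eq have "c G = c' G" by simp
  ultimately show ?case using Suc by (cases "h = G") auto
qed simp

lemma three_digits_unique:
  fixes a b c a' b' c' D :: nat
  assumes "a < D" "b < D" "a' < D" "b' < D" "a + D * b + D\<^sup>2 * c = a' + D * b' + D\<^sup>2 * c'"
  shows "a = a'" "b = b'" "c = c'"
proof -
  have *: "x = x' \<and> y = y'" if "x < D" "x' < D" "x + D * y = x' + D * y'" for x y x' y' :: nat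
  proof -
    have "x = (x + D * y) mod D" using that(1) by simp
    also have "\<dots> = x'" unfolding that(3) using that(2) by simp
    finally have "x = x'" .
    with that show ?thesis by auto
  qed
  have "a + D * (b + D * c) = a' + D * (b' + D * c')"
    using assms(5) by (simp add: algebra_simps power2_eq_square)
  from *[OF assms(1,3) this] have "a = a'" "b + D * c = b' + D * c'" by auto
  moreover from *[OF assms(2,4) this(2)] have "b = b'" "c = c'" by auto
  ultimately show "a = a'" "b = b'" "c = c'" by auto
qed

lemma three_digits_less:
  fixes a b c D :: nat
  assumes "a < D" "b < D" "c < D"
  shows "a + D * b + D\<^sup>2 * c < D ^ 3"
proof -
  have "a + D * b < D * (b + 1)" using assms by simp
  also have "\<dots> \<le> D * D" using assms by (intro mult_le_mono2) simp
  finally have "a + D * b + D\<^sup>2 * c < D\<^sup>2 * (c + 1)" by (simp add: power2_eq_square)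
  also have "\<dots> \<le> D\<^sup>2 * D" using assms by (intro mult_le_mono2) simp
  finally show ?thesis by (simp add: power3_eq_cube power2_eq_square)
qed

text \<open>\<open>D\<close> exceeds every digit sum over all items: a position receives at most
  \<open>n * C\<close> from its own tiles and \<open>n * C\<close> from those of one earlier
  position. The factor 2 in the bounds on left and lower colours leaves each tile a contribution of
  at least half of \<open>C\<close>.\<close>

locale tile_numbers =
  fixes n C D W G l0 :: nat and tl tr td tu sg :: "nat \<Rightarrow> nat"
  assumes n: "4 \<le> n" and W: "2 \<le> W" "W \<le> G"
    and colours: "\<And>i. i < n \<Longrightarrow> 2 * tl i \<le> C" "\<And>i. i < n \<Longrightarrow> 2 * td i \<le> C"
      "\<And>i. i < n \<Longrightarrow> tr i \<le> C" "\<And>i. i < n \<Longrightarrow> tu i \<le> C"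
    and l0: "l0 \<le> C" and sg: "\<And>h. h < W \<Longrightarrow> sg h \<le> C"
    and C: "1 \<le> C" and D: "2 * n * C < D"
begin

text \<open>
  Position \<open>h\<close> owns three digits in base \<open>D\<close>: they count the tiles chosen at \<open>h\<close>, and compare the
  colours of the horizontal and of the vertical edge ending at \<open>h\<close>. An edge contributes \<open>x\<close> at
  its beginning and \<open>C - y\<close> at its end, so \<open>x = y\<close> means that the digit is \<open>C\<close>. A condition on
  an edge without beginning is expressed by a different digit in the targets \<open>t1\<close> and \<open>t2\<close>.
\<close>

definition e1 :: "nat \<times> nat \<Rightarrow> nat \<Rightarrow> nat" where
  "e1 = (\<lambda>(g, i) h. (if h = g then C - tl i else 0) + (if h = Suc g then tr i else 0))"
definition e2 :: "nat \<times> nat \<Rightarrow> nat \<Rightarrow> nat" where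
  "e2 = (\<lambda>(g, i) h. (if h = g then C - td i else 0) + (if h = g + W then tu i else 0))"
definition e0 :: "nat \<times> nat \<Rightarrow> nat \<Rightarrow> nat" where
  "e0 = (\<lambda>(g, i) h. if h = g then 1 else 0)"
definition block :: "nat \<times> nat \<Rightarrow> nat \<Rightarrow> nat" where
  "block x h = e0 x h + D * e1 x h + D\<^sup>2 * e2 x h"
definition weight :: "nat \<times> nat \<Rightarrow> nat" where
  "weight x = (\<Sum>h<G. block x h * (D ^ 3) ^ h)"

definition all_l :: nat where "all_l = (\<Sum>i<n. C - tl i)"
definition all_d :: nat where "all_d = (\<Sum>i<n. C - td i)"
definition all_r :: nat where "all_r = (\<Sum>i<n. tr i)"
definition all_u :: nat where "all_u = (\<Sum>i<n. tu i)"

definition t1 :: "nat \<Rightarrow> nat" where "t1 h = C - (if h = 0 then l0 else 0)"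
definition t2 :: "nat \<Rightarrow> nat" where "t2 h = C - (if h < W then sg h else 0)"
definition s1 :: "nat \<Rightarrow> nat" where "s1 h = all_l + (if h = 0 then 0 else all_r)"
definition s2 :: "nat \<Rightarrow> nat" where "s2 h = all_d + (if h < W then 0 else all_u)"

text \<open>
  Digit by digit, \<open>bound\<close> is the sum of all weights minus the target, and \<open>fill\<close> is this sum minus
  twice the target.
\<close>

definition cobound :: "nat \<Rightarrow> nat" where
  "cobound h = (n - 1) + D * (s1 h - t1 h) + D\<^sup>2 * (s2 h - t2 h)"
definition cofill :: "nat \<Rightarrow> nat" where
  "cofill h = (n - 2) + D * (s1 h - 2 * t1 h) + D\<^sup>2 * (s2 h - 2 * t2 h)"
definition bound :: nat where "bound = (\<Sum>h<G. cobound h * (D ^ 3) ^ h)"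
definition fill :: nat where "fill = (\<Sum>h<G. cofill h * (D ^ 3) ^ h)"

section \<open>Digit sums over all items\<close>

abbreviation items :: "(nat \<times> nat) set" where "items \<equiv> {..<G} \<times> {..<n}"

lemma sum_items: "sum f items = (\<Sum>g<G. \<Sum>i<n. f (g, i))"
  by (simp add: sum.cartesian_product)

lemma sum_items_e0: "h < G \<Longrightarrow> (\<Sum>x\<in>items. e0 x h) = n"
proof -
  assume h: "h < G"
  have "(\<Sum>x\<in>items. e0 x h) = (\<Sum>g<G. if h = g then n else 0)"
    unfolding sum_items by (intro sum.cong) (simp_all add: e0_def)
  then show ?thesis using h by simp
qed

lemma sum_items_e1: "h < G \<Longrightarrow> (\<Sum>x\<in>items. e1 x h) = s1 h"
proof -
  assume h: "h < G"
  have "(\<Sum>x\<in>items. e1 x h) = (\<Sum>g<G. if h = g then all_l else 0) + (\<Sum>g<G. if h = Suc g then all_r else 0)"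
    unfolding sum_items sum.distrib[symmetric]
    by (intro sum.cong) (auto simp: e1_def all_l_def all_r_def sum.distrib)
  also have "(\<Sum>g<G. if h = Suc g then all_r else 0) = (if h = 0 then 0 else all_r)"
    using h by (cases h) auto
  finally show ?thesis using h by (simp add: s1_def)
qed

lemma sum_items_e2: "h < G \<Longrightarrow> (\<Sum>x\<in>items. e2 x h) = s2 h"
proof -
  assume h: "h < G"
  have "h - W < G" using h by simp
  have "(\<Sum>x\<in>items. e2 x h) = (\<Sum>g<G. if h = g then all_d else 0) + (\<Sum>g<G. if h = g + W then all_u else 0)"
    unfolding sum_items sum.distrib[symmetric]
    by (intro sum.cong) (auto simp: e2_def all_d_def all_u_def sum.distrib)
  also have "(\<Sum>g<G. if h = g + W then all_u else 0) = (\<Sum>g<G. if g = h - W then (if h < W then 0 else all_u) else 0)"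
    by (intro sum.cong) auto
  also have "\<dots> = (if h < W then 0 else all_u)" using \<open>h - W < G\<close> by simp
  finally show ?thesis using h by (simp add: s2_def)
qed

lemma s_less: "s1 h < D" "s2 h < D" "n < D"
proof -
  have *: "all_l \<le> n * C" "all_d \<le> n * C" "all_r \<le> n * C" "all_u \<le> n * C"
    using sum_bounded_above[of "{..<n}" "\<lambda>i. C - tl i" C] sum_bounded_above[of "{..<n}" "\<lambda>i. C - td i" C]
      sum_bounded_above[of "{..<n}" tr C] sum_bounded_above[of "{..<n}" tu C] colours
    by (simp_all add: all_l_def all_d_def all_r_def all_u_def)
  then show "s1 h < D" "s2 h < D" using D by (auto simp: s1_def s2_def)
  have "n \<le> n * C" "n * C \<le> 2 * n * C" using C by simp_all
  then show "n < D" using D by linarith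
qed

text \<open>Each tile contributes at least half of \<open>C\<close> to the digits at its own
  position, so four tiles give \<open>2 * C\<close>. Hence the differences in \<open>cobound\<close>
  and \<open>cofill\<close> are not truncated.\<close>

lemma t_le_s: "2 * t1 h \<le> s1 h" "2 * t2 h \<le> s2 h"
proof -
  have "(\<Sum>i<n. C) \<le> (\<Sum>i<n. 2 * (C - tl i))" "(\<Sum>i<n. C) \<le> (\<Sum>i<n. 2 * (C - td i))"
    by (rule sum_mono, use colours(1,2) in force)+
  then have "n * C \<le> 2 * all_l" "n * C \<le> 2 * all_d"
    by (simp_all add: all_l_def all_d_def sum_distrib_left)
  moreover have "4 * C \<le> n * C" using n by (rule mult_le_mono1)
  ultimately have "2 * C \<le> all_l" "2 * C \<le> all_d" by linarith+
  then show "2 * t1 h \<le> s1 h" "2 * t2 h \<le> s2 h" by (auto simp: t1_def t2_def s1_def s2_def)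
qed

lemma cobound_less: "cobound h < D ^ 3" and cofill_less: "cofill h < D ^ 3"
  unfolding cobound_def cofill_def
  using s_less by (auto intro!: three_digits_less intro: le_less_trans[OF diff_le_self])

lemma block_less:
  assumes "x \<in> items" "h < G"
  shows "block x h < D ^ 3"
proof -
  have "e0 x h \<le> n" "e1 x h \<le> s1 h" "e2 x h \<le> s2 h"
    using member_le_sum[OF assms(1), of "\<lambda>x. e0 x h"] member_le_sum[OF assms(1), of "\<lambda>x. e1 x h"]
      member_le_sum[OF assms(1), of "\<lambda>x. e2 x h"] sum_items_e0 sum_items_e1 sum_items_e2 assms(2)
    by simp_all
  then have "e0 x h < D" "e1 x h < D" "e2 x h < D"
    using s_less(1,2)[of h] s_less(3) by simp_all
  then show ?thesis unfolding block_def by (rule three_digits_less)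
qed

lemma bound_less: "bound < (D ^ 3) ^ G" and fill_less: "fill < (D ^ 3) ^ G"
  unfolding bound_def fill_def using cobound_less cofill_less by (auto intro!: base_digits_less)

lemma sum_weight: "sum weight S = (\<Sum>h<G. (sum (\<lambda>x. e0 x h) S + D * sum (\<lambda>x. e1 x h) S + D\<^sup>2 * sum (\<lambda>x. e2 x h) S) * (D ^ 3) ^ h)"
proof -
  have "sum weight S = (\<Sum>h<G. \<Sum>x\<in>S. block x h * (D ^ 3) ^ h)"
    unfolding weight_def by (rule sum.swap)
  also have "\<dots> = (\<Sum>h<G. (\<Sum>x\<in>S. block x h) * (D ^ 3) ^ h)"
    by (simp add: sum_distrib_right)
  finally show ?thesis by (simp add: block_def sum.distrib sum_distrib_left)
qed

definition goal :: nat where "goal = (\<Sum>h<G. (1 + D * t1 h + D\<^sup>2 * t2 h) * (D ^ 3) ^ h)"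

lemma bound_eq: "bound = goal + fill"
proof -
  have "cobound h = (1 + D * t1 h + D\<^sup>2 * t2 h) + cofill h" for h
  proof -
    have "s1 h - t1 h = t1 h + (s1 h - 2 * t1 h)" "s2 h - t2 h = t2 h + (s2 h - 2 * t2 h)" "n - 1 = 1 + (n - 2)"
      using t_le_s[of h] n by simp_all
    then show ?thesis unfolding cobound_def cofill_def by (simp only: algebra_simps)
  qed
  then show ?thesis
    unfolding bound_def goal_def fill_def by (simp add: algebra_simps flip: sum.distrib)
qed

text \<open>This identity lets one budget per bin act as an equation: all weights and
  \<open>fill\<close> together use up the budget \<open>bound\<close> of both bins exactly.\<close>

lemma total_eq: "sum weight items + fill = 2 * bound"
proof -
  have "n + D * s1 h + D\<^sup>2 * s2 h + cofill h = 2 * cobound h" for h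
  proof -
    obtain x where x: "s1 h = 2 * t1 h + x" using t_le_s(1)[of h] le_Suc_ex by blast
    obtain y where y: "s2 h = 2 * t2 h + y" using t_le_s(2)[of h] le_Suc_ex by blast
    obtain z where z: "n = 2 + z" using n le_Suc_ex[of 2 n] by auto
    then have "n - 1 = 1 + z" "n - 2 = z" by simp_all
    then show ?thesis unfolding cobound_def cofill_def x y by (simp add: z algebra_simps)
  qed
  then have "(\<Sum>h<G. (n + D * s1 h + D\<^sup>2 * s2 h) * (D ^ 3) ^ h) + fill = 2 * bound"
    unfolding fill_def bound_def sum_distrib_left sum.distrib[symmetric]
    by (intro sum.cong) (simp_all add: distrib_right[symmetric])
  moreover have "sum weight items = (\<Sum>h<G. (n + D * s1 h + D\<^sup>2 * s2 h) * (D ^ 3) ^ h)"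
    unfolding sum_weight by (intro sum.cong) (simp_all add: sum_items_e0 sum_items_e1 sum_items_e2)
  ultimately show ?thesis by simp
qed

definition helical :: "(nat \<Rightarrow> nat) \<Rightarrow> bool" where
  "helical x \<longleftrightarrow> (\<forall>g<G. x g < n) \<and> tl (x 0) = l0 \<and> (\<forall>g. Suc g < G \<longrightarrow> tr (x g) = tl (x (Suc g))) \<and>
     (\<forall>g<W. td (x g) = sg g) \<and> (\<forall>g. g + W < G \<longrightarrow> tu (x g) = td (x (g + W)))"


lemma graph_sums:
  assumes "h < G"
  defines "S x \<equiv> (\<lambda>g. (g, x g)) ` {..<G}"
  shows "(\<Sum>y\<in>S x. e0 y h) = 1"
    "(\<Sum>y\<in>S x. e1 y h) = (C - tl (x h)) + (if h = 0 then 0 else tr (x (h - 1)))"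
    "(\<Sum>y\<in>S x. e2 y h) = (C - td (x h)) + (if h < W then 0 else tu (x (h - W)))"
proof -
  have S: "sum f (S x) = (\<Sum>g<G. f (g, x g))" for f :: "nat \<times> nat \<Rightarrow> nat"
    unfolding S_def by (subst sum.reindex) (auto simp: inj_on_def)
  show "(\<Sum>y\<in>S x. e0 y h) = 1" using assms(1) by (simp add: S e0_def)
  have "(\<Sum>g<G. if h = Suc g then tr (x g) else 0) = (if h = 0 then 0 else tr (x (h - 1)))"
    using assms(1) by (cases h) auto
  then show "(\<Sum>y\<in>S x. e1 y h) = (C - tl (x h)) + (if h = 0 then 0 else tr (x (h - 1)))"
    using assms(1) by (simp add: S e1_def sum.distrib)
  have "h - W < G" using assms(1) by simp
  have "(\<Sum>g<G. if h = g + W then tu (x g) else 0) = (\<Sum>g<G. if g = h - W then (if h < W then 0 else tu (x g)) else 0)"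
    by (intro sum.cong) auto
  also have "\<dots> = (if h < W then 0 else tu (x (h - W)))" using \<open>h - W < G\<close> by simp
  finally show "(\<Sum>y\<in>S x. e2 y h) = (C - td (x h)) + (if h < W then 0 else tu (x (h - W)))"
    using assms(1) by (simp add: S e2_def sum.distrib)
qed

lemma helical_iff_sums:
  assumes "\<And>g. g < G \<Longrightarrow> x g < n"
  shows "helical x \<longleftrightarrow> (\<forall>h<G. (\<Sum>y\<in>(\<lambda>g. (g, x g)) ` {..<G}. e1 y h) = t1 h \<and>
     (\<Sum>y\<in>(\<lambda>g. (g, x g)) ` {..<G}. e2 y h) = t2 h)" (is "_ \<longleftrightarrow> (\<forall>h<G. ?E1 h \<and> ?E2 h)")
proof -
  have G: "0 < G" using W by simp
  have c: "tl (x g) \<le> C" "td (x g) \<le> C" "tr (x g) \<le> C" "tu (x g) \<le> C" if "g < G" for g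
    using colours[OF assms[OF that]] by auto
  have E1: "?E1 h \<longleftrightarrow> tl (x h) = (if h = 0 then l0 else tr (x (h - 1)))" if "h < G" for h
    using c[OF that] c[of "h - 1"] l0 that graph_sums(2)[OF that, of x] by (auto simp: t1_def)
  have E2: "?E2 h \<longleftrightarrow> td (x h) = (if h < W then sg h else tu (x (h - W)))" if "h < G" for h
    using c[OF that] c[of "h - W"] sg[of h] that graph_sums(3)[OF that, of x] by (auto simp: t2_def)
  have "(\<forall>h<G. ?E1 h) \<longleftrightarrow> tl (x 0) = l0 \<and> (\<forall>g. Suc g < G \<longrightarrow> tr (x g) = tl (x (Suc g)))"
  proof (intro iffI conjI allI impI)
    assume *: "\<forall>h<G. ?E1 h"
    show "tl (x 0) = l0" using * E1[of 0] G by auto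
    show "tr (x g) = tl (x (Suc g))" if "Suc g < G" for g using * E1[OF that] that by auto
  next
    fix h assume *: "tl (x 0) = l0 \<and> (\<forall>g. Suc g < G \<longrightarrow> tr (x g) = tl (x (Suc g)))" and h: "h < G"
    show "?E1 h" unfolding E1[OF h] using * h by (cases h) auto
  qed
  moreover have "(\<forall>h<G. ?E2 h) \<longleftrightarrow> (\<forall>g<W. td (x g) = sg g) \<and> (\<forall>g. g + W < G \<longrightarrow> tu (x g) = td (x (g + W)))"
  proof (intro iffI conjI allI impI)
    assume *: "\<forall>h<G. ?E2 h"
    show "td (x g) = sg g" if "g < W" for g using * E2[of g] that W by auto
    show "tu (x g) = td (x (g + W))" if "g + W < G" for g using * E2[OF that] that by auto
  next
    fix h assume *: "(\<forall>g<W. td (x g) = sg g) \<and> (\<forall>g. g + W < G \<longrightarrow> tu (x g) = td (x (g + W)))" and h: "h < G"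
    then have "\<not> h < W \<Longrightarrow> tu (x (h - W)) = td (x (h - W + W))" by auto
    then show "?E2 h" unfolding E2[OF h] using * h by auto
  qed
  ultimately show ?thesis unfolding helical_def using assms by blast
qed

text \<open>No digit sum over a subset reaches its base, so equality with the target holds digit by
  digit. The counting digits then give exactly one tile per position, so the subset is the graph of
  a tiling.\<close>

lemma helical_iff_subset:
  "(\<exists>x. helical x) \<longleftrightarrow> (\<exists>S \<subseteq> items. card S = G \<and> sum weight S + fill = bound)"
proof
  assume "\<exists>x. helical x"
  then obtain x where x: "helical x" by blast
  let ?S = "(\<lambda>g. (g, x g)) ` {..<G}"
  have lt: "\<And>g. g < G \<Longrightarrow> x g < n" using x by (simp add: helical_def)
  then have "?S \<subseteq> items" by auto
  moreover have "card ?S = G" by (subst card_image) (auto simp: inj_on_def)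
  moreover have "sum weight ?S = goal"
    unfolding sum_weight goal_def
    using helical_iff_sums[OF lt] x graph_sums(1) by (intro sum.cong) auto
  ultimately show "\<exists>S \<subseteq> items. card S = G \<and> sum weight S + fill = bound"
    using bound_eq by auto
next
  assume "\<exists>S \<subseteq> items. card S = G \<and> sum weight S + fill = bound"
  then obtain S where S: "S \<subseteq> items" "sum weight S + fill = bound" by blast
  have finS: "finite S" using S(1) finite_subset by blast
  have sub: "sum (\<lambda>x. f x h) S \<le> sum (\<lambda>x. f x h) items" for f :: "nat \<times> nat \<Rightarrow> nat \<Rightarrow> nat" and h
    using S(1) by (intro sum_mono2) auto
  have less: "sum (\<lambda>x. e0 x h) S < D" "sum (\<lambda>x. e1 x h) S < D" "sum (\<lambda>x. e2 x h) S < D" if "h < G" for h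
    using sub[of e0 h] sub[of e1 h] sub[of e2 h] sum_items_e0[OF that] sum_items_e1[OF that]
      sum_items_e2[OF that] s_less(1,2)[of h] s_less(3) by simp_all
  have tless: "1 < D" "t1 h < D" "t2 h < D" for h
    using s_less(3) n s_less(1,2)[of h] t_le_s[of h] by auto
  have "1 + D * t1 h + D\<^sup>2 * t2 h < D ^ 3" for h
    by (rule three_digits_less) (rule tless)+
  moreover have "sum (\<lambda>x. e0 x h) S + D * sum (\<lambda>x. e1 x h) S + D\<^sup>2 * sum (\<lambda>x. e2 x h) S < D ^ 3"
    if "h < G" for h
    by (rule three_digits_less) (rule less[OF that])+
  moreover have goal: "sum weight S = goal" using S(2) bound_eq by simp
  ultimately have eq: "sum (\<lambda>x. e0 x h) S + D * sum (\<lambda>x. e1 x h) S + D\<^sup>2 * sum (\<lambda>x. e2 x h) S = 1 + D * t1 h + D\<^sup>2 * t2 h"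
    if "h < G" for h
    by (intro base_digits_unique[where Q = "D ^ 3" and G = G and h = h and
          c = "\<lambda>h. sum (\<lambda>x. e0 x h) S + D * sum (\<lambda>x. e1 x h) S + D\<^sup>2 * sum (\<lambda>x. e2 x h) S" and
          c' = "\<lambda>h. 1 + D * t1 h + D\<^sup>2 * t2 h"])
      (use that in \<open>simp_all only: sum_weight goal_def\<close>)
  have digits: "sum (\<lambda>x. e0 x h) S = 1" "sum (\<lambda>x. e1 x h) S = t1 h" "sum (\<lambda>x. e2 x h) S = t2 h" if "h < G" for h
    using three_digits_unique[OF _ _ _ _ eq[OF that]] less[OF that] tless by auto
  have "\<exists>i. S \<inter> ({h} \<times> UNIV) = {(h, i)}" if "h < G" for h
  proof -
    have "(\<Sum>x\<in>S. e0 x h) = (\<Sum>x\<in>S. if x \<in> {h} \<times> UNIV then 1 else 0)"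
      by (intro sum.cong) (auto simp: e0_def split: if_splits)
    also have "\<dots> = card (S \<inter> ({h} \<times> UNIV))"
      using finS by (simp add: sum.inter_restrict[symmetric])
    finally have "card (S \<inter> ({h} \<times> UNIV)) = 1" using digits(1)[OF that] by simp
    then obtain p where "S \<inter> ({h} \<times> UNIV) = {p}" by (meson card_1_singletonE)
    then show ?thesis by (cases p) auto
  qed
  then obtain x where x: "\<And>h. h < G \<Longrightarrow> S \<inter> ({h} \<times> UNIV) = {(h, x h)}" by metis
  have S_eq: "S = (\<lambda>g. (g, x g)) ` {..<G}"
  proof (intro set_eqI iffI)
    fix p assume p: "p \<in> S"
    then have "fst p < G" using S(1) by auto
    moreover have "p \<in> S \<inter> ({fst p} \<times> UNIV)" using p by (cases p) auto
    ultimately show "p \<in> (\<lambda>g. (g, x g)) ` {..<G}" using x[of "fst p"] by auto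
  next
    fix p assume "p \<in> (\<lambda>g. (g, x g)) ` {..<G}"
    then show "p \<in> S" using x by blast
  qed
  have "x g < n" if "g < G" for g using S(1) S_eq that by auto
  then have "helical x" using helical_iff_sums digits S_eq by auto
  then show "\<exists>x. helical x" by blast
qed

end

section \<open>Instances with two bins\<close>

text \<open>Moving the time from \<open>P\<close> to \<open>\<mu>\<close> saves at most the distance
  of the two for each element of \<open>F\<close>, and costs exactly that distance for each element
  of \<open>I\<close>. With at least as many of the latter there is no gain.\<close>

lemma sum_abs_ge_anchored:
  fixes \<mu> P :: real
  assumes "finite S" "I \<inter> F = {}" "card (F \<inter> S) \<le> card (I \<inter> S)" "\<And>i. i \<in> I \<Longrightarrow> d i = P"
  shows "(\<Sum>i\<in>F \<inter> S. \<bar>d i - P\<bar>) \<le> (\<Sum>i\<in>S. \<bar>d i - \<mu>\<bar>)"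
proof -
  have "(\<Sum>i\<in>F \<inter> S. \<bar>d i - P\<bar>) \<le> (\<Sum>i\<in>F \<inter> S. \<bar>d i - \<mu>\<bar> + \<bar>P - \<mu>\<bar>)"
    by (rule sum_mono) linarith
  also have "\<dots> = (\<Sum>i\<in>F \<inter> S. \<bar>d i - \<mu>\<bar>) + real (card (F \<inter> S)) * \<bar>P - \<mu>\<bar>"
    by (simp add: sum.distrib)
  also have "\<dots> \<le> (\<Sum>i\<in>F \<inter> S. \<bar>d i - \<mu>\<bar>) + real (card (I \<inter> S)) * \<bar>P - \<mu>\<bar>"
    using assms(3) by (intro add_left_mono mult_right_mono) auto
  also have "\<dots> = (\<Sum>i\<in>F \<inter> S. \<bar>d i - \<mu>\<bar>) + (\<Sum>i\<in>I \<inter> S. \<bar>d i - \<mu>\<bar>)"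
    using assms(4) by simp
  also have "\<dots> = (\<Sum>i\<in>(F \<inter> S) \<union> (I \<inter> S). \<bar>d i - \<mu>\<bar>)"
    using assms(1,2) by (subst sum.union_disjoint) auto
  also have "\<dots> \<le> (\<Sum>i\<in>S. \<bar>d i - \<mu>\<bar>)"
    using assms(1) by (intro sum_mono2) auto
  finally show ?thesis .
qed

text \<open>\<open>J\<close> holds the items to choose from and \<open>f\<close> is the filler, so
  there are \<open>(q + 1) * G + 1\<close> items outside the clusters. A cluster twice as large puts
  at least that many of its own items into one of the two bins. \<open>3 \<le> q\<close> makes the
  distance \<open>(q - 1) * Y - c\<close> of the filler from \<open>q * Y\<close> larger than
  \<open>b\<close>.\<close>

locale two_bins =
  fixes ds :: "nat list" and q G Y b c :: nat and I0 I1 J :: "nat set" and f :: nat and a :: "nat \<Rightarrow> nat"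
  assumes items: "{1..length ds} = I0 \<union> I1 \<union> J \<union> {f}"
    and disj: "I0 \<inter> I1 = {}" "I0 \<inter> J = {}" "I1 \<inter> J = {}" "f \<notin> I0" "f \<notin> I1" "f \<notin> J"
    and due: "\<And>i. i \<in> I0 \<Longrightarrow> due_time ds i = Y" "\<And>i. i \<in> I1 \<Longrightarrow> due_time ds i = q * Y"
      "\<And>i. i \<in> J \<Longrightarrow> due_time ds i = (q + 1) * Y + a i" "due_time ds f = Y + c"
    and q: "3 \<le> q" and G: "1 \<le> G"
    and card_J: "card J = (q + 1) * G"
    and card_I: "2 * ((q + 1) * G + 1) \<le> card I0" "2 * ((q + 1) * G + 1) \<le> card I1"
    and sum_a: "2 * b = sum a J + c" and b: "b < Y" and c: "c < Y"
begin

text \<open>The same bound fits both bins: \<open>G\<close> items at a distance of about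
  \<open>q * Y\<close>, or \<open>q * G\<close> items at a distance of about
  \<open>Y\<close>.\<close>

definition B :: nat where "B = q * G * Y + b"

lemma fin: "finite I0" "finite I1" "finite J"
  using items finite_atLeastAtMost[of 1 "length ds"] by auto

lemma feasible_if_subset:
  assumes S: "S \<subseteq> J" "card S = G" "sum a S + c = b"
  shows "\<exists>bins. cds_feasible (ds, of_nat B) bins \<and> length bins \<le> 2"
proof -
  let ?S0 = "insert f (I0 \<union> S)" and ?S1 = "I1 \<union> (J - S)"
  let ?bins = "[(?S0, real Y), (?S1, real (q * Y))]"
  have finS: "finite S" "finite (J - S)" using S fin finite_subset by auto
  have "I0 \<noteq> {}" "I1 \<noteq> {}" using card_I by auto
  then have ne: "?S1 \<noteq> {}" "?S0 \<noteq> ?S1" using disj S by auto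
  have "partition_on {1..length ds} (set (map fst ?bins))"
    using ne(1) disj S unfolding items by (auto simp: partition_on_def disjoint_def)
  moreover have "(\<Sum>i\<in>?S0. delta ds i Y) = real B"
  proof -
    have "(\<Sum>i\<in>?S0. delta ds i Y) = delta ds f Y + ((\<Sum>i\<in>I0. delta ds i Y) + (\<Sum>i\<in>S. delta ds i Y))"
      using disj S finS fin by (subst sum.insert; (subst sum.union_disjoint)?) auto
    also have "(\<Sum>i\<in>I0. delta ds i Y) = 0" by (simp add: delta_def due)
    also have "(\<Sum>i\<in>S. delta ds i Y) = (\<Sum>i\<in>S. real (q * Y + a i))"
      using S(1) by (intro sum.cong) (auto simp: delta_def due subset_iff algebra_simps)
    also have "\<dots> = real (G * (q * Y) + sum a S)"
      using S(2) by (simp add: sum.distrib)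
    also have "delta ds f Y = real c" by (simp add: delta_def due)
    also have "real c + (0 + real (G * (q * Y) + sum a S)) = real B"
      using S(3) by (simp add: B_def flip: of_nat_add)
    finally show ?thesis .
  qed
  moreover have "(\<Sum>i\<in>?S1. delta ds i (q * Y)) = real B"
  proof -
    have "card (J - S) = q * G" using S fin by (simp add: card_Diff_subset finS card_J)
    have "sum a (J - S) + sum a S = sum a J"
      using S(1) fin by (metis sum.subset_diff)
    then have sb: "sum a (J - S) = b" using S(3) sum_a by linarith
    have "(\<Sum>i\<in>?S1. delta ds i (q * Y)) = (\<Sum>i\<in>I1. delta ds i (q * Y)) + (\<Sum>i\<in>J - S. delta ds i (q * Y))"
      using disj finS fin by (subst sum.union_disjoint) auto
    also have "(\<Sum>i\<in>I1. delta ds i (q * Y)) = 0" by (simp add: delta_def due)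
    also have "(\<Sum>i\<in>J - S. delta ds i (q * Y)) = (\<Sum>i\<in>J - S. real (Y + a i))"
      by (intro sum.cong) (auto simp: delta_def due algebra_simps)
    also have "\<dots> = real (q * G * Y + sum a (J - S))"
      using \<open>card (J - S) = q * G\<close> by (simp add: sum.distrib)
    finally show ?thesis using sb by (simp add: B_def)
  qed
  ultimately have "cds_feasible (ds, of_nat B) ?bins"
    using ne(2) by simp
  then show ?thesis by (intro exI[of _ ?bins]) simp
qed

text \<open>Each cluster pins one bin, so the cost is at least the cost of the other items at the
  fixed time \<open>Y\<close> or \<open>q * Y\<close>. The multiples of \<open>Y\<close> allow at
  most \<open>G\<close> items of \<open>J\<close> in the first bin and at most \<open>q * G\<close>
  in the second, hence exactly these numbers, and the budgets for the small parts remain.\<close>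

lemma subset_if_feasible:
  assumes bins: "cds_feasible (ds, of_nat B) bins" "length bins \<le> 2"
  shows "\<exists>S \<subseteq> J. card S = G \<and> sum a S + c = b"
proof -
  let ?N = "(q + 1) * G + 1" and ?F = "insert f J"
  have part: "distinct (map fst bins)" "partition_on {1..length ds} (set (map fst bins))"
    and cost: "\<And>S \<mu>. (S, \<mu>) \<in> set bins \<Longrightarrow> (\<Sum>i\<in>S. delta ds i \<mu>) \<le> real B"
    using bins(1) by auto
  have cover: "\<Union> (fst ` set bins) = I0 \<union> I1 \<union> J \<union> {f}"
    using part(2) items by (auto simp: partition_on_def)
  have finS: "finite S" if "(S, \<mu>) \<in> set bins" for S \<mu>
    using cover that fin by (intro finite_subset[of S "I0 \<union> I1 \<union> J \<union> {f}"]) force+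
  \<comment> \<open>Pigeonhole over at most two bins, with \<open>?N\<close> the number of items
    outside the clusters.\<close>
  have half: "\<exists>(S, \<mu>) \<in> set bins. ?N \<le> card (I \<inter> S)"
    if "I \<subseteq> \<Union> (fst ` set bins)" "2 * ?N \<le> card I" "finite I" for I
  proof (rule ccontr)
    assume *: "\<not> ?thesis"
    have "card I = card (\<Union>x\<in>set bins. I \<inter> fst x)"
      using that(1) by (intro arg_cong[where f = card]) auto
    also have "\<dots> \<le> (\<Sum>x\<in>set bins. card (I \<inter> fst x))"
      by (rule card_UN_le) simp
    also have "\<dots> \<le> (\<Sum>x\<in>set bins. ?N - 1)"
      using * by (intro sum_mono) force
    also have "\<dots> \<le> 2 * (?N - 1)"
      using bins(2) card_length[of bins] by (simp del: add_Suc_right)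
    finally show False using that(2) by simp
  qed
  obtain S0 m0 where S0: "(S0, m0) \<in> set bins" "?N \<le> card (I0 \<inter> S0)"
    using half[of I0] cover card_I fin by auto
  obtain S1 m1 where S1: "(S1, m1) \<in> set bins" "?N \<le> card (I1 \<inter> S1)"
    using half[of I1] cover card_I fin by auto
  \<comment> \<open>By the triangle inequality \<open>?N\<close> items of each cluster in one bin
    cost at least \<open>?N * (q - 1) * Y\<close>, which is more than \<open>B\<close>.\<close>
  have "S0 \<noteq> S1"
  proof
    assume eq: "S0 = S1"
    then have "m0 = m1" using S0(1) S1(1) part(1) by (metis eq_key_imp_eq_value)
    have fS: "finite S0" using finS S0 by blast
    have "real ?N * (real q * Y - Y) \<le> real ?N * \<bar>real Y - m0\<bar> + real ?N * \<bar>real (q * Y) - m0\<bar>"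
      unfolding distrib_left[symmetric] by (intro mult_left_mono) auto
    also have "\<dots> \<le> real (card (I0 \<inter> S0)) * \<bar>real Y - m0\<bar> + real (card (I1 \<inter> S0)) * \<bar>real (q * Y) - m0\<bar>"
      using S0(2) S1(2) eq by (intro add_mono mult_right_mono) (auto simp del: of_nat_add of_nat_mult)
    also have "\<dots> = (\<Sum>i\<in>I0 \<inter> S0. delta ds i m0) + (\<Sum>i\<in>I1 \<inter> S0. delta ds i m0)"
      by (simp add: delta_def due)
    also have "\<dots> = (\<Sum>i\<in>(I0 \<inter> S0) \<union> (I1 \<inter> S0). delta ds i m0)"
      using fS disj by (subst sum.union_disjoint) auto
    also have "\<dots> \<le> (\<Sum>i\<in>S0. delta ds i m0)"
      using fS by (intro sum_mono2) (auto simp: delta_def)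
    also have "\<dots> \<le> real B" using cost S0(1) by blast
    finally have "real (?N * (q * Y)) \<le> real (B + ?N * Y)"
      by (simp add: algebra_simps)
    then have "?N * (q * Y) \<le> B + ?N * Y" by (simp only: of_nat_le_iff)
    moreover have "?N * (q * Y) = ?N * Y * (q - 1) + ?N * Y"
      using q by (cases q) (auto simp: algebra_simps)
    moreover have "?N * Y * 2 \<le> ?N * Y * (q - 1)" using q by (intro mult_le_mono2) auto
    moreover have "B < ?N * Y" using b by (simp add: B_def algebra_simps)
    ultimately show False by linarith
  qed
  then have "card (set bins) \<ge> 2" "{(S0, m0), (S1, m1)} \<subseteq> set bins" 
    using S0(1) S1(1) card_mono[of "set bins" "{(S0, m0), (S1, m1)}"] by auto
  moreover have "card (set bins) \<le> 2" using bins(2) card_length[of bins] by linarith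
  ultimately have set_bins: "set bins = {(S0, m0), (S1, m1)}"
    using \<open>S0 \<noteq> S1\<close> by (intro card_subset_eq[symmetric]) auto
  then have un: "S0 \<union> S1 = I0 \<union> I1 \<union> J \<union> {f}" using cover by auto
  have dj: "S0 \<inter> S1 = {}"
    using part(2) set_bins \<open>S0 \<noteq> S1\<close> by (auto simp: partition_on_def disjoint_def)
  have fS: "finite S0" "finite S1" using finS S0 S1 by blast+
  have cF: "card (?F \<inter> S) \<le> ?N" for S
  proof -
    have "card (?F \<inter> S) \<le> card ?F" using fin by (intro card_mono) auto
    then show ?thesis using fin disj card_J by simp
  qed
  have c0: "(\<Sum>i\<in>?F \<inter> S0. \<bar>real (due_time ds i) - Y\<bar>) \<le> B"
    using sum_abs_ge_anchored[of S0 I0 ?F "\<lambda>i. real (due_time ds i)" "real Y" m0]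
      order.trans[OF cF S0(2)] cost[OF S0(1)] disj fS due(1) by (auto simp: delta_def)
  have c1: "(\<Sum>i\<in>?F \<inter> S1. \<bar>real (due_time ds i) - q * Y\<bar>) \<le> B"
    using sum_abs_ge_anchored[of S1 I1 ?F "\<lambda>i. real (due_time ds i)" "real (q * Y)" m1]
      order.trans[OF cF S1(2)] cost[OF S1(1)] disj fS due(2) by (auto simp: delta_def)
  define n0 where "n0 = card (J \<inter> S0)"
  define n1 where "n1 = card (J \<inter> S1)"
  have J_eq: "J = (J \<inter> S0) \<union> (J \<inter> S1)" using un by auto
  have n: "n0 + n1 = (q + 1) * G"
    unfolding n0_def n1_def card_J[symmetric]
    using dj fin by (subst J_eq, subst card_Un_disjoint) auto
  have sa: "sum a J = sum a (J \<inter> S0) + sum a (J \<inter> S1)"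
    using dj fin by (subst J_eq, subst sum.union_disjoint) auto
  have j0: "(\<Sum>i\<in>J \<inter> S0. \<bar>real (due_time ds i) - Y\<bar>) = real (n0 * (q * Y) + sum a (J \<inter> S0))"
  proof -
    have "(\<Sum>i\<in>J \<inter> S0. \<bar>real (due_time ds i) - Y\<bar>) = (\<Sum>i\<in>J \<inter> S0. real (q * Y + a i))"
      by (intro sum.cong) (auto simp: due algebra_simps)
    then show ?thesis by (simp add: sum.distrib n0_def)
  qed
  have j1: "(\<Sum>i\<in>J \<inter> S1. \<bar>real (due_time ds i) - q * Y\<bar>) = real (n1 * Y + sum a (J \<inter> S1))"
  proof -
    have "(\<Sum>i\<in>J \<inter> S1. \<bar>real (due_time ds i) - q * Y\<bar>) = (\<Sum>i\<in>J \<inter> S1. real (Y + a i))"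
      by (intro sum.cong) (auto simp: due algebra_simps)
    then show ?thesis by (simp add: sum.distrib n1_def)
  qed
  have le0: "n0 * (q * Y) + sum a (J \<inter> S0) + (if f \<in> S0 then c else 0) \<le> B"
  proof (cases "f \<in> S0")
    case True
    then have "?F \<inter> S0 = insert f (J \<inter> S0)" by auto
    then show ?thesis using True c0 j0 fin disj
      by (simp add: due flip: of_nat_add of_nat_mult)
  next
    case False
    then have "?F \<inter> S0 = J \<inter> S0" by auto
    then show ?thesis using False c0 j0 by (simp flip: of_nat_add of_nat_mult)
  qed
  have le1: "n1 * Y + sum a (J \<inter> S1) + (if f \<in> S1 then (q - 1) * Y - c else 0) \<le> B"
  proof (cases "f \<in> S1")
    case True
    have "3 * Y \<le> q * Y" using q by (rule mult_le_mono1)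
    then have qY: "Y + c \<le> q * Y" using c by linarith
    have "(q - 1) * Y = q * Y - Y" by (simp add: diff_mult_distrib)
    note qY = qY this
    then have "\<bar>real (Y + c) - q * Y\<bar> = real ((q - 1) * Y - c)"
      by (simp add: of_nat_diff flip: of_nat_mult)
    moreover from True have "?F \<inter> S1 = insert f (J \<inter> S1)" by auto
    ultimately show ?thesis using True c1 j1 fin disj
      by (simp add: due flip: of_nat_add of_nat_mult)
  next
    case False
    then have "?F \<inter> S1 = J \<inter> S1" by auto
    then show ?thesis using False c1 j1 by (simp flip: of_nat_add of_nat_mult)
  qed
  have "n0 \<le> G"
  proof (rule ccontr)
    assume "\<not> n0 \<le> G"
    then have "(G + 1) * (q * Y) \<le> n0 * (q * Y)" by (intro mult_le_mono1) simp
    moreover have "(G + 1) * (q * Y) = q * G * Y + q * Y" by (simp add: algebra_simps)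
    moreover have "Y \<le> q * Y" using q by simp
    ultimately show False using le0 b unfolding B_def by linarith
  qed
  \<comment> \<open>In the second bin the filler would add more than \<open>Y\<close> to a load of
    at least \<open>q * G * Y\<close>.\<close>
  have "f \<in> S0"
  proof (rule ccontr)
    assume "f \<notin> S0"
    then have "f \<in> S1" using un by auto
    have "q * G \<le> n1" using n \<open>n0 \<le> G\<close> by simp
    then have "q * G * Y \<le> n1 * Y" by (rule mult_le_mono1)
    moreover have "2 * Y \<le> (q - 1) * Y" by (rule mult_le_mono1) (use q in simp)
    moreover have "n1 * Y + (q - 1) * Y - c \<le> q * G * Y + b"
      using le1 \<open>f \<in> S1\<close> unfolding B_def by simp
    ultimately show False using b c by linarith
  qed
  have "n1 \<le> q * G"
  proof (rule ccontr)
    assume "\<not> n1 \<le> q * G"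
    then have "(q * G + 1) * Y \<le> n1 * Y" by (intro mult_le_mono1) simp
    then show False using le1 b by (simp add: B_def algebra_simps split: if_splits)
  qed
  then have nn: "n0 = G" "n1 = q * G" using n \<open>n0 \<le> G\<close> by auto
  have "sum a (J \<inter> S0) + c \<le> b" using le0 \<open>f \<in> S0\<close> by (simp add: B_def nn algebra_simps)
  moreover have "sum a (J \<inter> S1) \<le> b" using le1 by (simp add: B_def nn split: if_splits)
  \<comment> \<open>Both budgets are at most \<open>b\<close>, and by \<open>sum_a\<close> their sum
    is \<open>2 * b\<close>, so neither has slack.\<close>
  ultimately have "sum a (J \<inter> S0) + c = b" using sa sum_a by linarith
  then show ?thesis using nn(1) by (intro exI[of _ "J \<inter> S0"]) (auto simp: n0_def)
qed

lemma feasible_iff_subset: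
  "(\<exists>bins. cds_feasible (ds, of_nat B) bins \<and> length bins \<le> 2) \<longleftrightarrow>
     (\<exists>S \<subseteq> J. card S = G \<and> sum a S + c = b)"
  using feasible_if_subset subset_if_feasible by blast

end

section \<open>Polynomial bounds, unique decoding and reindexing\<close>

instance direction :: countable
  by countable_datatype

text \<open>The exponent has the form \<open>2 ^ j\<close> because padding squares the length;
  \<open>l\<close> is the number of blanks appended before the padding.\<close>

lemma poly_le_power:
  "\<exists>l j. \<forall>n. poly p n \<le> (n + l) ^ 2 ^ j" for p :: "nat poly"
proof (induction p)
  case 0
  then show ?case by (intro exI[of _ 0]) simp
next
  case (pCons a p)
  then obtain l j where IH: "\<And>n. poly p n \<le> (n + l) ^ 2 ^ j" by blast
  have "poly (pCons a p) n \<le> (n + (l + a + 1)) ^ 2 ^ Suc j" for n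
  proof -
    let ?X = "n + (l + a + 1)"
    have 1: "(n + l) ^ 2 ^ j \<le> ?X ^ 2 ^ j" by (intro power_mono) auto
    have 2: "?X \<le> ?X ^ 2 ^ j" by (rule self_le_power) auto
    then have "1 \<le> ?X ^ 2 ^ j" by simp
    then have "a \<le> a * ?X ^ 2 ^ j" by simp
    moreover have "n * poly p n \<le> n * ?X ^ 2 ^ j"
      using IH[of n] 1 by (intro mult_le_mono2) linarith
    ultimately have "a + n * poly p n \<le> a * ?X ^ 2 ^ j + n * ?X ^ 2 ^ j" by (rule add_mono)
    then have "poly (pCons a p) n \<le> (a + n) * ?X ^ 2 ^ j" by (simp only: poly_pCons distrib_right)
    also have "\<dots> \<le> ?X ^ 2 ^ j * ?X ^ 2 ^ j" using 2 by (intro mult_le_mono1) linarith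
    also have "\<dots> = ?X ^ 2 ^ Suc j" by (simp add: power_add[symmetric] mult_2)
    finally show ?thesis .
  qed
  then show ?case by blast
qed

text \<open>Membership speaks of some instance with the given code; since codes are injective, it is
  the intended one.\<close>

lemma decision_iff_feasible:
  assumes "x \<in> instances container_delivery"
  shows "encode_nat K @ cds_encode x \<in> decision_problem container_delivery \<longleftrightarrow>
    (\<exists>bins. cds_feasible x bins \<and> length bins \<le> K)"
proof
  assume "encode_nat K @ cds_encode x \<in> decision_problem container_delivery"
  then obtain K' y where y: "encode_nat K @ cds_encode x = encode_nat K' @ cds_encode y"
    "y \<in> instances container_delivery" "\<exists>s. cds_feasible y s \<and> length s \<le> K'"
    unfolding decision_problem_def
    by (auto simp: container_delivery_def simp del: cds_encode.simps cds_feasible.simps)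
  then have "K = K'" "cds_encode x = cds_encode y" by (simp_all add: encode_nat_append_inject)
  then have "x = y" using inj_onD[OF inj_on_cds_encode] assms y(2) by blast
  then show "\<exists>bins. cds_feasible x bins \<and> length bins \<le> K" using y \<open>K = K'\<close> by simp
next
  assume "\<exists>bins. cds_feasible x bins \<and> length bins \<le> K"
  then show "encode_nat K @ cds_encode x \<in> decision_problem container_delivery"
    using assms unfolding decision_problem_def
    by (auto simp: container_delivery_def simp del: cds_encode.simps cds_feasible.simps)
qed

lemma bij_betw_div_mod:
  assumes "X \<subseteq> {..<R :: nat}"
  shows "bij_betw (\<lambda>s. (s div R, s mod R)) {s. s < R * G \<and> s mod R \<in> X} ({..<G} \<times> X)"
proof (rule bij_betw_byWitness[where f' = "\<lambda>(g, i). R * g + i"])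
  have lt: "R * g + i < R * G" if "g < G" "i < R" for g i
  proof -
    have "R * g + i < R * (g + 1)" using that by simp
    also have "\<dots> \<le> R * G" using that by (intro mult_le_mono2) simp
    finally show ?thesis .
  qed
  then show "(\<lambda>(g, i). R * g + i) ` ({..<G} \<times> X) \<subseteq> {s. s < R * G \<and> s mod R \<in> X}"
    using assms by (auto simp: subset_iff)
  show "(\<lambda>s. (s div R, s mod R)) ` {s. s < R * G \<and> s mod R \<in> X} \<subseteq> {..<G} \<times> X"
    by (auto simp: less_mult_imp_div_less mult.commute)
  show "\<forall>a\<in>{s. s < R * G \<and> s mod R \<in> X}. (case (a div R, a mod R) of (g, i) \<Rightarrow> R * g + i) = a"
    by simp
  show "\<forall>a\<in>{..<G} \<times> X.
      ((case a of (g, i) \<Rightarrow> R * g + i) div R, (case a of (g, i) \<Rightarrow> R * g + i) mod R) = a"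
    using assms by (auto simp: subset_iff)
qed


lemma ex_subset_bij:
  assumes "bij_betw h J I"
  shows "(\<exists>S \<subseteq> J. card S = m \<and> sum (\<lambda>s. f (h s)) S + c = b) \<longleftrightarrow> (\<exists>S \<subseteq> I. card S = m \<and> sum f S + c = (b :: nat))"
proof
  assume "\<exists>S \<subseteq> J. card S = m \<and> sum (\<lambda>s. f (h s)) S + c = b"
  then obtain S where S: "S \<subseteq> J" "card S = m" "sum (\<lambda>s. f (h s)) S + c = b" by blast
  have inj: "inj_on h S" using assms S(1) by (meson bij_betw_def inj_on_subset)
  have "h ` S \<subseteq> I" using assms S(1) by (auto simp: bij_betw_def)
  then show "\<exists>S \<subseteq> I. card S = m \<and> sum f S + c = b"
    using S by (intro exI[of _ "h ` S"]) (simp add: card_image[OF inj] sum.reindex[OF inj] o_def)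
next
  assume "\<exists>S \<subseteq> I. card S = m \<and> sum f S + c = b"
  then obtain S where S: "S \<subseteq> I" "card S = m" "sum f S + c = b" by blast
  define S' where "S' = {s \<in> J. h s \<in> S}"
  have inj: "inj_on h S'" using assms by (auto simp: bij_betw_def S'_def inj_on_def)
  have "h ` S' = S" using assms S(1) by (auto simp: bij_betw_def S'_def)
  then have "card S' = card S" "sum (\<lambda>s. f (h s)) S' = sum f S"
    using card_image[OF inj] sum.reindex[OF inj, of f] by (simp_all add: o_def)
  then show "\<exists>S \<subseteq> J. card S = m \<and> sum (\<lambda>s. f (h s)) S + c = b"
    using S by (intro exI[of _ S']) (auto simp: S'_def)
qed

section \<open>The reduction\<close>

locale reduction =
  fixes M :: machine and tls :: "(hcolour, vcolour) tile list" and P :: "nat poly" and c0 l j :: nat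
  assumes M: "turing_machine M"
    and bound_P: "\<And>w r c. (step M ^^ r) (init M w) c \<Longrightarrow> r \<le> poly P (length w)"
    and tls: "set tls = tiles M" "4 \<le> length tls"
    and c0: "\<And>t. t \<in> tiles M \<Longrightarrow> to_nat (lft t) \<le> c0 \<and> to_nat (rgt t) \<le> c0 \<and>
        to_nat (dwn t) \<le> c0 \<and> to_nat (upp t) \<le> c0"
      "to_nat (initial M, stays M) \<le> c0" "to_nat (None :: vcolour) \<le> c0"
      "\<And>f b. f \<le> 2 \<Longrightarrow> to_nat (Some ((f, b) # replicate (tapes M - 1) (0, b)) :: vcolour) \<le> c0"
    and lj: "\<And>n. poly P n + 2 \<le> (n + l) ^ 2 ^ j" "1 \<le> l"
begin

text \<open>
  There are \<open>R\<close> items per cell. The first \<open>K\<close> of them belong to the cluster with due time \<open>Y\<close>, the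
  next \<open>K\<close> to the cluster with due time \<open>q * Y\<close>, and the other \<open>n\<close> to the \<open>n = q + 1\<close> tiles.
  Colours are below \<open>F\<close>; the symbols \<open>F\<close> and \<open>F + 1\<close> are the binary digits of \<open>q * G\<close>.
\<close>

definition n :: nat where "n = length tls"
definition q :: nat where "q = n - 1"
definition C :: nat where "C = 2 * c0 + 1"
definition d :: nat where "d = 2 * n * C"
definition D :: nat where "D = 2 ^ d"
definition K :: nat where "K = 2 * n + 4"
definition R :: nat where "R = n + 2 * K"
definition F :: nat where "F = R + c0 + 2"
definition A :: nat where "A = 3 * (F + 1) + 2"
definition l0 :: nat where "l0 = to_nat (initial M, stays M)"
definition lcol :: "nat \<Rightarrow> nat" where "lcol i = to_nat (lft (tls ! i))"
definition rcol :: "nat \<Rightarrow> nat" where "rcol i = to_nat (rgt (tls ! i))"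
definition dcol :: "nat \<Rightarrow> nat" where "dcol i = to_nat (dwn (tls ! i))"
definition ucol :: "nat \<Rightarrow> nat" where "ucol i = to_nat (upp (tls ! i))"

text \<open>The successor keeps colours positive, so that \<open>R + v\<close> differs from
  \<open>R\<close>, the mark of a cell without prescribed colour; \<open>sg\<close> takes it off
  again.\<close>

definition vcode :: "nat \<Rightarrow> bool \<Rightarrow> nat" where
  "vcode f b = Suc (to_nat (Some ((if f = 3 then 0 else f, b) # replicate (tapes M - 1) (0, b)) :: vcolour))"
definition scode :: nat where "scode = Suc (to_nat (None :: vcolour))"

definition content :: "bool list \<Rightarrow> nat list" where
  "content w = (pad ^^ j) (map letter w @ replicate l 3)"
definition first_row :: "bool list \<Rightarrow> nat list" where
  "first_row w = row_code scode vcode (content w)"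
definition W :: "bool list \<Rightarrow> nat" where "W w = length (first_row w)"
definition G :: "bool list \<Rightarrow> nat" where "G w = W w * W w"
definition lo :: "bool list \<Rightarrow> nat" where "lo w = length (content w) + 1"
definition width :: "bool list \<Rightarrow> nat" where "width w = length (content w) * (length (content w) + 1)"

lemma content_props:
  "\<exists>k. content w = map letter w @ replicate k 3" "poly P (length w) + 2 \<le> length (content w)"
  "f \<in> set (content w) \<Longrightarrow> f \<in> {1, 2, 3}"
proof -
  obtain k where "content w = (map letter w @ replicate l 3) @ replicate k 3"
    using pad_funpow(1) unfolding content_def by blast
  then have k: "content w = map letter w @ replicate (l + k) 3" by (simp add: replicate_add)
  then show "\<exists>k. content w = map letter w @ replicate k 3" by blast
  show "f \<in> set (content w) \<Longrightarrow> f \<in> {1, 2, 3}" unfolding k by (auto simp: letter_def)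
  have "poly P (length w) + 2 \<le> (length w + l) ^ 2 ^ j" by (rule lj)
  also have "\<dots> \<le> length (content w)"
    using pad_funpow(2)[of "map letter w @ replicate l 3" j] by (simp add: content_def)
  finally show "poly P (length w) + 2 \<le> length (content w)" .
qed

lemma W_eq: "W w = Suc (width w)" "2 \<le> length (content w)"
  using content_props(2)[of w] length_row_code[of "content w"] by (simp_all add: W_def first_row_def width_def)

text \<open>The pad symbol 3 is read as a blank, so the padded input between its margins is the
  initial window. The four cases are left margin, head, rest of the content and right
  margin.\<close>

lemma first_row_eq: "first_row w = map (\<lambda>v. Suc (to_nat v)) (row (lo w) (width w) (snd (init M w)))"
proof (rule nth_equalityI)
  show len: "length (first_row w) = length (map (\<lambda>v. Suc (to_nat v)) (row (lo w) (width w) (snd (init M w))))"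
    using W_eq[of w] by (simp add: W_def)
  fix i assume "i < length (first_row w)"
  then have i: "i < Suc (width w)" using len by simp
  let ?c = "content w" and ?m = "length (content w)"
  obtain k where k: "?c = map letter w @ replicate k 3" using content_props(1) by blast
  have cell0: "cell (snd (init M w)) z = (word_tape w z, z = 0) # replicate (tapes M - 1) (0, z = 0)" for z
    by (auto simp: cell_def init_def word_tape_def)
  show "first_row w ! i = map (\<lambda>v. Suc (to_nat v)) (row (lo w) (width w) (snd (init M w))) ! i"
  proof (cases i)
    case 0
    then show ?thesis by (simp add: first_row_def row_code_def scode_def row_def)
  next
    case (Suc h)
    then have h: "h < width w" using i by simp
    have rhs: "map (\<lambda>v. Suc (to_nat v)) (row (lo w) (width w) (snd (init M w))) ! i =
        Suc (to_nat (Some (cell (snd (init M w)) (int h - int (lo w)))))"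
      using Suc h by simp
    obtain f fs where cf: "?c = f # fs" using W_eq(2)[of w] by (cases ?c) auto
    consider "h < lo w" | "h = lo w" | "lo w < h" "h < lo w + ?m" | "lo w + ?m \<le> h" by linarith
    then show ?thesis
    proof cases
      case 1
      then have "first_row w ! i = vcode 3 False"
        unfolding first_row_def row_code_def Suc by (simp add: lo_def nth_append del: replicate_Suc)
      moreover have "word_tape w (int h - int (lo w)) = 0" using 1 by (simp add: word_tape_def)
      ultimately show ?thesis unfolding rhs cell0 using 1 by (simp add: vcode_def)
    next
      case 2
      then have "first_row w ! i = vcode f True"
        unfolding first_row_def row_code_def Suc by (simp add: lo_def nth_append cf)
      moreover have "word_tape w 0 = (if f = 3 then 0 else f)"
        using k cf by (cases w; cases k; cases "hd w") (auto simp: word_tape_def letter_def)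
      ultimately show ?thesis unfolding rhs cell0 using 2 by (simp add: vcode_def)
    next
      case 3
      define g where "g = h - lo w"
      have g: "0 < g" "g < ?m" "h = lo w + g" using 3 by (auto simp: g_def)
      obtain g' where "g = Suc g'" using g(1) by (cases g) auto
      then have "first_row w ! i = vcode (?c ! g) False"
        using g unfolding first_row_def row_code_def Suc by (simp add: lo_def nth_append cf)
      moreover have "word_tape w (int g) = (if ?c ! g = 3 then 0 else ?c ! g)"
        using g k by (auto simp: word_tape_def letter_def nth_append)
      ultimately show ?thesis unfolding rhs cell0 using g by (simp add: vcode_def)
    next
      case 4
      obtain m where m: "?m = 2 + m" using W_eq(2) le_Suc_ex by blast
      define g where "g = h - lo w - ?m"
      have g: "h = lo w + ?m + g" using 4 by (auto simp: g_def)
      have "g < (?m - 2) * (?m + 1) + 1"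
        using h unfolding g width_def lo_def m by (simp add: algebra_simps)
      then have "first_row w ! i = vcode 3 False"
        unfolding first_row_def row_code_def Suc g
        by (simp add: lo_def nth_append cf del: replicate_Suc)
      moreover have "length w \<le> ?m" using k by simp
      then have "word_tape w (int h - int (lo w)) = 0" unfolding g by (simp add: word_tape_def)
      moreover have "int h - int (lo w) \<noteq> 0" unfolding g m by simp
      ultimately show ?thesis unfolding rhs cell0 by (simp add: vcode_def)
    qed
  qed
qed

lemma n_ge: "4 \<le> n" and q_ge: "3 \<le> q" and q_Suc: "q + 1 = n"
  using tls by (simp_all add: n_def q_def)

text \<open>The bound depends on the tiles only, not on the input, so blocks of \<open>3 * d\<close>
  bits have constant length.\<close>

lemma D_gt: "2 * n * C < D"
  unfolding D_def d_def by (rule less_exp)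

lemma D_cube: "2 ^ (3 * d) = D ^ 3"
  by (simp add: D_def power_mult[symmetric] mult.commute)

definition sg :: "bool list \<Rightarrow> nat \<Rightarrow> nat" where "sg w h = first_row w ! h - 1"

lemma vcode_le: "f \<in> {1, 2, 3} \<Longrightarrow> 1 \<le> vcode f b \<and> vcode f b \<le> c0 + 1" and scode_le: "1 \<le> scode \<and> scode \<le> c0 + 1"
  using c0(3) c0(4)[of "if f = 3 then 0 else f" b] by (auto simp: vcode_def scode_def)

lemma first_row_le:
  assumes "v \<in> set (first_row w)"
  shows "1 \<le> v \<and> v \<le> c0 + 1"
proof -
  have "hd (content w) \<in> set (content w)" using W_eq(2)[of w] by (intro hd_in_set) auto
  moreover have "set (list.tl (content w)) \<subseteq> set (content w)" by (cases "content w") auto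
  ultimately have "\<exists>f\<in>{1, 2, 3}. \<exists>b. v = scode \<or> v = vcode f b"
    using assms content_props(3)[of _ w] by (fastforce simp: first_row_def row_code_def)
  then show ?thesis using vcode_le scode_le by blast
qed

lemma tile_numbers_w: "tile_numbers n C D (W w) (G w) l0 lcol rcol dcol ucol (sg w)"
proof
  show "4 \<le> n" by (rule n_ge)
  show "2 \<le> W w" using W_eq[of w] by (simp add: width_def)
  then show "W w \<le> G w" by (simp add: G_def)
  have "tls ! i \<in> tiles M" if "i < n" for i
    using nth_mem[of i tls] that by (simp add: n_def tls(1))
  then show "2 * lcol i \<le> C" "2 * dcol i \<le> C" "rcol i \<le> C" "ucol i \<le> C" if "i < n" for i
    using c0(1)[of "tls ! i"] that by (simp_all add: lcol_def rcol_def dcol_def ucol_def C_def)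
  show "l0 \<le> C" using c0(2) by (simp add: l0_def C_def)
  show "sg w h \<le> C" if "h < W w" for h
    using first_row_le[OF nth_mem[of h "first_row w"]] that by (auto simp: sg_def W_def C_def)
qed (use D_gt in \<open>simp_all add: C_def\<close>)

text \<open>A position enters these sums only through being the first and through lying in the first
  row, which the presence of a prescribed colour signals. That makes them available to a finite
  control.\<close>

definition col_sums :: "bool \<Rightarrow> nat option \<Rightarrow> nat \<times> nat" where
  "col_sums first v = ((\<Sum>i<n. C - lcol i) + (if first then 0 else (\<Sum>i<n. rcol i)),
     (\<Sum>i<n. C - dcol i) + (if v = None then (\<Sum>i<n. ucol i) else 0))"

definition targets :: "bool \<Rightarrow> nat option \<Rightarrow> nat \<times> nat" where
  "targets first v = (C - (if first then l0 else 0), C - (case v of None \<Rightarrow> 0 | Some x \<Rightarrow> x - 1))"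

text \<open>Copy 0 spells the digits of the bound, copy 1 those of the filler, and later copies the
  weight of an item. Types from \<open>2 * K\<close> on are tiles; all other types have no small
  part.\<close>

definition block :: "nat \<Rightarrow> bool \<Rightarrow> nat option \<Rightarrow> nat option \<Rightarrow> nat \<Rightarrow> bool \<Rightarrow> nat" where
  "block c first v ty gap u = (
     if c = 0 then (n - 1) + D * (fst (col_sums first v) - fst (targets first v)) +
       D\<^sup>2 * (snd (col_sums first v) - snd (targets first v))
     else if c = 1 then (n - 2) + D * (fst (col_sums first v) - 2 * fst (targets first v)) +
       D\<^sup>2 * (snd (col_sums first v) - 2 * snd (targets first v))
     else case ty of None \<Rightarrow> 0 | Some p \<Rightarrow> if p < 2 * K then 0 else
       (if gap = 0 then 1 + D * (C - lcol (p - 2 * K)) + D\<^sup>2 * (C - dcol (p - 2 * K)) else 0) +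
       (if gap = 1 then D * rcol (p - 2 * K) else 0) + (if u then D\<^sup>2 * ucol (p - 2 * K) else 0))"

text \<open>The coefficient of \<open>Y\<close> in a due time. A copy whose marker is beyond the
  grid has no type and joins the cluster at \<open>Y\<close>, where more items only strengthen the
  anchor.\<close>

definition leading :: "nat option \<Rightarrow> nat" where
  "leading ty = (case ty of None \<Rightarrow> 1 | Some p \<Rightarrow> if p < K then 1 else if p < 2 * K then q else q + 1)"

text \<open>In copy 0 the bits of \<open>q * G\<close> have already been passed on, so what is
  missing is the terminator of the numerator and the denominator 1 of the integral bound. In copy 1
  the leading part 1 puts the filler just above \<open>Y\<close>.\<close>

definition fin :: "nat \<Rightarrow> nat option \<Rightarrow> nat list" where
  "fin c ty = (if c = 0 then 1 # map letter (encode_nat 1)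
     else if c = 1 then emit (bits 1) @ [1] else emit (bits (leading ty)) @ [1])"

sublocale out: output_rule "3 * d" R F "map letter (encode_nat 2)" fin block
  by standard (use n_ge in \<open>simp_all add: R_def F_def\<close>)

definition cell_codes :: "bool list \<Rightarrow> nat \<Rightarrow> nat" where
  "cell_codes w h = (if h < W w then R + first_row w ! h else R)"

definition count_bits :: "bool list \<Rightarrow> bool list" where "count_bits w = bits (q * G w)"

definition copies :: "bool list \<Rightarrow> nat" where "copies w = R * G w + length (count_bits w)"

definition reduce :: "bool list \<Rightarrow> nat list" where
  "reduce w = concat (map (out.copy_output (W w) (G w) (cell_codes w) (count_bits w)) [0..<copies w])"

subsection \<open>The reduction is computable in polynomial time\<close>

lemma A_props: "A mod 3 = 2" "10 \<le> A" "9 \<le> A"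
proof -
  show "A mod 3 = 2" unfolding A_def by presburger
qed (simp_all add: A_def F_def)

lemma set_letters: "set (map letter bs) \<subseteq> {1, 2}"
  by (auto simp: letter_def)

lemma set_fin: "set (fin c ty) \<subseteq> {1, 2}"
  using set_emit set_letters[of "encode_nat 1"] by (auto simp: fin_def subset_iff)

lemma set_copy_output: "set (out.copy_output W' G' x bs s) \<subseteq> {1, 2}"
  unfolding out.copy_output_def using set_emit set_fin set_letters[of "encode_nat 2"] by (auto simp: subset_iff)

lemma set_reduce: "set (reduce w) \<subseteq> {1, 2}"
  using set_copy_output unfolding reduce_def by fastforce

lemma produces_first_row: "produces True A (\<lambda>w. mark (first_row w))"
  unfolding first_row_def
proof (rule produces_row)
  show "produces True A (\<lambda>w. mark (content w))"
    unfolding content_def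
  proof (rule produces_pad_funpow)
    show "produces True A (\<lambda>w. mark (map letter w @ replicate l 3))"
      by (rule produces_start) (use A_props lj in auto)
    show "map letter w @ replicate l 3 \<noteq> []" for w using lj(2) by (cases l) auto
    show "1 \<le> f" if "f \<in> set (map letter w @ replicate l 3)" for f w using that by (auto simp: letter_def)
  qed (use A_props in auto)
  show "f \<in> {1, 2, 3}" if "f \<in> set (content w)" for w f using content_props(3)[OF that] .
  show "1 \<le> vcode f b \<and> 3 * vcode f b + 2 \<le> A" if "f \<in> {1, 2, 3}" for f b
    using vcode_le[OF that, of b] by (simp add: A_def F_def)
  show "1 \<le> scode" "3 * scode + 2 \<le> A" using scode_le by (simp_all add: A_def F_def)
qed (use A_props W_eq in auto)

definition grid_fixed :: "bool list \<Rightarrow> nat list" where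
  "grid_fixed w = concat (map (\<lambda>h. [1..<R] @ [if h < length (first_row w) then R + first_row w ! h else R])
     [0..<length (first_row w) * length (first_row w)])"

definition grid_moves :: "bool list \<Rightarrow> nat list" where
  "grid_moves w = map (out.move (length (first_row w)) 0) [0..<R * (length (first_row w) * length (first_row w))]"

lemma W_ge: "2 \<le> length (first_row w)"
  using W_eq[of w] by (simp add: width_def W_def[symmetric])

lemma length_grid_fixed: "length (grid_fixed w) = R * G w"
proof -
  have "map (\<lambda>h. length ([1..<R] @ [if h < length (first_row w) then R + first_row w ! h else R]))
      [0..<length (first_row w) * length (first_row w)] = map (\<lambda>_. R) [0..<G w]"
    using n_ge by (simp add: R_def G_def W_def)
  then show ?thesis
    unfolding grid_fixed_def length_concat map_map o_def by (simp add: sum_list_triv mult.commute del: map_eq_conv)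
qed

lemma length_grid_moves: "length (grid_moves w) = R * G w"
  by (simp add: grid_moves_def G_def W_def)

lemma produces_counted:
  "produces False A (\<lambda>w. track (grid_fixed w @ map (\<lambda>b. F + of_bool b) (count_bits w))
     (grid_moves w @ replicate (length (count_bits w)) 0))"
proof -
  let ?P = "\<lambda>a. 1 \<le> a div 3 \<and> a div 3 \<le> q"
  let ?b = "\<lambda>b. 3 * (F + of_bool b)"
  have "produces True A (\<lambda>w. grid R (first_row w))"
  proof (rule produces_grid[OF produces_first_row])
    show "1 \<le> f \<and> f \<le> c0 + 1" if "f \<in> set (first_row w)" for f w using first_row_le[OF that] .
  qed (use A_props W_ge n_ge in \<open>auto simp: R_def A_def F_def\<close>)
  then have "produces (\<not> True) A (\<lambda>w. grid R (first_row w) @ map ?b (bits (length (filter ?P (grid R (first_row w))))))"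
    by (rule produces_count) (auto simp: A_def F_def)
  moreover have "grid R (first_row w) @ map ?b (bits (length (filter ?P (grid R (first_row w))))) =
     track (grid_fixed w @ map (\<lambda>b. F + of_bool b) (count_bits w))
       (grid_moves w @ replicate (length (count_bits w)) 0)" for w
  proof -
    have "q < R" using q_Suc by (simp add: R_def)
    then have "length (filter ?P (grid R (first_row w))) = q * G w"
      by (simp only: length_filter_grid G_def W_def)
    moreover have "track (map (\<lambda>b. F + of_bool b) bs) (replicate (length bs) 0) = map ?b bs" for bs
      by (induction bs) auto
    moreover have "grid R (first_row w) = track (grid_fixed w) (grid_moves w)"
      unfolding grid_fixed_def grid_moves_def by (rule out.grid_eq_track[OF W_ge])
    ultimately show ?thesis
      using length_grid_fixed[of w] length_grid_moves[of w] by (simp add: track_append count_bits_def)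
  qed
  ultimately show ?thesis by simp
qed

lemma produces_reduce: "produces False A reduce"
proof -
  let ?fs = "\<lambda>w. grid_fixed w @ map (\<lambda>b. F + of_bool b) (count_bits w)"
  let ?ms = "\<lambda>w. grid_moves w @ replicate (length (count_bits w)) 0"
  have moves: "grid_moves w = 1 # map (out.move (length (first_row w)) 0)
      [1..<R * (length (first_row w) * length (first_row w))]" for w
  proof -
    have "0 < R * (length (first_row w) * length (first_row w))"
      using W_ge[of w] n_ge by (auto simp: R_def)
    then show ?thesis unfolding grid_moves_def by (simp add: upt_conv_Cons out.move_def)
  qed
  have "produces (\<not> False) A (\<lambda>w. shifts (?fs w) (?ms w))"
  proof (rule produces_shifts[OF produces_counted])
    show "length (?fs w) = length (?ms w)" for w
      using length_grid_fixed[of w] length_grid_moves[of w] by simp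
    show "1 \<le> f" if "f \<in> set (?fs w)" for f w
      using that n_ge by (auto simp: grid_fixed_def R_def F_def split: if_splits)
    show "?ms w \<noteq> []" "hd (?ms w) = 1" for w using moves[of w] by simp_all
    show "m = 0 \<or> m = 2" if "m \<in> set (list.tl (?ms w))" for m w
      using that unfolding moves by (auto simp: out.move_def)
  qed (use A_props in auto)
  then have "produces (\<not> True) A (\<lambda>w. let (q, os) = transduce out.out (0, None, 0, False, True) (shifts (?fs w) (?ms w)) in os @ (\<lambda>_. []) q)"
    unfolding not_False_eq_True
  proof (rule produces_transduce[where S = "{..2} \<times> insert None (Some ` {..<R}) \<times> {..2} \<times> UNIV \<times> UNIV"])
    have R: "1 \<le> R" using n_ge by (simp add: R_def)
    have "set (emit bs) \<subseteq> {1..A}" "set (fin c ty) \<subseteq> {1..A}" "set (map letter bs) \<subseteq> {1..A}" for bs c ty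
      using set_emit[of bs] set_fin[of c ty] set_letters[of bs] A_props by fastforce+
    then have "set (snd (out.out q a)) \<subseteq> {1..A}" for q a
      by (cases q) (simp add: out.out_def Let_def, use A_props in \<open>auto simp: letter_def subset_iff\<close>)
    moreover have "fst (out.out q a) \<in> {..2} \<times> insert None (Some ` {..<R}) \<times> {..2} \<times> UNIV \<times> UNIV"
      if q: "q \<in> {..2} \<times> insert None (Some ` {..<R}) \<times> {..2} \<times> UNIV \<times> UNIV" for q a
    proof -
      obtain c ty e u first where "q = (c, ty, e, u, first)" by (cases q)
      moreover have "min (a div 3) R - 1 < R" using R by simp
      ultimately show ?thesis using q by (simp add: out.out_def Let_def)
    qed
    ultimately show "fst (out.out q a) \<in> {..2} \<times> insert None (Some ` {..<R}) \<times> {..2} \<times> UNIV \<times> UNIV \<and>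
        set (snd (out.out q a)) \<subseteq> {1..A}"
      if "q \<in> {..2} \<times> insert None (Some ` {..<R}) \<times> {..2} \<times> UNIV \<times> UNIV" for q a
      using that by blast
  qed auto
  moreover have "snd (transduce out.out (0, None, 0, False, True) (shifts (?fs w) (?ms w))) = reduce w" for w
  proof -
    have "R + v < F" if "v \<in> set (first_row w)" for v
      using first_row_le[OF that] by (simp add: F_def)
    moreover have "R < F" by (simp add: F_def)
    ultimately show ?thesis
      using out.transduce_copies[OF W_ge, of w "count_bits w"]
      unfolding reduce_def grid_fixed_def[symmetric] grid_moves_def[symmetric]
      by (simp add: length_grid_fixed copies_def G_def W_def cell_codes_def[abs_def])
  qed
  ultimately show ?thesis by (simp add: case_prod_unfold)
qed

subsection \<open>Correctness of the reduction\<close>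

abbreviation tiling :: "bool list \<Rightarrow> (nat \<Rightarrow> (hcolour, vcolour) tile) \<Rightarrow> bool" where
  "tiling w \<equiv> helix (tiles M) (initial M, stays M) (row (lo w) (width w) (snd (init M w))) (G w)"

definition copy_type :: "bool list \<Rightarrow> nat \<Rightarrow> nat option" where
  "copy_type w s = (if s < R * G w then Some (s mod R) else None)"

lemma number_output:
  assumes "\<And>h. h < m \<Longrightarrow> c h < D ^ 3" "0 < y"
  shows "emit (concat (map (\<lambda>h. fixed_bits (3 * d) (c h)) [0..<m])) @ emit (bits y) @ [1] =
    map letter (encode_nat ((\<Sum>h<m. c h * (D ^ 3) ^ h) + (D ^ 3) ^ m * y))"
  using bits_blocks[of m c "3 * d" y] assms by (simp add: map_letter_encode_nat D_cube)

text \<open>Tiles may be listed more than once; any index of a tile translates a tiling into tile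
  numbers.\<close>

lemma helical_iff_helix:
  "(\<exists>x. tile_numbers.helical n (W w) (G w) l0 lcol rcol dcol ucol (sg w) x) \<longleftrightarrow>
   (\<exists>x. tiling w x)"
proof -
  interpret T: tile_numbers n C D "W w" "G w" l0 lcol rcol dcol ucol "sg w"
    by (rule tile_numbers_w)
  let ?row = "row (lo w) (width w) (snd (init M w))"
  have lr: "length ?row = W w" using W_eq by simp
  have sg: "sg w g = to_nat (?row ! g)" if "g < W w" for g
    using that lr by (simp add: sg_def first_row_eq)
  have G: "0 < G w" "W w \<le> G w" using T.W by auto
  show ?thesis
  proof
    assume "\<exists>x. T.helical x"
    then obtain x where x: "T.helical x" by blast
    then have lt: "x g < n" if "g < G w" for g using that by (simp add: T.helical_def)
    have "tiling w (\<lambda>g. tls ! x g)"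
      unfolding helix_def lr
    proof (intro conjI allI impI)
      show "tls ! x g \<in> tiles M" if "g < G w" for g
        using lt[OF that] tls(1) nth_mem by (fastforce simp: n_def)
    qed (use x[unfolded T.helical_def] sg G in \<open>auto simp: lcol_def rcol_def dcol_def ucol_def l0_def\<close>)
    then show "\<exists>x. tiling w x" by blast
  next
    assume "\<exists>x. tiling w x"
    then obtain X where X: "tiling w X" by blast
    have "\<exists>i<n. tls ! i = X g" if "g < G w" for g
    proof -
      have "X g \<in> set tls" using X that tls(1) by (simp add: helix_def)
      then show ?thesis unfolding n_def in_set_conv_nth .
    qed
    then obtain x where x: "\<And>g. g < G w \<Longrightarrow> x g < n \<and> tls ! (x g) = X g" by metis
    have "T.helical x"
      unfolding T.helical_def
    proof (intro conjI allI impI)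
      show "x g < n" if "g < G w" for g using x that by blast
      show "lcol (x 0) = l0" using x[OF G(1)] X by (simp add: lcol_def l0_def helix_def)
      show "rcol (x g) = lcol (x (Suc g))" if "Suc g < G w" for g
        using x[of g] x[of "Suc g"] X that by (simp add: lcol_def rcol_def helix_def)
      show "dcol (x g) = sg w g" if "g < W w" for g
        using x[of g] X that G sg[OF that] lr by (simp add: dcol_def helix_def)
      show "ucol (x g) = dcol (x (g + W w))" if "g + W w < G w" for g
        using x[of g] x[of "g + W w"] X that by (simp add: dcol_def ucol_def helix_def W_eq)
    qed
    then show "\<exists>x. T.helical x" by blast
  qed
qed

text \<open>Copy 0 writes the number of bins and the bound, copy 1 the filler as item 1, and each
  later copy \<open>s\<close> the item \<open>s\<close>, so the numbers of copies and items
  agree.\<close>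

lemma reduce_instance:
  "\<exists>x. reduce w = map letter (encode_nat 2 @ cds_encode x) \<and> x \<in> instances container_delivery \<and>
     ((\<exists>bins. cds_feasible x bins \<and> length bins \<le> 2) \<longleftrightarrow>
      (\<exists>x. tiling w x))"
proof -
  interpret T: tile_numbers n C D "W w" "G w" l0 lcol rcol dcol ucol "sg w"
    by (rule tile_numbers_w)
  \<comment> \<open>The base value just above all \<open>G w\<close> blocks: it exceeds
    \<open>T.bound\<close> and \<open>T.fill\<close>, and multiples of it are written behind the
    blocks.\<close>
  define Y where "Y = (D ^ 3) ^ G w"
  have Y: "0 < Y" using D_gt by (simp add: Y_def)
  have G: "1 \<le> G w" using T.W by simp
  have R: "2 * K < R" "2 \<le> K" "R - 2 * K = n" using n_ge by (simp_all add: R_def K_def)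
  define low where "low s h = (if s < R * G w \<and> 2 * K \<le> s mod R then T.block (s div R, s mod R - 2 * K) h else 0)" for s h
  define wt where "wt s = T.weight (s div R, s mod R - 2 * K)" for s
  define val where "val s = (if s < R * G w \<and> 2 * K \<le> s mod R then wt s else 0) + Y * leading (copy_type w s)" for s
  define bnd where "bnd = q * G w * Y + T.bound"
  define ds where "ds = (Y + T.fill) # map val [2..<copies w]"
  have div_less: "s div R < G w \<longleftrightarrow> s < R * G w" for s
    using R by (simp add: div_less_iff_less_mult mult.commute)
  have item: "(s div R, s mod R - 2 * K) \<in> T.items" if "s < R * G w" "2 * K \<le> s mod R" for s
  proof -
    have "s mod R < R" using R by simp
    then have "s mod R - 2 * K < n" using that(2) R by linarith
    then show ?thesis using that div_less by simp
  qed
  have leading: "0 < leading ty" for ty using q_ge by (auto simp: leading_def split: option.split)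
  have code: "(if R < cell_codes w h then Some (cell_codes w h - R) else None) =
      (if h < W w then Some (first_row w ! h) else None)" for h
    using first_row_le[OF nth_mem, of h w] by (auto simp: cell_codes_def W_def)
  have sums: "T.s1 h = fst (col_sums (h = 0) v)" "T.s2 h = snd (col_sums (h = 0) v)"
    "T.t1 h = fst (targets (h = 0) v)" "T.t2 h = snd (targets (h = 0) v)"
    if "v = (if h < W w then Some (first_row w ! h) else None)" for h v
    using that by (auto simp: T.s1_def T.s2_def T.t1_def T.t2_def T.all_l_def T.all_r_def T.all_d_def T.all_u_def
        col_sums_def targets_def sg_def)
  have cv0: "out.cell_value (W w) (cell_codes w) 0 h = T.cobound h" for h
    unfolding out.cell_value_def code T.cobound_def sums[OF refl] by (simp add: block_def)
  have cv1: "out.cell_value (W w) (cell_codes w) 1 h = T.cofill h" for h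
    unfolding out.cell_value_def code T.cofill_def sums[OF refl] by (simp add: block_def)
  have cv: "out.cell_value (W w) (cell_codes w) s h = low s h" if "2 \<le> s" "h < G w" for s h
  proof (cases "s div R \<le> h")
    case False
    then show ?thesis using that T.W
      by (auto simp: out.cell_value_def block_def low_def T.block_def T.e0_def T.e1_def T.e2_def)
  next
    case True
    then have "s < R * G w" using that(2) div_less by (meson le_less_trans)
    moreover have "min 2 (h - s div R) = 0 \<longleftrightarrow> h = s div R" "min 2 (h - s div R) = 1 \<longleftrightarrow> h = Suc (s div R)"
      using True by (auto simp: min_def)
    ultimately show ?thesis using that True T.W(1)
      by (auto simp: out.cell_value_def block_def low_def T.block_def T.e0_def T.e1_def T.e2_def)
  qed
  have low_less: "low s h < D ^ 3" if "h < G w" for s h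
    using T.block_less[OF item that] D_gt by (simp add: low_def)
  have val_eq: "val s = (\<Sum>h<G w. low s h * (D ^ 3) ^ h) + Y * leading (copy_type w s)" for s
  proof (cases "s < R * G w \<and> 2 * K \<le> s mod R")
    case True
    then show ?thesis by (simp add: val_def low_def wt_def T.weight_def)
  next
    case False
    then have "low s h = 0" for h unfolding low_def by (simp only: if_False)
    then show ?thesis using False unfolding val_def by (simp only: if_False) simp
  qed
  have copy0: "out.copy_output (W w) (G w) (cell_codes w) (count_bits w) 0 =
      map letter (encode_nat 2 @ encode_nat bnd @ encode_nat 1)"
  proof -
    have "0 < q * G w" using q_ge G by simp
    from number_output[where m = "G w" and c = T.cobound, OF T.cobound_less this]
    have "emit (concat (map (\<lambda>h. fixed_bits (3 * d) (T.cobound h)) [0..<G w])) @ emit (count_bits w) @ [1] =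
        map letter (encode_nat bnd)"
      by (simp add: count_bits_def bnd_def T.bound_def Y_def algebra_simps)
    then show ?thesis
      by (simp add: out.copy_output_def cv0 fin_def)
  qed
  have copy1: "out.copy_output (W w) (G w) (cell_codes w) (count_bits w) 1 = map letter (encode_nat (Y + T.fill))"
    using number_output[where m = "G w" and c = T.cofill and y = 1, OF T.cofill_less]
    by (simp add: out.copy_output_def cv1[unfolded One_nat_def] fin_def T.fill_def Y_def add.commute)
  have copy: "out.copy_output (W w) (G w) (cell_codes w) (count_bits w) s = map letter (encode_nat (val s))" if "2 \<le> s" for s
  proof -
    have lows: "map (\<lambda>h. fixed_bits (3 * d) (out.cell_value (W w) (cell_codes w) s h)) [0..<G w] =
        map (\<lambda>h. fixed_bits (3 * d) (low s h)) [0..<G w]"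
      using cv[OF that] by simp
    show ?thesis
      using number_output[where m = "G w" and c = "low s", OF low_less leading, of "copy_type w s"] that
      unfolding out.copy_output_def lows copy_type_def[symmetric]
      by (simp add: fin_def val_eq Y_def)
  qed
  have "2 \<le> R * G w" using R G by (metis le_trans mult_le_mono mult.right_neutral less_imp_le_nat mult_2 le_add1)
  then have c2: "2 \<le> copies w" "R * G w \<le> copies w" by (simp_all add: copies_def)
  then have "[0..<copies w] = 0 # 1 # [2..<copies w]"
    by (simp add: upt_conv_Cons numeral_2_eq_2)
  then have "reduce w = map letter (encode_nat 2 @ encode_nat bnd @ encode_nat 1) @
      map letter (encode_nat (Y + T.fill)) @
      concat (map (\<lambda>s. out.copy_output (W w) (G w) (cell_codes w) (count_bits w) s) [2..<copies w])"
    unfolding reduce_def using copy0 copy1 by simp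
  also have "map (\<lambda>s. out.copy_output (W w) (G w) (cell_codes w) (count_bits w) s) [2..<copies w] =
      map (\<lambda>s. map letter (encode_nat (val s))) [2..<copies w]"
    using copy by simp
  finally have out_eq: "reduce w = map letter (encode_nat 2 @ cds_encode (ds, of_nat bnd))"
    by (simp add: ds_def map_concat o_def quotient_of_int[of "int bnd", simplified])
  have val_pos: "0 < val s" for s using leading Y by (simp add: val_def)
  have "bnd > 0" using q_ge G Y by (simp add: bnd_def)
  then have inst: "(ds, of_nat bnd) \<in> instances container_delivery"
    using val_pos Y by (auto simp: container_delivery_def ds_def)
  \<comment> \<open>The cluster at \<open>Y\<close> takes the residues below \<open>K\<close> and
    all copies beyond the grid, except copies 0 and 1, which are used up by the bound and the
    filler.\<close>
  define I0 where "I0 = {s \<in> {2..<copies w}. \<not> (s < R * G w \<and> K \<le> s mod R)}"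
  define I1 where "I1 = {s. s < R * G w \<and> s mod R \<in> {K..<2 * K}}"
  define J where "J = {s. s < R * G w \<and> s mod R \<in> {2 * K..<R}}"
  have modR: "s mod R < R" for s using R by simp
  \<comment> \<open>Since \<open>2 \<le> K\<close>, the copies 0 and 1 have residues below
    \<open>K\<close>, so \<open>I1\<close> and \<open>J\<close> lose nothing.\<close>
  have big: "2 \<le> s" if "K \<le> s mod R" for s
    using that R mod_less_eq_dividend[of s R] by linarith
  have due: "due_time ds s = val s" if s: "2 \<le> s" "s < copies w" for s
  proof -
    obtain s' where "s = 2 + s'" using le_Suc_ex[OF s(1)] by blast
    then show ?thesis using s by (simp add: due_time_def ds_def)
  qed
  have bijJ: "bij_betw (\<lambda>s. (s div R, s mod R - 2 * K)) J T.items"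
  proof -
    have "bij_betw (\<lambda>s. (s div R, s mod R)) J ({..<G w} \<times> {2 * K..<R})"
      unfolding J_def by (rule bij_betw_div_mod) auto
    moreover have "bij_betw (\<lambda>(g, i). (g, i - 2 * K)) ({..<G w} \<times> {2 * K..<R}) T.items"
      by (rule bij_betw_byWitness[where f' = "\<lambda>(g, i). (g, i + 2 * K)"]) (use R in auto)
    ultimately have "bij_betw ((\<lambda>(g, i). (g, i - 2 * K)) \<circ> (\<lambda>s. (s div R, s mod R))) J T.items"
      by (rule bij_betw_trans)
    then show ?thesis by (simp add: o_def)
  qed
  have card_mod: "card {s. s < R * G w \<and> s mod R \<in> X} = G w * card X" if "X \<subseteq> {..<R}" for X
    using bij_betw_same_card[OF bij_betw_div_mod[OF that, of "G w"]] by (simp add: card_cartesian_product)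
  interpret two_bins ds q "G w" Y T.bound T.fill I0 I1 J 1 wt
  proof
    show "{1..length ds} = I0 \<union> I1 \<union> J \<union> {1}"
    proof -
      have "length ds = copies w - 1" using c2 by (simp add: ds_def)
      moreover have "{1..copies w - 1} = {2..<copies w} \<union> {1}" using c2 by auto
      moreover have "{2..<copies w} = I0 \<union> I1 \<union> J"
        using c2 modR big R by (auto simp: I0_def I1_def J_def not_less intro: order.strict_trans2)
      ultimately show ?thesis by simp
    qed
    show "I0 \<inter> I1 = {}" "I0 \<inter> J = {}" "I1 \<inter> J = {}" by (auto simp: I0_def I1_def J_def)
    show "1 \<notin> I0" "1 \<notin> I1" "1 \<notin> J" using R big[of 1] by (auto simp: I0_def I1_def J_def)
    show "due_time ds s = Y" if "s \<in> I0" for s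
      using that due[of s] by (auto simp: I0_def val_def leading_def copy_type_def)
    show "due_time ds s = q * Y" if "s \<in> I1" for s
      using that due[of s] big[of s] c2 by (auto simp: I1_def val_def leading_def copy_type_def)
    show "due_time ds s = (q + 1) * Y + wt s" if "s \<in> J" for s
      using that due[of s] big[of s] c2 by (auto simp: J_def val_def leading_def copy_type_def)
    show "due_time ds 1 = Y + T.fill" by (simp add: due_time_def ds_def)
    show "card J = (q + 1) * G w"
      using card_mod[of "{2 * K..<R}"] R q_Suc by (simp add: J_def subset_iff mult.commute)
    show "2 * ((q + 1) * G w + 1) \<le> card I1"
    proof -
      have "card I1 = G w * K" using card_mod[of "{K..<2 * K}"] R by (simp add: I1_def subset_iff)
      then show ?thesis using G unfolding q_Suc K_def by (simp add: algebra_simps)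
    qed
    \<comment> \<open>Without copies 0 and 1 at least \<open>G w * K - 2\<close> items are left; the
      summand 4 in \<open>K\<close> makes up for this and for the 2 on the left, as
      \<open>1 \<le> G w\<close>.\<close>
    show "2 * ((q + 1) * G w + 1) \<le> card I0"
    proof -
      let ?Z = "{s. s < R * G w \<and> s mod R \<in> {..<K}}"
      have "card ?Z = G w * K" using card_mod[of "{..<K}"] R by (simp add: subset_iff)
      moreover have "?Z - {0, 1} \<subseteq> I0" using c2 by (auto simp: I0_def)
      then have "card (?Z - {0, 1}) \<le> card I0" by (rule card_mono[rotated]) (simp add: I0_def)
      moreover have "card ?Z - card {0 :: nat, 1} \<le> card (?Z - {0, 1})"
        by (rule diff_card_le_card_Diff) simp
      ultimately show ?thesis using G unfolding q_Suc K_def by (simp add: algebra_simps)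
    qed
    show "2 * T.bound = sum wt J + T.fill"
      using T.total_eq sum.reindex_bij_betw[OF bijJ, of T.weight] by (simp add: wt_def)
    show "T.bound < Y" "T.fill < Y" using T.bound_less T.fill_less by (simp_all add: Y_def)
  qed (use q_ge G in auto)
  have "(\<exists>bins. cds_feasible (ds, of_nat bnd) bins \<and> length bins \<le> 2) \<longleftrightarrow>
      (\<exists>S \<subseteq> J. card S = G w \<and> sum wt S + T.fill = T.bound)"
    using feasible_iff_subset by (simp only: B_def bnd_def)
  also have "\<dots> \<longleftrightarrow> (\<exists>S \<subseteq> T.items. card S = G w \<and> sum T.weight S + T.fill = T.bound)"
    unfolding wt_def by (rule ex_subset_bij[OF bijJ])
  also have "\<dots> \<longleftrightarrow> (\<exists>x. T.helical x)" by (rule T.helical_iff_subset[symmetric])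
  also note helical_iff_helix
  finally show ?thesis using out_eq inst by blast
qed

text \<open>The content is longer than the running time, so both margins of the window hold every
  head position. The grid is square, hence has \<open>W w\<close> rows, which is at least
  \<open>poly P (length w) + 2\<close>.\<close>

lemma accepts_iff_helix:
  "(\<exists>c. (step M)\<^sup>*\<^sup>* (init M w) c \<and> fst c = accept M) \<longleftrightarrow>
   (\<exists>x. tiling w x)"
proof
  let ?P = "poly P (length w)"
  obtain m where m: "length (content w) = ?P + 2 + m" using content_props(2) le_Suc_ex by blast
  have lo: "lo w = ?P + 3 + m" unfolding lo_def m by simp
  have width: "lo w + ?P + 2 \<le> width w"
  proof -
    have "2 * (length (content w) + 1) \<le> width w"
      unfolding width_def using W_eq(2)[of w] by (rule mult_le_mono1)
    then show ?thesis unfolding lo m by simp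
  qed
  {
    assume "\<exists>c. (step M)\<^sup>*\<^sup>* (init M w) c \<and> fst c = accept M"
    then obtain N c where c: "(step M ^^ N) (init M w) c" "fst c = accept M"
      by (meson rtranclp_imp_relpowp)
    then have "N \<le> ?P" using bound_P by blast
    then show "\<exists>x. tiling w x"
      using helix_complete[OF M c] lo width by simp
  next
    assume "\<exists>x. tiling w x"
    then obtain x where x: "tiling w x"
      by blast
    have "(?P + 2) * Suc (width w) \<le> G w"
      unfolding G_def W_eq using width by (intro mult_le_mono1) simp
    then show "\<exists>c. (step M)\<^sup>*\<^sup>* (init M w) c \<and> fst c = accept M"
      using helix_sound[OF M bound_P _ width _ x] lo by simp
  }
qed

lemma poly_reducible_accepted:
  assumes "\<And>w. w \<in> L \<longleftrightarrow> (\<exists>c. (step M)\<^sup>*\<^sup>* (init M w) c \<and> fst c = accept M)"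
  shows "poly_reducible L (decision_problem container_delivery)"
  unfolding poly_reducible_def
proof (intro exI conjI allI)
  show "poly_time_computable (\<lambda>w. map (\<lambda>x. x = 2) (reduce w))"
    using produces_final[OF produces_reduce set_reduce] .
  fix w
  obtain x where x: "reduce w = map letter (encode_nat 2 @ cds_encode x)" "x \<in> instances container_delivery"
    "(\<exists>bins. cds_feasible x bins \<and> length bins \<le> 2) \<longleftrightarrow>
      (\<exists>x. tiling w x)"
    using reduce_instance by blast
  have "map (\<lambda>x. x = 2) (reduce w) = encode_nat 2 @ cds_encode x"
    unfolding x(1) by (simp add: letter_def o_def)
  then show "w \<in> L \<longleftrightarrow> map (\<lambda>x. x = 2) (reduce w) \<in> decision_problem container_delivery"
    using decision_iff_feasible[OF x(2)] x(3) accepts_iff_helix assms by simp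
qed

end

theorem theorem2: "NP_hard_minimization container_delivery"
  unfolding NP_hard_minimization_def NP_hard_def
proof
  fix L assume "L \<in> NP"
  then obtain M and P :: "nat poly" where M: "turing_machine M"
    "\<And>w r c. (step M ^^ r) (init M w) c \<Longrightarrow> r \<le> poly P (length w)"
    and L: "\<And>w. w \<in> L \<longleftrightarrow> (\<exists>c. (step M)\<^sup>*\<^sup>* (init M w) c \<and> fst c = accept M)"
    unfolding NP_def by blast
  obtain ts where ts: "set ts = tiles M" using finite_list[OF finite_tiles[OF M(1)]] by blast
  have "Tile (idle M, stays M) (idle M, stays M) None None \<in> state_tiles M"
    by (rule state_tilesI[OF M(1)]) (simp_all add: idle_def[OF M(1)])
  then have "ts \<noteq> []" using ts by (auto simp: tiles_def[OF M(1)])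
  then have "1 \<le> length ts" by (simp add: Suc_le_eq)
  \<comment> \<open>Listing every tile four times provides the four tiles that the digit estimates
    require without changing which tilings exist.\<close>
  then have tls: "set (ts @ ts @ ts @ ts) = tiles M" "4 \<le> length (ts @ ts @ ts @ ts)"
    by (simp_all add: ts)
  let ?cols = "(\<lambda>t. to_nat (lft t)) ` tiles M \<union> (\<lambda>t. to_nat (rgt t)) ` tiles M \<union>
     (\<lambda>t. to_nat (dwn t)) ` tiles M \<union> (\<lambda>t. to_nat (upp t)) ` tiles M \<union>
     {to_nat (initial M, stays M), to_nat (None :: vcolour)} \<union>
     (\<lambda>(f, b). to_nat (Some ((f, b) # replicate (tapes M - 1) (0, b)) :: vcolour)) ` ({..2} \<times> UNIV)"
  have "finite ?cols" using finite_tiles[OF M(1)] by simp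
  then obtain c0 where "\<forall>x\<in>?cols. x \<le> c0" by (meson finite_nat_set_iff_bounded_le)
  then have c0: "\<And>x. x \<in> ?cols \<Longrightarrow> x \<le> c0" by blast
  have c0': "to_nat (Some ((f, b) # replicate (tapes M - 1) (0, b)) :: vcolour) \<le> c0"
    if "f \<le> 2" for f b
    by (rule c0, rule UnI2, rule image_eqI[where x = "(f, b)"]) (use that in simp_all)
  \<comment> \<open>The 2 is the margin by which the content has to exceed the running time;
    enlarging \<open>l\<close> afterwards makes it positive.\<close>
  obtain l j where "\<And>n. poly (P + [:2:]) n \<le> (n + l) ^ 2 ^ j" using poly_le_power by blast
  then have "poly P n + 2 \<le> (n + l) ^ 2 ^ j" for n by simp
  moreover have "(n + l) ^ 2 ^ j \<le> (n + (l + 1)) ^ 2 ^ j" for n by (rule power_mono) simp_all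
  ultimately have lj: "poly P n + 2 \<le> (n + (l + 1)) ^ 2 ^ j" for n by (rule order.trans)
  interpret reduction M "ts @ ts @ ts @ ts" P c0 "l + 1" j
  proof
    show "to_nat (lft t) \<le> c0 \<and> to_nat (rgt t) \<le> c0 \<and> to_nat (dwn t) \<le> c0 \<and> to_nat (upp t) \<le> c0"
      if "t \<in> tiles M" for t
      using that by (intro conjI c0) blast+
    show "to_nat (initial M, stays M) \<le> c0" "to_nat (None :: vcolour) \<le> c0"
      by (rule c0, blast)+
  qed (fact M tls lj c0' | simp)+
  show "poly_reducible L (decision_problem container_delivery)"
    by (rule poly_reducible_accepted[OF L])
qed

end
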